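(* Let $X$ be a time frequency shifts invariant space, with associated polynomial weight function $v$ on $\mathbb R^{2d}$ and constant $C>0$, i.e. $\|\pi_zu\|_X\le C\,v(z)\|u\|_X$ for all $u\in X$, $z\in\mathbb R^{2d}$. Let $L\in GL(2d)$ and $p\in\mathcal D'(\mathbb T^{2d}_L)$. Assume that the Fourier coefficients $c_\kappa(p)$, $\kappa\in\mathbb Z^{2d}$, of $p$ satisfy $$c_0(p)\ne0\quad\text{and}\quad\sum_{\kappa\in\mathbb Z^{2d}\setminus\{0\}}|c_\kappa(p)|\,v(\mathcal JL^{-T}\kappa)<\frac{|c_0(p)|}{C}.$$ Then for any $0\le\tau\le1$: (i) the operator $\mathrm{Op}_\tau(p)$ is invertible in $\mathcal L(X)$; (ii) the norm in $\mathcal L(X)$ of the inverse operator satisfies $$\|(\mathrm{Op}_\tau(p))^{-1}\|_{\mathcal L(X)}\le\frac{1}{(1+Cv(0))\,|c_0(p)|-C\,\|c_\kappa(p)\|_{\ell^1_{L,v}}},$$ where $\|c_\kappa(p)\|_{\ell^1_{L,v}}:=\sum_{\kappa\in\mathbb Z^{2d}}v(\mathcal JL^{-T}\kappa)\,|c_\kappa(p)|$.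
   Context: $GL(n)$ denotes the invertible real $n\times n$ matrices; $L^{-T}:=(L^{-1})^T$; $\langle x,y\rangle=x\cdot y$ is the Euclidean inner product; $\mathcal J=\begin{pmatrix}0&-I\\ I&0\end{pmatrix}\in GL(2d)$ with $d\times d$ blocks. Time frequency shifts. For $z=(x,\omega)\in\mathbb R^d\times\mathbb R^d$, $\pi_zf(t)=M_\omega T_xf(t)=e^{2\pi i\omega\cdot t}f(t-x)$, extended to distributions. Polynomial weight function: $v(z)=(1+|z|^2)^{s/2}$ for some $s\ge0$. Time frequency shifts invariant (tfs invariant) space: a Banach space $X$ with continuous embeddings $\mathcal S(\mathbb R^d)\hookrightarrow X\hookrightarrow\mathcal S'(\mathbb R^d)$, with $\mathcal S(\mathbb R^d)$ dense in $X$, such that for some polynomial weight function $v$ on $\mathbb R^{2d}$ and some $C>0$, $\|\pi_zu\|_X\le C\,v(z)\|u\|_X$ for all $u\in X$, $z\in\mathbb R^{2d}$. Periodic distributions. For $L\in GL(n)$, $\mathbb T^n_L=\mathbb R^n/L\mathbb Z^n$, and $\mathcal D'(\mathbb T^n_L)$ is identified with the space of $L$-periodic distributions: those $u\in\mathcal D'(\mathbb R^n)$ invariant under translation by $L\kappa$ for all $\kappa\in\mathbb Z^n$ (these are automatically tempered). The Fourier coefficients of $u\in\mathcal D'(\mathbb T^n_L)$ are $$c_\kappa(u)=\frac1{|\det L|}\langle u,e^{-2\pi i\langle L^{-T}\kappa,\cdot\rangle}\rangle_{\mathbb T^n_L}=\langle u(L\,\cdot),\phi\,e^{-2\pi i\langle\cdot,\kappa\rangle}\rangle,\qquad\kappa\in\mathbb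 Z^n,$$ where in the last expression the pairing is the bilinear distributional one on $\mathbb R^n$ and $\phi\in C_0^\infty(\mathbb R^n)$ is any function with $\sum_{\kappa\in\mathbb Z^n}\phi(x-\kappa)=1$ for all $x$ (the value does not depend on $\phi$). Pseudodifferential operators. For $0\le\tau\le1$ and $p\in\mathcal S'(\mathbb R^{2d})$, $\mathrm{Op}_\tau(p):\mathcal S(\mathbb R^d)\to\mathcal S'(\mathbb R^d)$ is given by $$\mathrm{Op}_\tau(p)u(x)=\int_{\mathbb R^d}\int_{\mathbb R^d}e^{2\pi i(x-y)\cdot\omega}\,p\big((1-\tau)x+\tau y,\omega\big)\,u(y)\,dy\,d\omega,$$ understood in the distribution sense, i.e. $\mathrm{Op}_\tau(p)$ is the operator with distributional Schwartz kernel $K(x,y)=(\mathcal F_2^{-1}p)((1-\tau)x+\tau y,\,x-y)$, where $\mathcal F_2^{-1}$ is the inverse Fourier transform in the second $d$ variables, with $\mathcal F f(\omega)=\int f(x)e^{-2\pi i x\cdot\omega}\,dx$. $\mathcal L(X)$ is the Banach algebra of bounded linear operators on $X$ with the operator norm. $\mathrm{Op}_\tau(p)$, defined on $\mathcal S(\mathbb R^d)$, is regarded as an element of $\mathcal L(X)$ through its unique bounded extension to $X$ (part of the assertion is that this extension exists). *)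

theory Defs
  imports "HOL-Analysis.Analysis"
begin

section \<open>Test functions and Schwartz functions\<close>

primrec partial_derivs :: "'n list \<Rightarrow> (real^'n \<Rightarrow> complex) \<Rightarrow> real^'n \<Rightarrow> complex" where
  "partial_derivs [] f = f"
| "partial_derivs (i # is) f =
     (\<lambda>x. frechet_derivative (partial_derivs is f) (at x) (axis i 1))"

text \<open>Differentiability of the iterated partial derivatives of every order makes all of them
  continuous, so this is the class of infinitely differentiable functions.\<close>

definition smooth_fun :: "(real^'n \<Rightarrow> complex) \<Rightarrow> bool" where
  "smooth_fun f \<longleftrightarrow> (\<forall>is x. partial_derivs is f differentiable (at x))"

definition test_functions :: "(real^'n \<Rightarrow> complex) set" where
  "test_functions = {f. smooth_fun f \<and> compact (closure {x. f x \<noteq> 0})}"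

definition schwartz_functions :: "(real^'n \<Rightarrow> complex) set" where
  "schwartz_functions = {f. smooth_fun f \<and>
     (\<forall>k is. bounded (range (\<lambda>x. (1 + norm x) ^ k *\<^sub>R partial_derivs is f x)))}"

text \<open>The seminorms for \<open>k = m\<close> define the topology of the Schwartz space; those for \<open>k = 0\<close>
  define the topology of the test functions supported in a fixed compact set.\<close>

definition weighted_seminorm :: "nat \<Rightarrow> nat \<Rightarrow> (real^'n \<Rightarrow> complex) \<Rightarrow> real" where
  "weighted_seminorm k m f =
     (\<Sum>is | length is \<le> m. SUP x. (1 + norm x) ^ k * norm (partial_derivs is f x))"


section \<open>Distributions\<close>

text \<open>Distributions are linear functionals on a set of functions. They are taken to be zero
  outside that set, so that equality of distributions is equality of HOL functions. Pairings are
  bilinear.\<close>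

type_synonym 'n functional = "(real^'n \<Rightarrow> complex) \<Rightarrow> complex"

definition linear_functional_on :: "(real^'n \<Rightarrow> complex) set \<Rightarrow> 'n functional \<Rightarrow> bool" where
  "linear_functional_on F u \<longleftrightarrow>
     (\<forall>f\<in>F. \<forall>g\<in>F. u (\<lambda>x. f x + g x) = u f + u g) \<and>
     (\<forall>a. \<forall>f\<in>F. u (\<lambda>x. a * f x) = a * u f) \<and>
     (\<forall>f. f \<notin> F \<longrightarrow> u f = 0)"

definition distributions :: "'n::finite functional set" where
  "distributions = {u. linear_functional_on test_functions u \<and>
     (\<forall>K. compact K \<longrightarrow> (\<exists>B m. \<forall>f\<in>test_functions. {x. f x \<noteq> 0} \<subseteq> K \<longrightarrow>
        norm (u f) \<le> B * weighted_seminorm 0 m f))}"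

definition tempered_distributions :: "'n::finite functional set" where
  "tempered_distributions = {u. linear_functional_on schwartz_functions u \<and>
     (\<exists>B m. \<forall>f\<in>schwartz_functions. norm (u f) \<le> B * weighted_seminorm m m f)}"

text \<open>The test functions are dense in the Schwartz functions, so a distribution has at most one
  tempered extension. A periodic distribution has one.\<close>

definition tempered_extension :: "'n::finite functional \<Rightarrow> 'n functional" where
  "tempered_extension u =
     (THE w. w \<in> tempered_distributions \<and> (\<forall>f\<in>test_functions. w f = u f))"

definition dist_of_fun :: "(real^'n::finite \<Rightarrow> complex) \<Rightarrow> 'n functional" where
  "dist_of_fun f = (\<lambda>g. if g \<in> schwartz_functions then (\<integral>x. f x * g x \<partial>lborel) else 0)"

definition dist_translate :: "real^'n \<Rightarrow> 'n functional \<Rightarrow> 'n functional" where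
  "dist_translate a u = (\<lambda>f. u (\<lambda>t. f (t + a)))"

definition dist_modulate :: "real^'n \<Rightarrow> 'n functional \<Rightarrow> 'n functional" where
  "dist_modulate w u = (\<lambda>f. u (\<lambda>t. cis (2 * pi * (w \<bullet> t)) * f t))"

text \<open>The distribution \<open>u(M \<cdot>)\<close>, for an invertible matrix \<open>M\<close>.\<close>

definition dist_compose :: "'n::finite functional \<Rightarrow> real^'n^'n \<Rightarrow> 'n functional" where
  "dist_compose u M =
     (\<lambda>f. u (\<lambda>x. f (matrix_inv M *v x)) / complex_of_real \<bar>det M\<bar>)"


section \<open>Periodic distributions and their Fourier coefficients\<close>

definition of_int_vec :: "int^'n \<Rightarrow> real^'n" where
  "of_int_vec \<kappa> = (\<chi> i. real_of_int (\<kappa> $ i))"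

definition periodic_distributions :: "real^'n^'n \<Rightarrow> 'n::finite functional set" where
  "periodic_distributions L =
     {u \<in> distributions. \<forall>\<kappa>. dist_translate (L *v of_int_vec \<kappa>) u = u}"

definition periodic_partition :: "(real^'n \<Rightarrow> complex) \<Rightarrow> bool" where
  "periodic_partition \<phi> \<longleftrightarrow>
     \<phi> \<in> test_functions \<and> (\<forall>x. ((\<lambda>\<kappa>. \<phi> (x - of_int_vec \<kappa>)) has_sum 1) UNIV)"

text \<open>For \<open>L\<close>-periodic \<open>u\<close> the value does not depend on the choice of \<open>\<phi>\<close>.\<close>

definition fourier_coeff :: "real^'n^'n \<Rightarrow> 'n::finite functional \<Rightarrow> int^'n \<Rightarrow> complex" where
  "fourier_coeff L u \<kappa> =
     (let \<phi> = (SOME \<phi>. periodic_partition \<phi>)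
      in dist_compose u L (\<lambda>x. \<phi> x * cis (- 2 * pi * (x \<bullet> of_int_vec \<kappa>))))"


section \<open>Phase space\<close>

text \<open>Phase space \<open>\<real>\<^sup>d \<times> \<real>\<^sup>d\<close> is \<open>real^('d+'d)\<close>; the components with index \<open>Inl i\<close>
  are those of the first factor.\<close>

definition join :: "real^'d::finite \<Rightarrow> real^'d \<Rightarrow> real^('d+'d)" where
  "join x w = (\<chi> k. case k of Inl i \<Rightarrow> x $ i | Inr i \<Rightarrow> w $ i)"

definition fst_part :: "real^('d::finite+'d) \<Rightarrow> real^'d" where
  "fst_part z = (\<chi> i. z $ Inl i)"

definition snd_part :: "real^('d::finite+'d) \<Rightarrow> real^'d" where
  "snd_part z = (\<chi> i. z $ Inr i)"

definition symplectic_J :: "real^('d::finite+'d)^('d+'d)" where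
  "symplectic_J = (\<chi> k l. case (k, l) of
       (Inl i, Inr j) \<Rightarrow> if i = j then - 1 else 0
     | (Inr i, Inl j) \<Rightarrow> if i = j then 1 else 0
     | _ \<Rightarrow> 0)"

definition tf_shift :: "real^('d::finite+'d) \<Rightarrow> 'd functional \<Rightarrow> 'd functional" where
  "tf_shift z u = dist_modulate (snd_part z) (dist_translate (fst_part z) u)"

definition polynomial_weight :: "(real^'n \<Rightarrow> real) \<Rightarrow> bool" where
  "polynomial_weight v \<longleftrightarrow> (\<exists>s\<ge>0. \<forall>z. v z = (1 + (norm z)\<^sup>2) powr (s / 2))"


section \<open>Banach spaces of tempered distributions\<close>

text \<open>\<open>N\<close> is the norm of the complex Banach space \<open>X\<close>; its values outside \<open>X\<close> are irrelevant.\<close>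

definition banach_space_on :: "'n functional set \<Rightarrow> ('n functional \<Rightarrow> real) \<Rightarrow> bool" where
  "banach_space_on X N \<longleftrightarrow>
     (\<lambda>f. 0) \<in> X \<and>
     (\<forall>u\<in>X. \<forall>w\<in>X. (\<lambda>f. u f + w f) \<in> X) \<and>
     (\<forall>a. \<forall>u\<in>X. (\<lambda>f. a * u f) \<in> X) \<and>
     (\<forall>u\<in>X. 0 \<le> N u \<and> (N u = 0 \<longleftrightarrow> u = (\<lambda>f. 0))) \<and>
     (\<forall>u\<in>X. \<forall>w\<in>X. N (\<lambda>f. u f + w f) \<le> N u + N w) \<and>
     (\<forall>a. \<forall>u\<in>X. N (\<lambda>f. a * u f) = norm a * N u) \<and>
     (\<forall>\<sigma>. (\<forall>n. \<sigma> n \<in> X) \<and>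
          (\<forall>\<epsilon>>0. \<exists>M::nat. \<forall>m\<ge>M. \<forall>n\<ge>M. N (\<lambda>f. \<sigma> m f - \<sigma> n f) < \<epsilon>) \<longrightarrow>
          (\<exists>u\<in>X. (\<lambda>n. N (\<lambda>f. \<sigma> n f - u f)) \<longlonglongrightarrow> 0))"

text \<open>Continuity of the inclusion into the tempered distributions is with respect to the weak-*
  topology.\<close>

definition tfs_invariant ::
    "'d::finite functional set \<Rightarrow> ('d functional \<Rightarrow> real) \<Rightarrow> (real^('d+'d) \<Rightarrow> real) \<Rightarrow> real \<Rightarrow> bool" where
  "tfs_invariant X N v C \<longleftrightarrow>
     banach_space_on X N \<and>
     X \<subseteq> tempered_distributions \<and>
     (\<forall>f\<in>schwartz_functions. \<exists>B. \<forall>u\<in>X. norm (u f) \<le> B * N u) \<and>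
     dist_of_fun ` schwartz_functions \<subseteq> X \<and>
     (\<exists>B m. \<forall>f\<in>schwartz_functions. N (dist_of_fun f) \<le> B * weighted_seminorm m m f) \<and>
     (\<forall>u\<in>X. \<forall>\<epsilon>>0. \<exists>f\<in>schwartz_functions. N (\<lambda>g. u g - dist_of_fun f g) < \<epsilon>) \<and>
     polynomial_weight v \<and> C > 0 \<and>
     (\<forall>u\<in>X. \<forall>z. tf_shift z u \<in> X \<and> N (tf_shift z u) \<le> C * v z * N u)"

definition bounded_operators ::
    "'n functional set \<Rightarrow> ('n functional \<Rightarrow> real) \<Rightarrow> ('n functional \<Rightarrow> 'n functional) set" where
  "bounded_operators X N = {A \<in> X \<rightarrow>\<^sub>E X.
     (\<forall>u\<in>X. \<forall>w\<in>X. A (\<lambda>f. u f + w f) = (\<lambda>f. A u f + A w f)) \<and>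
     (\<forall>a. \<forall>u\<in>X. A (\<lambda>f. a * u f) = (\<lambda>f. a * A u f)) \<and>
     (\<exists>B. \<forall>u\<in>X. N (A u) \<le> B * N u)}"

definition operator_norm ::
    "'n functional set \<Rightarrow> ('n functional \<Rightarrow> real) \<Rightarrow> ('n functional \<Rightarrow> 'n functional) \<Rightarrow> real" where
  "operator_norm X N A = (SUP u\<in>{u \<in> X. N u \<le> 1}. N (A u))"

definition extends_schwartz_operator ::
    "('n::finite functional \<Rightarrow> 'n functional) \<Rightarrow> ((real^'n \<Rightarrow> complex) \<Rightarrow> 'n functional) \<Rightarrow> bool" where
  "extends_schwartz_operator A T \<longleftrightarrow> (\<forall>f\<in>schwartz_functions. A (dist_of_fun f) = T f)"


section \<open>Pseudodifferential operators\<close>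

definition inv_fourier_snd ::
    "(real^('d::finite+'d) \<Rightarrow> complex) \<Rightarrow> real^('d+'d) \<Rightarrow> complex" where
  "inv_fourier_snd \<Psi> z =
     (\<integral>w. \<Psi> (join (fst_part z) w) * cis (2 * pi * (w \<bullet> snd_part z)) \<partial>lborel)"

text \<open>With respect to the bilinear pairing, the partial inverse Fourier transform is its own
  transpose.\<close>

definition dist_inv_fourier_snd :: "('d::finite+'d) functional \<Rightarrow> ('d+'d) functional" where
  "dist_inv_fourier_snd p =
     (\<lambda>\<Psi>. if \<Psi> \<in> schwartz_functions then p (inv_fourier_snd \<Psi>) else 0)"

definition kernel_matrix :: "real \<Rightarrow> real^('d::finite+'d)^('d+'d)" where
  "kernel_matrix \<tau> = matrix (\<lambda>z. join ((1 - \<tau>) *\<^sub>R fst_part z + \<tau> *\<^sub>R snd_part z)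
                                        (fst_part z - snd_part z))"

definition op_kernel :: "real \<Rightarrow> ('d::finite+'d) functional \<Rightarrow> ('d+'d) functional" where
  "op_kernel \<tau> p = dist_compose (dist_inv_fourier_snd p) (kernel_matrix \<tau>)"

definition Op ::
    "real \<Rightarrow> ('d::finite+'d) functional \<Rightarrow> (real^'d \<Rightarrow> complex) \<Rightarrow> 'd functional" where
  "Op \<tau> p f = (\<lambda>g. if g \<in> schwartz_functions
                   then op_kernel \<tau> p (\<lambda>z. g (fst_part z) * f (snd_part z)) else 0)"

end

theory Submission
  imports Defs "HOL-Probability.Sinc_Integral" "HOL-Probability.Characteristic_Functions"
begin

text \<open>Quantization turns a character into a time frequency shift: up to a factor of modulus 1, \<open>Op \<tau>\<close> sends
  \<open>e\<^sub>\<zeta>(z) = exp (2 \<pi> i \<zeta> \<bullet> z)\<close> to \<open>tf_shift (symplectic_J *v \<zeta>)\<close> (\<open>Op_character\<close>). The symbol is the sum of its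
  Fourier series \<open>\<Sum>\<kappa>. c \<kappa> * e\<^sub>\<zeta>\<close> with \<open>\<zeta> = L\<^sup>-\<^sup>T \<kappa>\<close>, so \<open>Op \<tau> p\<close> is a series of time frequency shifts. The
  shift with index \<open>\<kappa>\<close> has norm at most \<open>C * w \<kappa>\<close> on \<open>X\<close>. The hypothesis says that
  the terms with \<open>\<kappa> \<noteq> 0\<close> have total norm at most \<open>r * \<bar>c 0\<bar>\<close> with \<open>r < 1\<close>; hence \<open>Op \<tau> p = c 0 * (1 - Q)\<close>, where \<open>Q\<close> has norm at most \<open>r\<close>, and the Neumann series inverts it with
  norm at most \<open>1 / (\<bar>c 0\<bar> * (1 - r))\<close> (\<open>neumann_inverse\<close>). This is the asserted bound, because the term \<open>\<kappa> = 0\<close>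
  of the weighted norm of the coefficients is \<open>v 0 * \<bar>c 0\<bar>\<close>.

  Three facts carry the argument.

  First, \<open>p\<close> is a distribution, and it has to be shown that its tempered extension is the absolutely convergent
  series of characters. The difference of the two is a periodic functional whose Fourier coefficients vanish. It
  vanishes on the products of a partition of unity with trigonometric polynomials, and the Fejer means of the periodization of a test function
  converge with all derivatives, so the difference is zero (\<open>periodic_functional_eq_zero\<close>,
  \<open>periodic_distribution_eq_character_sum\<close>). Since test functions are dense in the Schwartz functions, this determines
  the tempered extension (\<open>tempered_extension_periodic\<close>).

  Second, \<open>Op_character\<close> is an instance of Fourier inversion in the second variable. It rests on the
  invariance of the Schwartz functions under the partial Fourier transform (\<open>schwartz_inv_fourier_snd\<close>) and on the
  inversion formula (\<open>fourier_inversion\<close>).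

  Third, the series of time frequency shifts converges in the norm of \<open>X\<close>, whereas the series of characters is formed by
  testing against Schwartz functions. The two agree because evaluation at a Schwartz function is continuous
  on \<open>X\<close> (\<open>banach_absolutely_convergent_sum\<close>).\<close>

(* From here on, join is the pairing of the two halves of phase space. *)
hide_const (open) Giry_Monad.join
hide_fact (open) Giry_Monad.join_def

section \<open>Calculus of iterated partial derivatives\<close>

definition partial_deriv :: "'n \<Rightarrow> (real^'n \<Rightarrow> complex) \<Rightarrow> real^'n \<Rightarrow> complex" where
  "partial_deriv i f = (\<lambda>x. frechet_derivative f (at x) (axis i 1))"

lemma partial_derivs_Cons: "partial_derivs (i # is) f = partial_deriv i (partial_derivs is f)"
  by (simp add: partial_deriv_def)

lemma partial_derivs_snoc: "partial_derivs (is @ [i]) f = partial_derivs is (partial_deriv i f)"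
  by (induction "is") (simp_all add: partial_deriv_def)

lemma partial_derivs_append: "partial_derivs (is @ js) f = partial_derivs is (partial_derivs js f)"
  by (induction "is") simp_all

lemma partial_deriv_eqI:
  assumes "(f has_derivative f') (at x)"
  shows "partial_deriv i f x = f' (axis i 1)"
  using frechet_derivative_at[OF assms] by (simp add: partial_deriv_def)

lemma vec_expansion: "(h :: real^'n) = (\<Sum>i\<in>UNIV. h $ i *\<^sub>R axis i 1)"
  using basis_expansion[of h] by (simp add: scalar_mult_eq_scaleR)

lemma linear_eq_sum_axis:
  assumes "linear (f' :: real^'n \<Rightarrow> 'b::real_vector)"
  shows "f' h = (\<Sum>i\<in>UNIV. h $ i *\<^sub>R f' (axis i 1))"
proof -
  have "f' h = f' (\<Sum>i\<in>UNIV. h $ i *\<^sub>R axis i 1)"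
    using vec_expansion[of h] by simp
  then show ?thesis
    by (simp add: linear_sum[OF assms] linear_cmul[OF assms])
qed

lemma sum_axis_scaleR: "(\<Sum>j\<in>UNIV. axis i (1::real) $ j *\<^sub>R F j) = (F i :: 'a::real_vector)"
  by (subst sum.mono_neutral_right[of _ "{i}"]) (auto simp: axis_def)

lemma has_derivative_partial:
  fixes f :: "real^'n \<Rightarrow> complex"
  assumes "f differentiable (at x)"
  shows "(f has_derivative (\<lambda>h. \<Sum>i\<in>UNIV. h $ i *\<^sub>R partial_deriv i f x)) (at x)"
proof -
  have D: "(f has_derivative frechet_derivative f (at x)) (at x)"
    using assms frechet_derivative_works by blast
  have "frechet_derivative f (at x) = (\<lambda>h. \<Sum>i\<in>UNIV. h $ i *\<^sub>R partial_deriv i f x)"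
    unfolding partial_deriv_def
    by (rule ext) (rule linear_eq_sum_axis[OF has_derivative_linear[OF D]])
  with D show ?thesis by simp
qed

lemma partial_deriv_add:
  assumes "f differentiable (at x)" "g differentiable (at x)"
  shows "partial_deriv i (\<lambda>x. f x + g x) x = partial_deriv i f x + partial_deriv i g x"
proof -
  have "((\<lambda>x. f x + g x) has_derivative
      (\<lambda>h. frechet_derivative f (at x) h + frechet_derivative g (at x) h)) (at x)"
    using assms frechet_derivative_works has_derivative_add by blast
  from partial_deriv_eqI[OF this] show ?thesis
    by (simp add: partial_deriv_def)
qed

lemma partial_deriv_cmult:
  assumes "f differentiable (at x)"
  shows "partial_deriv i (\<lambda>x. a * f x) x = a * partial_deriv i f x"
proof -
  have "(f has_derivative frechet_derivative f (at x)) (at x)"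
    using assms frechet_derivative_works by blast
  then have "((\<lambda>x. a * f x) has_derivative (\<lambda>h. a * frechet_derivative f (at x) h)) (at x)"
    by (rule has_derivative_mult_right)
  from partial_deriv_eqI[OF this] show ?thesis
    by (simp add: partial_deriv_def)
qed

lemma partial_deriv_mult:
  assumes "f differentiable (at x)" "g differentiable (at x)"
  shows "partial_deriv i (\<lambda>x. f x * g x) x = partial_deriv i f x * g x + f x * partial_deriv i g x"
proof -
  have "((\<lambda>x. f x * g x) has_derivative
      (\<lambda>h. f x * frechet_derivative g (at x) h + frechet_derivative f (at x) h * g x)) (at x)"
    using assms frechet_derivative_works has_derivative_mult by blast
  from partial_deriv_eqI[OF this] show ?thesis
    by (simp add: partial_deriv_def)
qed

lemma has_derivative_compose_affine:
  fixes f :: "real^'n \<Rightarrow> complex" and M :: "real^'m \<Rightarrow> real^'n"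
  assumes "linear M" "f differentiable (at (M x + a))"
  shows "((\<lambda>x. f (M x + a)) has_derivative
            (\<lambda>h. \<Sum>j\<in>UNIV. M h $ j *\<^sub>R partial_deriv j f (M x + a))) (at x)"
proof -
  have M: "((\<lambda>x. M x + a) has_derivative M) (at x)"
    using assms(1) linear_imp_has_derivative[of M] has_derivative_add_const by blast
  show ?thesis
    using has_derivative_compose[OF M has_derivative_partial[OF assms(2)]] by simp
qed

lemma partial_deriv_compose_affine:
  fixes f :: "real^'n \<Rightarrow> complex" and M :: "real^'m \<Rightarrow> real^'n"
  assumes "linear M" "f differentiable (at (M x + a))"
  shows "partial_deriv i (\<lambda>x. f (M x + a)) x =
           (\<Sum>j\<in>UNIV. M (axis i 1) $ j *\<^sub>R partial_deriv j f (M x + a))"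
  by (rule partial_deriv_eqI[OF has_derivative_compose_affine[OF assms]])

lemma partial_deriv_local:
  assumes "open U" "x \<in> U" "\<And>y. y \<in> U \<Longrightarrow> f y = g y"
  shows "partial_deriv i f x = partial_deriv i g x"
proof -
  have "(f has_derivative D) (at x) \<longleftrightarrow> (g has_derivative D) (at x)" for D
    by (metis assms has_derivative_transform_within_open)
  then show ?thesis by (simp add: partial_deriv_def frechet_derivative_def)
qed

lemma partial_derivs_local:
  assumes "open U" "\<And>y. y \<in> U \<Longrightarrow> f y = g y" "x \<in> U"
  shows "partial_derivs is f x = partial_derivs is g x"
  using assms(3)
proof (induction "is" arbitrary: x)
  case (Cons i "is")
  then show ?case
    unfolding partial_derivs_Cons by (intro partial_deriv_local[OF assms(1)]) auto
qed (use assms in auto)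

lemma partial_derivs_zero: "partial_derivs is (\<lambda>x. 0) = (\<lambda>x. 0)"
  by (induction "is") (auto simp: partial_derivs_Cons partial_deriv_def)

lemma partial_derivs_zero_outside:
  assumes "\<And>x. R < norm x \<Longrightarrow> f x = 0" "R < norm x"
  shows "partial_derivs is f x = 0"
proof -
  have "open {x :: real^'a. R < norm x}" by (intro open_Collect_less continuous_intros)
  then have "partial_derivs is f x = partial_derivs is (\<lambda>x. 0) x"
    by (rule partial_derivs_local) (use assms in auto)
  then show ?thesis by (simp add: partial_derivs_zero)
qed

subsection \<open>Linear combinations\<close>

inductive_set complex_span :: "('a \<Rightarrow> complex) set \<Rightarrow> ('a \<Rightarrow> complex) set"
  for G :: "('a \<Rightarrow> complex) set" where
  zero: "(\<lambda>x. 0) \<in> complex_span G"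
| base: "g \<in> G \<Longrightarrow> g \<in> complex_span G"
| add: "f \<in> complex_span G \<Longrightarrow> g \<in> complex_span G \<Longrightarrow> (\<lambda>x. f x + g x) \<in> complex_span G"
| scale: "f \<in> complex_span G \<Longrightarrow> (\<lambda>x. a * f x) \<in> complex_span G"

lemma complex_span_sum:
  assumes "\<And>i. i \<in> I \<Longrightarrow> f i \<in> complex_span G"
  shows "(\<lambda>x. \<Sum>i\<in>I. f i x) \<in> complex_span G"
  using assms
  by (induction I rule: infinite_finite_induct)
     (auto intro: complex_span.zero complex_span.add)

lemma complex_span_scaleR: "f \<in> complex_span G \<Longrightarrow> (\<lambda>x. r *\<^sub>R f x) \<in> complex_span G"
  using complex_span.scale[of f G "of_real r"] by (simp add: scaleR_conv_of_real)

lemma complex_span_differentiable: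
  assumes "\<And>g x. g \<in> G \<Longrightarrow> g differentiable (at x)" "f \<in> complex_span G"
  shows "f differentiable (at x)"
  using assms(2) by (induction) (auto intro: assms(1))

lemma complex_span_partial_derivs:
  assumes d: "\<And>g x. g \<in> G \<Longrightarrow> g differentiable (at x)"
    and c: "\<And>g i. g \<in> G \<Longrightarrow> partial_deriv i g \<in> complex_span G"
    and f: "f \<in> complex_span G"
  shows "partial_derivs is f \<in> complex_span G"
proof (induction "is")
  case (Cons i "is")
  have "h \<in> complex_span G \<Longrightarrow> partial_deriv i h \<in> complex_span G" for h
  proof (induction rule: complex_span.induct)
    case zero
    have "partial_deriv i (\<lambda>x. 0) = (\<lambda>x. 0)"
      by (auto simp: partial_deriv_def)
    then show ?case by (simp add: complex_span.zero)
  next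
    case (base g)
    then show ?case by (rule c)
  next
    case (add f g)
    have "partial_deriv i (\<lambda>x. f x + g x) = (\<lambda>x. partial_deriv i f x + partial_deriv i g x)"
      using complex_span_differentiable[OF d add(1)] complex_span_differentiable[OF d add(2)]
      by (auto simp: partial_deriv_add)
    then show ?case using complex_span.add[OF add(3,4)] by simp
  next
    case (scale f a)
    have "partial_deriv i (\<lambda>x. a * f x) = (\<lambda>x. a * partial_deriv i f x)"
      using complex_span_differentiable[OF d scale(1)]
      by (auto simp: partial_deriv_cmult)
    then show ?case using complex_span.scale[OF scale(2)] by simp
  qed
  then show ?case using Cons by (simp only: partial_derivs_Cons)
qed (simp add: f)

text \<open>Closure of the span of \<open>G\<close> under a single partial derivative is checked once; the induction over the
  list of directions is done here and not in each application.\<close>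

lemma smooth_fun_coinduct:
  assumes "\<And>g x. g \<in> G \<Longrightarrow> g differentiable (at x)"
    and "\<And>g i. g \<in> G \<Longrightarrow> partial_deriv i g \<in> complex_span G"
    and "f \<in> complex_span G"
  shows "smooth_fun f"
  unfolding smooth_fun_def
  using complex_span_differentiable[OF assms(1) complex_span_partial_derivs[OF assms]] by blast

subsection \<open>Smooth functions\<close>

lemma smooth_differentiable: "smooth_fun f \<Longrightarrow> f differentiable (at x)"
  unfolding smooth_fun_def by (metis partial_derivs.simps(1))

lemma smooth_continuous: "smooth_fun f \<Longrightarrow> continuous_on S f"
  by (meson continuous_at_imp_continuous_on differentiable_imp_continuous_within smooth_differentiable)

lemma smooth_measurable [measurable_dest]: "smooth_fun f \<Longrightarrow> f \<in> borel_measurable borel"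
  by (simp add: borel_measurable_continuous_onI smooth_continuous)

lemma smooth_partial_deriv: "smooth_fun f \<Longrightarrow> smooth_fun (partial_deriv i f)"
  unfolding smooth_fun_def partial_derivs_snoc[symmetric] by blast

lemma smooth_partial_derivs: "smooth_fun f \<Longrightarrow> smooth_fun (partial_derivs is f)"
  unfolding smooth_fun_def partial_derivs_append[symmetric] by blast

lemma smooth_add:
  assumes "smooth_fun f" "smooth_fun g" shows "smooth_fun (\<lambda>x. f x + g x)"
  by (rule smooth_fun_coinduct[where G = "{f. smooth_fun f}"])
     (use assms in \<open>auto intro: complex_span.intros smooth_differentiable smooth_partial_deriv\<close>)

lemma smooth_cmult:
  assumes "smooth_fun f" shows "smooth_fun (\<lambda>x. a * f x)"
  by (rule smooth_fun_coinduct[where G = "{f. smooth_fun f}"])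
     (use assms in \<open>auto intro: complex_span.intros smooth_differentiable smooth_partial_deriv\<close>)

lemma smooth_const: "smooth_fun (\<lambda>x. a)"
  by (rule smooth_fun_coinduct[where G = "{\<lambda>x. a}"])
     (auto simp: partial_deriv_def intro: complex_span.intros)

lemma smooth_sum:
  "(\<And>i. i \<in> I \<Longrightarrow> smooth_fun (f i)) \<Longrightarrow> smooth_fun (\<lambda>x. \<Sum>i\<in>I. f i x)"
  by (induction I rule: infinite_finite_induct) (auto intro: smooth_const smooth_add)

lemma smooth_diff:
  assumes "smooth_fun f" "smooth_fun g" shows "smooth_fun (\<lambda>x. f x - g x)"
  using smooth_add[OF assms(1) smooth_cmult[OF assms(2), of "-1"]] by simp

lemma smooth_mult:
  assumes "smooth_fun f" "smooth_fun g" shows "smooth_fun (\<lambda>x. f x * g x)"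
proof (rule smooth_fun_coinduct[where G = "{(\<lambda>x. f x * g x) |f g. smooth_fun f \<and> smooth_fun g}"])
  fix h :: "real^'a \<Rightarrow> complex" and i
  assume "h \<in> {(\<lambda>x. f x * g x) |f g. smooth_fun f \<and> smooth_fun g}"
  then obtain f g where h: "h = (\<lambda>x. f x * g x)" and s: "smooth_fun f" "smooth_fun g" by auto
  have "partial_deriv i h = (\<lambda>x. partial_deriv i f x * g x + f x * partial_deriv i g x)"
    using s by (auto simp: h partial_deriv_mult smooth_differentiable)
  moreover have mem: "(\<lambda>x. f x * g x) \<in> {(\<lambda>x. f x * g x) |f g. smooth_fun f \<and> smooth_fun g}"
    if "smooth_fun f" "smooth_fun g" for f g :: "real^'a \<Rightarrow> complex"
    using that by blast
  ultimately show "partial_deriv i h \<in> complex_span {(\<lambda>x. f x * g x) |f g. smooth_fun f \<and> smooth_fun g}"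
    using s by (simp only:) (intro complex_span.add complex_span.base mem smooth_partial_deriv)
  show "h differentiable (at x)" for x
    unfolding h using s by (intro differentiable_mult smooth_differentiable)
qed (use assms in \<open>auto intro!: complex_span.base\<close>)

lemma smooth_prod:
  "(\<And>i. i \<in> I \<Longrightarrow> smooth_fun (f i)) \<Longrightarrow> smooth_fun (\<lambda>x. \<Prod>i\<in>I. f i x)"
  by (induction I rule: infinite_finite_induct) (auto intro: smooth_const smooth_mult)

lemma smooth_compose_affine:
  fixes f :: "real^'n \<Rightarrow> complex" and M :: "real^'m \<Rightarrow> real^'n"
  assumes "smooth_fun f" "linear M"
  shows "smooth_fun (\<lambda>x. f (M x + a))"
proof (rule smooth_fun_coinduct[where G = "{(\<lambda>x. f (M x + a)) |f. smooth_fun f}"])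
  fix h :: "real^'m \<Rightarrow> complex" and i x
  assume "h \<in> {(\<lambda>x. f (M x + a)) |f. smooth_fun f}"
  then obtain f where h: "h = (\<lambda>x. f (M x + a))" and s: "smooth_fun f" by auto
  show "h differentiable (at x)"
    using has_derivative_compose_affine[OF assms(2) smooth_differentiable[OF s]]
    unfolding h differentiable_def by blast
  have "partial_deriv i h = (\<lambda>x. \<Sum>j\<in>UNIV. M (axis i 1) $ j *\<^sub>R partial_deriv j f (M x + a))"
    using partial_deriv_compose_affine[OF assms(2) smooth_differentiable[OF s]]
    unfolding h by blast
  moreover have mem: "(\<lambda>x. partial_deriv j f (M x + a)) \<in> {(\<lambda>x. f (M x + a)) |f. smooth_fun f}" for j
    using smooth_partial_deriv[OF s] by blast
  ultimately show "partial_deriv i h \<in> complex_span {(\<lambda>x. f (M x + a)) |f. smooth_fun f}"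
    by (simp only:) (intro complex_span_sum complex_span_scaleR complex_span.base mem)
qed (use assms(1) in \<open>auto intro: complex_span.base\<close>)

lemma smooth_translate: "smooth_fun f \<Longrightarrow> smooth_fun (\<lambda>x. f (x + a))"
  using smooth_compose_affine[of f id a] by (simp add: linear_id)

lemma smooth_compose_linear: "smooth_fun f \<Longrightarrow> linear M \<Longrightarrow> smooth_fun (\<lambda>x. f (M x))"
  using smooth_compose_affine[of f M 0] by simp

subsection \<open>Iterated derivatives of sums and products\<close>

lemma partial_derivs_add:
  assumes "smooth_fun f" "smooth_fun g"
  shows "partial_derivs is (\<lambda>x. f x + g x) = (\<lambda>x. partial_derivs is f x + partial_derivs is g x)"
proof (induction "is")
  case (Cons i "is")
  then show ?case
    using smooth_differentiable[OF smooth_partial_derivs[OF assms(1)]]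
      smooth_differentiable[OF smooth_partial_derivs[OF assms(2)]]
    by (auto simp: partial_derivs_Cons partial_deriv_add simp del: partial_derivs.simps)
qed simp

lemma partial_derivs_cmult:
  assumes "smooth_fun f"
  shows "partial_derivs is (\<lambda>x. a * f x) = (\<lambda>x. a * partial_derivs is f x)"
proof (induction "is")
  case (Cons i "is")
  then show ?case
    using smooth_differentiable[OF smooth_partial_derivs[OF assms(1)]]
    by (auto simp: partial_derivs_Cons partial_deriv_cmult simp del: partial_derivs.simps)
qed simp

lemma partial_derivs_diff:
  assumes "smooth_fun f" "smooth_fun g"
  shows "partial_derivs is (\<lambda>x. f x - g x) = (\<lambda>x. partial_derivs is f x - partial_derivs is g x)"
  using partial_derivs_add[OF assms(1) smooth_cmult[OF assms(2), of "-1"]]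
    partial_derivs_cmult[OF assms(2), of _ "-1"] by simp

lemma partial_derivs_sum:
  assumes "\<And>i. i \<in> I \<Longrightarrow> smooth_fun (f i)"
  shows "partial_derivs is (\<lambda>x. \<Sum>i\<in>I. f i x) = (\<lambda>x. \<Sum>i\<in>I. partial_derivs is (f i) x)"
  using assms
  by (induction I rule: infinite_finite_induct) (simp_all add: partial_derivs_zero partial_derivs_add smooth_sum)

lemma partial_derivs_translate:
  assumes "smooth_fun f"
  shows "partial_derivs is (\<lambda>x. f (x + a)) = (\<lambda>x. partial_derivs is f (x + a))"
proof (induction "is")
  case (Cons i "is")
  have "partial_deriv i (\<lambda>x. partial_derivs is f (x + a)) x = partial_deriv i (partial_derivs is f) (x + a)" for x
    using partial_deriv_compose_affine[OF linear_id, of "partial_derivs is f" x a i]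
      smooth_differentiable[OF smooth_partial_derivs[OF assms]]
    by (simp add: sum_axis_scaleR)
  then show ?case using Cons by (auto simp: partial_derivs_Cons simp del: partial_derivs.simps)
qed simp

text \<open>The product rule doubles the number of terms with each derivative. Counting them replaces the full
  Leibniz formula.\<close>

lemma partial_derivs_mult_bound:
  assumes "smooth_fun f" "smooth_fun g"
    and "\<And>js. length js \<le> length is \<Longrightarrow> norm (partial_derivs js f x) \<le> F"
    and "\<And>js. length js \<le> length is \<Longrightarrow> norm (partial_derivs js g x) \<le> H"
  shows "norm (partial_derivs is (\<lambda>x. f x * g x) x) \<le> 2 ^ length is * (F * H)"
  using assms
proof (induction "is" arbitrary: f g rule: rev_induct)
  case Nil
  have "0 \<le> F" using order_trans[OF norm_ge_zero Nil(3)[of "[]"]] by simp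
  then show ?case
    using Nil(3)[of "[]"] Nil(4)[of "[]"] by (simp add: norm_mult mult_mono)
next
  case (snoc i "is")
  have e: "partial_deriv i (\<lambda>x. f x * g x) = (\<lambda>x. partial_deriv i f x * g x + f x * partial_deriv i g x)"
    using snoc.prems(1,2) by (auto simp: partial_deriv_mult smooth_differentiable)
  have s: "smooth_fun (partial_deriv i f)" "smooth_fun (partial_deriv i g)"
    using snoc.prems(1,2) by (auto intro: smooth_partial_deriv)
  have 1: "norm (partial_derivs is (\<lambda>x. partial_deriv i f x * g x) x) \<le> 2 ^ length is * (F * H)"
    using snoc.prems by (intro snoc.IH s) (auto simp flip: partial_derivs_snoc)
  have 2: "norm (partial_derivs is (\<lambda>x. f x * partial_deriv i g x) x) \<le> 2 ^ length is * (F * H)"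
    using snoc.prems by (intro snoc.IH s) (auto simp flip: partial_derivs_snoc)
  have "partial_derivs (is @ [i]) (\<lambda>x. f x * g x) x =
      partial_derivs is (\<lambda>x. partial_deriv i f x * g x) x + partial_derivs is (\<lambda>x. f x * partial_deriv i g x) x"
    using s snoc.prems(1,2) by (simp add: partial_derivs_snoc e partial_derivs_add smooth_mult)
  then show ?case
    using norm_triangle_mono[OF 1 2] by (simp add: mult_ac)
qed

lemma finite_short_lists: "finite {js :: 'n::finite list. length js \<le> m}"
  using finite_lists_length_le[of "UNIV :: 'n set" m] by simp

subsection \<open>Characters\<close>

definition character :: "real^'n \<Rightarrow> real^'n \<Rightarrow> complex" where
  "character w x = cis (2 * pi * (w \<bullet> x))"

lemma norm_character [simp]: "norm (character w x) = 1"
  by (simp add: character_def)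

lemma character_zero [simp]: "character 0 x = 1" "character w 0 = 1"
  by (simp_all add: character_def)

lemma character_add: "character w (x + y) = character w x * character w y"
  by (simp add: character_def cis_mult inner_add_right distrib_left)

lemma character_add_left: "character (v + w) x = character v x * character w x"
  by (simp add: character_def cis_mult inner_add_left distrib_left)

lemma character_has_derivative:
  "(character w has_derivative (\<lambda>h. (2 * pi * (w \<bullet> h)) *\<^sub>R (\<i> * character w x))) (at x)"
proof -
  have "((\<lambda>x. \<i> * complex_of_real (2 * pi * (w \<bullet> x))) has_derivative
      (\<lambda>h. \<i> * complex_of_real (2 * pi * (w \<bullet> h)))) (at x)"
    by (intro has_derivative_mult_right has_derivative_of_real has_derivative_inner_right has_derivative_ident)
  from has_derivative_compose[OF this DERIV_exp[THEN has_field_derivative_imp_has_derivative]]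
  show ?thesis
    unfolding character_def cis_conv_exp by (simp add: scaleR_conv_of_real mult_ac)
qed

lemma partial_deriv_character:
  "partial_deriv i (character w) x = (2 * pi * \<i> * (w $ i)) * character w x"
  using partial_deriv_eqI[OF character_has_derivative]
  by (simp add: inner_axis scaleR_conv_of_real mult_ac)

lemma smooth_character: "smooth_fun (character w)"
proof (rule smooth_fun_coinduct[where G = "{character w}"])
  fix g i assume "g \<in> {character w}"
  then have "partial_deriv i g = (\<lambda>x. (2 * pi * \<i> * (w $ i)) * character w x)"
    using partial_deriv_character by auto
  then show "partial_deriv i g \<in> complex_span {character w}"
    by (simp only:) (intro complex_span.scale complex_span.base singletonI)
qed (auto intro: complex_span.base differentiableI character_has_derivative)

subsection \<open>Schwartz functions\<close>

definition rapidly_decreasing :: "(real^'n \<Rightarrow> complex) \<Rightarrow> bool" where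
  "rapidly_decreasing f \<longleftrightarrow> (\<forall>k. \<exists>B. \<forall>x. (1 + norm x) ^ k * norm (f x) \<le> B)"

lemma schwartz_iff:
  "f \<in> schwartz_functions \<longleftrightarrow> smooth_fun f \<and> (\<forall>is. rapidly_decreasing (partial_derivs is f))"
proof -
  have "bounded (range (\<lambda>x. (1 + norm x) ^ k *\<^sub>R g x)) \<longleftrightarrow>
      (\<exists>B. \<forall>x. (1 + norm x) ^ k * norm (g x) \<le> B)" for k and g :: "real^'n \<Rightarrow> complex"
    by (simp add: bounded_iff)
  then show ?thesis
    unfolding schwartz_functions_def rapidly_decreasing_def by (simp only: mem_Collect_eq) blast
qed

lemma schwartz_smooth: "f \<in> schwartz_functions \<Longrightarrow> smooth_fun f"
  by (simp add: schwartz_iff)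

lemma schwartz_differentiable: "f \<in> schwartz_functions \<Longrightarrow> f differentiable (at x)"
  by (simp add: smooth_differentiable schwartz_smooth)

lemma schwartz_rapid: "f \<in> schwartz_functions \<Longrightarrow> rapidly_decreasing f"
  unfolding schwartz_iff by (metis partial_derivs.simps(1))

lemma schwartz_partial_deriv: "f \<in> schwartz_functions \<Longrightarrow> partial_deriv i f \<in> schwartz_functions"
  unfolding schwartz_iff by (auto simp: smooth_partial_deriv partial_derivs_snoc[symmetric])

lemma schwartz_partial_derivs: "f \<in> schwartz_functions \<Longrightarrow> partial_derivs is f \<in> schwartz_functions"
  unfolding schwartz_iff by (auto simp: smooth_partial_derivs partial_derivs_append[symmetric])

lemma rapidly_decreasing_mult_bounded:
  assumes "rapidly_decreasing f" "\<And>x. norm (g x) \<le> B * norm (f x)"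
  shows "rapidly_decreasing g"
  unfolding rapidly_decreasing_def
proof
  fix k
  obtain K where K: "\<And>x. (1 + norm x) ^ k * norm (f x) \<le> K"
    using assms(1) unfolding rapidly_decreasing_def by blast
  have "(1 + norm x) ^ k * norm (g x) \<le> \<bar>B\<bar> * K" for x
  proof -
    have "norm (g x) \<le> \<bar>B\<bar> * norm (f x)"
      by (rule order_trans[OF assms(2)]) (intro mult_right_mono abs_ge_self norm_ge_zero)
    then have "(1 + norm x) ^ k * norm (g x) \<le> (1 + norm x) ^ k * (\<bar>B\<bar> * norm (f x))"
      by (intro mult_left_mono) auto
    also have "\<dots> = \<bar>B\<bar> * ((1 + norm x) ^ k * norm (f x))" by simp
    also have "\<dots> \<le> \<bar>B\<bar> * K" using K by (intro mult_left_mono) auto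
    finally show ?thesis .
  qed
  then show "\<exists>B. \<forall>x. (1 + norm x) ^ k * norm (g x) \<le> B" by blast
qed

lemma rapidly_decreasing_add:
  assumes "rapidly_decreasing f" "rapidly_decreasing g"
  shows "rapidly_decreasing (\<lambda>x. f x + g x)"
  unfolding rapidly_decreasing_def
proof
  fix k
  obtain K L where KL: "\<And>x. (1 + norm x) ^ k * norm (f x) \<le> K" "\<And>x. (1 + norm x) ^ k * norm (g x) \<le> L"
    using assms unfolding rapidly_decreasing_def by metis
  have "(1 + norm x) ^ k * norm (f x + g x) \<le> K + L" for x
  proof -
    have "(1 + norm x) ^ k * norm (f x + g x) \<le> (1 + norm x) ^ k * (norm (f x) + norm (g x))"
      by (intro mult_left_mono norm_triangle_ineq) auto
    also have "\<dots> \<le> K + L" using KL[of x] by (simp add: distrib_left)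
    finally show ?thesis .
  qed
  then show "\<exists>B. \<forall>x. (1 + norm x) ^ k * norm (f x + g x) \<le> B" by blast
qed

lemma rapidly_decreasing_compose:
  assumes "rapidly_decreasing f" "c \<ge> 0" "\<And>x. 1 + norm x \<le> c * (1 + norm (T x))"
  shows "rapidly_decreasing (\<lambda>x. f (T x))"
  unfolding rapidly_decreasing_def
proof
  fix k
  obtain K where K: "\<And>x. (1 + norm x) ^ k * norm (f x) \<le> K"
    using assms(1) unfolding rapidly_decreasing_def by blast
  have "(1 + norm x) ^ k * norm (f (T x)) \<le> c ^ k * K" for x
  proof -
    have "(1 + norm x) ^ k \<le> (c * (1 + norm (T x))) ^ k"
      by (intro power_mono assms(3)) auto
    then have "(1 + norm x) ^ k * norm (f (T x)) \<le> (c * (1 + norm (T x))) ^ k * norm (f (T x))"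
      by (intro mult_right_mono) auto
    also have "\<dots> = c ^ k * ((1 + norm (T x)) ^ k * norm (f (T x)))"
      by (simp add: power_mult_distrib)
    also have "\<dots> \<le> c ^ k * K" using K assms(2) by (intro mult_left_mono) auto
    finally show ?thesis .
  qed
  then show "\<exists>B. \<forall>x. (1 + norm x) ^ k * norm (f (T x)) \<le> B" by blast
qed

text \<open>As for smooth functions. The decay passes from \<open>G\<close> to all iterated derivatives because these lie in the span
  of \<open>G\<close>.\<close>

lemma schwartz_coinduct:
  assumes d: "\<And>g x. g \<in> G \<Longrightarrow> g differentiable (at x)"
    and c: "\<And>g i. g \<in> G \<Longrightarrow> partial_deriv i g \<in> complex_span G"
    and r: "\<And>g. g \<in> G \<Longrightarrow> rapidly_decreasing g"
    and f: "f \<in> complex_span G"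
  shows "f \<in> schwartz_functions"
proof -
  have "rapidly_decreasing h" if "h \<in> complex_span G" for h
    using that
  proof induction
    case zero
    then show ?case by (auto simp: rapidly_decreasing_def)
  next
    case (scale f a)
    show ?case
      by (rule rapidly_decreasing_mult_bounded[OF scale(2), where B = "norm a"]) (simp add: norm_mult)
  next
    case (add f g)
    show ?case by (rule rapidly_decreasing_add[OF add(3,4)])
  qed (rule r)
  then show ?thesis
    unfolding schwartz_iff
    using smooth_fun_coinduct[where G = G, OF d c f] complex_span_partial_derivs[where G = G, OF d c f]
    by blast
qed

text \<open>The form of the principle suited to integral transforms: decay need not be estimated if
  multiplication by the coordinates stays inside the class.\<close>

lemma schwartz_coinduct_bounded:
  assumes d: "\<And>g x. g \<in> G \<Longrightarrow> g differentiable (at x)"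
    and c: "\<And>g i. g \<in> G \<Longrightarrow> partial_deriv i g \<in> complex_span G"
    and m: "\<And>g i. g \<in> G \<Longrightarrow> (\<lambda>x. x $ i *\<^sub>R g x) \<in> complex_span G"
    and b: "\<And>g. g \<in> G \<Longrightarrow> \<exists>B. \<forall>x. norm (g x) \<le> B"
    and f: "f \<in> complex_span G"
  shows "f \<in> schwartz_functions"
proof (rule schwartz_coinduct[where G = G, OF d c _ f])
  have m': "(\<lambda>x. x $ i *\<^sub>R h x) \<in> complex_span G" if "h \<in> complex_span G" for h i
    using that
  proof induction
    case (add f g)
    show ?case using complex_span.add[OF add(3,4)] by (simp add: scaleR_add_right)
  next
    case (scale f a)
    show ?case using complex_span.scale[OF scale(2), of a] by simp
  qed (auto intro: complex_span.zero m)
  have b': "\<exists>B. \<forall>x. norm (h x) \<le> B" if "h \<in> complex_span G" for h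
    using that
  proof induction
    case (add f g)
    then obtain B1 B2 where "\<forall>x. norm (f x) \<le> B1" "\<forall>x. norm (g x) \<le> B2" by blast
    then have "\<forall>x. norm (f x + g x) \<le> B1 + B2"
      by (meson add_mono norm_triangle_ineq order_trans)
    then show ?case by blast
  next
    case (scale f a)
    then obtain B where "\<forall>x. norm (f x) \<le> B" by blast
    then have "\<forall>x. norm (a * f x) \<le> norm a * B" by (simp add: norm_mult mult_left_mono)
    then show ?case by blast
  qed (auto intro: b)
  fix g assume g: "g \<in> G"
  have "\<exists>B. \<forall>x. (1 + (\<Sum>i\<in>UNIV. \<bar>x $ i\<bar>)) ^ k * norm (h x) \<le> B" if "h \<in> complex_span G" for h k
    using that
  proof (induction k arbitrary: h)
    case (Suc k)
    obtain B0 where B0: "\<And>x. (1 + (\<Sum>i\<in>UNIV. \<bar>x $ i\<bar>)) ^ k * norm (h x) \<le> B0"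
      using Suc by blast
    have "\<exists>B. \<forall>x. (1 + (\<Sum>i\<in>UNIV. \<bar>x $ i\<bar>)) ^ k * norm (x $ i *\<^sub>R h x) \<le> B" for i
      using Suc.IH[OF m'[OF Suc.prems]] .
    then obtain B where B: "\<And>i x. (1 + (\<Sum>i\<in>UNIV. \<bar>x $ i\<bar>)) ^ k * norm (x $ i *\<^sub>R h x) \<le> B i"
      by metis
    have "(1 + (\<Sum>i\<in>UNIV. \<bar>x $ i\<bar>)) ^ Suc k * norm (h x) \<le> B0 + (\<Sum>i\<in>UNIV. B i)" for x
    proof -
      have "(1 + (\<Sum>i\<in>UNIV. \<bar>x $ i\<bar>)) ^ Suc k * norm (h x) =
        (1 + (\<Sum>i\<in>UNIV. \<bar>x $ i\<bar>)) ^ k * norm (h x) +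
        (\<Sum>i\<in>UNIV. (1 + (\<Sum>i\<in>UNIV. \<bar>x $ i\<bar>)) ^ k * norm (x $ i *\<^sub>R h x))"
        by (simp add: algebra_simps sum_distrib_left sum_distrib_right)
      also have "\<dots> \<le> B0 + (\<Sum>i\<in>UNIV. B i)"
        by (intro add_mono B0 sum_mono B)
      finally show ?thesis .
    qed
    then show ?case by blast
  qed (use b' in simp)
  then have *: "\<exists>B. \<forall>x. (1 + (\<Sum>i\<in>UNIV. \<bar>x $ i\<bar>)) ^ k * norm (g x) \<le> B" for k
    using complex_span.base[OF g] by blast
  show "rapidly_decreasing g"
    unfolding rapidly_decreasing_def
  proof
    fix k
    obtain B where B: "\<And>x. (1 + (\<Sum>i\<in>UNIV. \<bar>x $ i\<bar>)) ^ k * norm (g x) \<le> B" using * by blast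
    have "(1 + norm x) ^ k * norm (g x) \<le> B" for x
      by (rule order_trans[OF mult_right_mono[OF power_mono] B])
         (use norm_le_l1_cart[of x] in auto)
    then show "\<exists>B. \<forall>x. (1 + norm x) ^ k * norm (g x) \<le> B" by blast
  qed
qed

lemma schwartz_complex_span:
  assumes "f \<in> complex_span schwartz_functions" shows "f \<in> schwartz_functions"
proof (rule schwartz_coinduct[where G = schwartz_functions, OF _ _ _ assms])
  fix g :: "real^'a \<Rightarrow> complex" and i x assume "g \<in> schwartz_functions"
  then show "g differentiable (at x)" "partial_deriv i g \<in> complex_span schwartz_functions"
    "rapidly_decreasing g"
    by (simp_all add: schwartz_differentiable schwartz_partial_deriv complex_span.base schwartz_rapid)
qed

lemma schwartz_add:
  "f \<in> schwartz_functions \<Longrightarrow> g \<in> schwartz_functions \<Longrightarrow> (\<lambda>x. f x + g x) \<in> schwartz_functions"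
  by (rule schwartz_complex_span) (intro complex_span.add complex_span.base)

lemma schwartz_cmult: "f \<in> schwartz_functions \<Longrightarrow> (\<lambda>x. a * f x) \<in> schwartz_functions"
  by (rule schwartz_complex_span) (intro complex_span.scale complex_span.base)

lemma schwartz_diff:
  assumes "f \<in> schwartz_functions" "g \<in> schwartz_functions"
  shows "(\<lambda>x. f x - g x) \<in> schwartz_functions"
  using schwartz_add[OF assms(1) schwartz_cmult[OF assms(2), where a = "-1"]] by simp

lemma schwartz_character_mult:
  assumes "f \<in> schwartz_functions"
  shows "(\<lambda>x. character w x * f x) \<in> schwartz_functions"
proof (rule schwartz_coinduct[where G = "{(\<lambda>x. character w x * f x) |f. f \<in> schwartz_functions}"])
  fix h i assume "h \<in> {(\<lambda>x. character w x * f x) |f. f \<in> schwartz_functions}"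
  then obtain f where h: "h = (\<lambda>x. character w x * f x)" and f: "f \<in> schwartz_functions" by auto
  show "rapidly_decreasing h"
    unfolding h by (rule rapidly_decreasing_mult_bounded[OF schwartz_rapid[OF f], of _ 1]) (simp add: norm_mult)
  have "partial_deriv i h = (\<lambda>x. character w x * ((2 * pi * \<i> * (w $ i)) * f x + partial_deriv i f x))"
    unfolding h by (auto simp: partial_deriv_mult partial_deriv_character smooth_differentiable
        smooth_character schwartz_smooth[OF f] algebra_simps)
  moreover have "(\<lambda>x. (2 * pi * \<i> * (w $ i)) * f x + partial_deriv i f x) \<in> schwartz_functions"
    using f by (intro schwartz_add schwartz_cmult schwartz_partial_deriv)
  moreover have mem: "(\<lambda>x. character w x * f x) \<in> {(\<lambda>x. character w x * f x) |f. f \<in> schwartz_functions}"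
    if "f \<in> schwartz_functions" for f
    using that by blast
  ultimately show "partial_deriv i h \<in> complex_span {(\<lambda>x. character w x * f x) |f. f \<in> schwartz_functions}"
    by (simp only:) (intro complex_span.base mem)
  show "h differentiable (at x)" for x
    unfolding h using f by (intro differentiable_mult smooth_differentiable smooth_character schwartz_smooth)
qed (use assms in \<open>auto intro!: complex_span.base\<close>)

text \<open>The condition on \<open>M\<close> and \<open>a\<close> holds for translations, for invertible linear maps and for
  the restriction to an affine subspace.\<close>

lemma schwartz_compose_affine:
  fixes f :: "real^'n \<Rightarrow> complex" and M :: "real^'m \<Rightarrow> real^'n"
  assumes "f \<in> schwartz_functions" "linear M" "c \<ge> 0" "\<And>x. 1 + norm x \<le> c * (1 + norm (M x + a))"
  shows "(\<lambda>x. f (M x + a)) \<in> schwartz_functions"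
proof (rule schwartz_coinduct[where G = "{(\<lambda>x. f (M x + a)) |f. f \<in> schwartz_functions}"])
  fix h :: "real^'m \<Rightarrow> complex" and i x
  assume "h \<in> {(\<lambda>x. f (M x + a)) |f. f \<in> schwartz_functions}"
  then obtain f where h: "h = (\<lambda>x. f (M x + a))" and s: "f \<in> schwartz_functions" by auto
  show "h differentiable (at x)"
    using has_derivative_compose_affine[OF assms(2) schwartz_differentiable[OF s]]
    unfolding h differentiable_def by blast
  show "rapidly_decreasing h"
    unfolding h using rapidly_decreasing_compose[OF schwartz_rapid[OF s] assms(3,4)] .
  have "partial_deriv i h = (\<lambda>x. \<Sum>j\<in>UNIV. M (axis i 1) $ j *\<^sub>R partial_deriv j f (M x + a))"
    using partial_deriv_compose_affine[OF assms(2) schwartz_differentiable[OF s]]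
    unfolding h by blast
  moreover have mem: "(\<lambda>x. partial_deriv j f (M x + a)) \<in> {(\<lambda>x. f (M x + a)) |f. f \<in> schwartz_functions}" for j
    using schwartz_partial_deriv[OF s] by blast
  ultimately show "partial_deriv i h \<in> complex_span {(\<lambda>x. f (M x + a)) |f. f \<in> schwartz_functions}"
    by (simp only:) (intro complex_span_sum complex_span_scaleR complex_span.base mem)
qed (use assms(1) in \<open>auto intro: complex_span.base\<close>)

lemma schwartz_translate:
  assumes "f \<in> schwartz_functions" shows "(\<lambda>x. f (x + a)) \<in> schwartz_functions"
proof -
  have "(\<lambda>x. f (id x + a)) \<in> schwartz_functions"
  proof (rule schwartz_compose_affine[OF assms linear_id])
    fix x :: "real^'a"
    have "norm x \<le> norm (x + a) + norm a"
      by (metis add_diff_cancel_right' norm_triangle_ineq4)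
    moreover have "0 \<le> norm a * norm (x + a)" by simp
    moreover have "(1 + norm a) * (1 + norm (id x + a)) = 1 + norm (x + a) + norm a + norm a * norm (x + a)"
      by (simp add: algebra_simps)
    ultimately show "1 + norm x \<le> (1 + norm a) * (1 + norm (id x + a))"
      by linarith
  qed simp
  then show ?thesis by simp
qed

lemma schwartz_compose_invertible:
  fixes f :: "real^'n \<Rightarrow> complex" and M :: "real^'m \<Rightarrow> real^'n"
  assumes "f \<in> schwartz_functions" "linear M" "linear M'" "\<And>x. M' (M x) = x"
  shows "(\<lambda>x. f (M x)) \<in> schwartz_functions"
proof -
  obtain B where B: "B > 0" "\<And>x. norm (M' x) \<le> B * norm x"
    using linear_bounded_pos[OF assms(3)] by blast
  have "(\<lambda>x. f (M x + 0)) \<in> schwartz_functions"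
  proof (rule schwartz_compose_affine[OF assms(1,2), where c = "1 + B"])
    fix x
    have "norm x \<le> B * norm (M x)" using B(2)[of "M x"] assms(4) by simp
    then show "1 + norm x \<le> (1 + B) * (1 + norm (M x + 0))"
      using B(1) by (simp add: algebra_simps add_increasing)
  qed (use B in auto)
  then show ?thesis by simp
qed

text \<open>Differentiating \<open>x $ i *\<^sub>R f x\<close> leaves \<open>f\<close> itself as a remainder when the direction is \<open>i\<close>, so the class is
  enlarged by the Schwartz functions to make it closed.\<close>

lemma schwartz_coordinate_mult:
  assumes "f \<in> schwartz_functions"
  shows "(\<lambda>x. x $ i *\<^sub>R f x) \<in> schwartz_functions"
proof (rule schwartz_coinduct[where G = "{(\<lambda>x. x $ i *\<^sub>R f x) |f. f \<in> schwartz_functions} \<union> schwartz_functions"])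
  fix h :: "real^'a \<Rightarrow> complex" and j x
  let ?G = "{(\<lambda>x. x $ i *\<^sub>R f x) |f. f \<in> schwartz_functions} \<union> schwartz_functions"
  assume "h \<in> ?G"
  then consider "h \<in> schwartz_functions" | f where "h = (\<lambda>x. x $ i *\<^sub>R f x)" "f \<in> schwartz_functions"
    by auto
  then have "h differentiable (at x) \<and> rapidly_decreasing h \<and> partial_deriv j h \<in> complex_span ?G"
  proof cases
    case 1
    then show ?thesis
      by (auto intro: schwartz_differentiable schwartz_rapid complex_span.base schwartz_partial_deriv)
  next
    case (2 f)
    have D: "(h has_derivative (\<lambda>v. x $ i *\<^sub>R (\<Sum>k\<in>UNIV. v $ k *\<^sub>R partial_deriv k f x) + v $ i *\<^sub>R f x)) (at x)" for x
      unfolding 2(1)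
      by (rule has_derivative_scaleR[OF bounded_linear.has_derivative[OF bounded_linear_vec_nth has_derivative_ident]
            has_derivative_partial[OF schwartz_differentiable[OF 2(2)]]])
    have "(\<Sum>k\<in>UNIV. axis j 1 $ k *\<^sub>R partial_deriv k f x) = partial_deriv j f x" for x
      by (rule sum_axis_scaleR)
    then have "partial_deriv j h = (\<lambda>x. x $ i *\<^sub>R partial_deriv j f x + axis j 1 $ i *\<^sub>R f x)"
      using partial_deriv_eqI[OF D] by auto
    then have "partial_deriv j h \<in> complex_span ?G"
      using schwartz_partial_deriv[OF 2(2), of j] 2(2)
      by (auto intro!: complex_span.add complex_span_scaleR intro: complex_span.base)
    moreover have "rapidly_decreasing h"
      unfolding rapidly_decreasing_def
    proof
      fix k
      obtain B where B: "\<And>x. (1 + norm x) ^ Suc k * norm (f x) \<le> B"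
        using schwartz_rapid[OF 2(2)] unfolding rapidly_decreasing_def by blast
      have "(1 + norm x) ^ k * norm (h x) \<le> B" for x
      proof -
        have "(1 + norm x) ^ k * norm (h x) = (1 + norm x) ^ k * norm (f x) * \<bar>x $ i\<bar>"
          by (simp add: 2)
        also have "\<dots> \<le> (1 + norm x) ^ k * norm (f x) * (1 + norm x)"
          by (rule mult_left_mono) (use component_le_norm_cart[of x i] in auto)
        also have "\<dots> = (1 + norm x) ^ Suc k * norm (f x)" by simp
        also have "\<dots> \<le> B" by (rule B)
        finally show ?thesis .
      qed
      then show "\<exists>B. \<forall>x. (1 + norm x) ^ k * norm (h x) \<le> B" by blast
    qed
    ultimately show ?thesis using D unfolding differentiable_def by blast
  qed
  then show "h differentiable (at x)" "partial_deriv j h \<in> complex_span ?G" "rapidly_decreasing h"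
    by auto
qed (use assms in \<open>auto intro!: complex_span.base\<close>)

section \<open>Lebesgue measure on coordinate space\<close>

lemma Basis_vec_eq: "(Basis :: (real^'n) set) = range (\<lambda>i. axis i 1)"
  by (auto simp: Basis_vec_def)

lemma prod_Basis_vec: "(\<Prod>b\<in>(Basis :: (real^'n) set). h b) = (\<Prod>i\<in>UNIV. h (axis i 1))"
  unfolding Basis_vec_eq by (subst prod.reindex) (auto simp: inj_on_def axis_eq_axis)

interpretation lborel_PiM: product_sigma_finite "\<lambda>_::'i. lborel :: real measure"
  by unfold_locales

lemma measurable_vec_lambda_PiM [measurable]:
  "(\<lambda>f. \<chi> i. f i) \<in> (\<Pi>\<^sub>M i\<in>(UNIV::'n::finite set). (lborel :: real measure)) \<rightarrow>\<^sub>M borel"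
proof (rule borel_measurable_euclidean_space[THEN iffD2], rule ballI)
  fix b :: "real^'n" assume "b \<in> Basis"
  then obtain i where b: "b = axis i 1" by (auto simp: Basis_vec_eq)
  have "(\<lambda>f. f i) \<in> (\<Pi>\<^sub>M i\<in>(UNIV::'n set). (lborel :: real measure)) \<rightarrow>\<^sub>M borel"
    by measurable
  then show "(\<lambda>f. (\<chi> i. f i) \<bullet> b) \<in> borel_measurable (\<Pi>\<^sub>M i\<in>(UNIV::'n set). (lborel :: real measure))"
    by (simp add: b inner_axis)
qed

text \<open>Both measures give a box the product of its side lengths. In this form integrals over \<open>real^'n\<close> can be
  computed coordinate by coordinate.\<close>

lemma lborel_vec:
  "(lborel :: (real^'n) measure) = distr (\<Pi>\<^sub>M i\<in>UNIV. lborel) borel (\<lambda>f. \<chi> i. f i)"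
proof (rule lborel_eqI)
  fix l u :: "real^'n"
  assume le: "\<And>b. b \<in> Basis \<Longrightarrow> l \<bullet> b \<le> u \<bullet> b"
  have le': "l $ i \<le> u $ i" for i
    using le[of "axis i 1"] by (auto simp: Basis_vec_eq inner_axis)
  have "(\<lambda>f. \<chi> i. f i) -` box l u \<inter> space (\<Pi>\<^sub>M i\<in>(UNIV::'n set). (lborel :: real measure)) =
      (\<Pi>\<^sub>E i\<in>UNIV. {l $ i <..< u $ i})"
    by (auto simp: space_PiM mem_box_cart PiE_def Pi_def)
  then have "emeasure (distr (\<Pi>\<^sub>M i\<in>UNIV. lborel) borel (\<lambda>f. \<chi> i. f i)) (box l u) =
      emeasure (\<Pi>\<^sub>M i\<in>(UNIV::'n set). (lborel :: real measure)) (\<Pi>\<^sub>E i\<in>UNIV. {l $ i <..< u $ i})"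
    by (subst emeasure_distr) auto
  also have "\<dots> = (\<Prod>i\<in>UNIV. ennreal (u $ i - l $ i))"
    by (subst lborel_PiM.emeasure_PiM) (auto simp: le')
  also have "\<dots> = ennreal (\<Prod>b\<in>Basis. (u - l) \<bullet> b)"
    by (simp add: prod_Basis_vec inner_axis prod_ennreal le')
  finally show "emeasure (distr (\<Pi>\<^sub>M i\<in>UNIV. lborel) borel (\<lambda>f. \<chi> i. f i)) (box l u) =
      ennreal (\<Prod>b\<in>Basis. (u - l) \<bullet> b)" .
qed simp

lemma
  fixes f :: "'n::finite \<Rightarrow> real \<Rightarrow> 'b::{real_normed_field,banach,second_countable_topology}"
  assumes "\<And>i. integrable lborel (f i)"
  shows integrable_prod_vec: "integrable lborel (\<lambda>x::real^'n. \<Prod>i\<in>UNIV. f i (x $ i))"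
    and integral_prod_vec: "(\<integral>x. (\<Prod>i\<in>UNIV. f i (x $ i)) \<partial>(lborel :: (real^'n) measure)) = (\<Prod>i\<in>UNIV. (\<integral>t. f i t \<partial>lborel))"
proof -
  have [measurable]: "f i \<in> borel_measurable borel" for i
    using borel_measurable_integrable[OF assms, of i] by simp
  have m: "(\<lambda>x::real^'n. \<Prod>i\<in>UNIV. f i (x $ i)) \<in> borel_measurable borel"
    by (intro borel_measurable_prod measurable_compose[OF _ \<open>f _ \<in> _\<close>]
        borel_measurable_continuous_onI continuous_intros)
  show "integrable lborel (\<lambda>x::real^'n. \<Prod>i\<in>UNIV. f i (x $ i))"
    unfolding lborel_vec
    by (subst integrable_distr_eq[OF _ m]) (use lborel_PiM.product_integrable_prod[of UNIV f] assms in auto)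
  show "(\<integral>x. (\<Prod>i\<in>UNIV. f i (x $ i)) \<partial>(lborel :: (real^'n) measure)) = (\<Prod>i\<in>UNIV. (\<integral>t. f i t \<partial>lborel))"
    unfolding lborel_vec
    by (subst integral_distr[OF _ m]) (use lborel_PiM.product_integral_prod[of UNIV f] assms in auto)
qed

subsection \<open>Linear change of variables\<close>

text \<open>With the other coordinates fixed, the shear translates the coordinate \<open>m\<close>, and integration over that
  coordinate comes first.\<close>

lemma nn_integral_shear:
  fixes g :: "real^'n \<Rightarrow> ennreal"
  assumes [measurable]: "g \<in> borel_measurable borel" and mn: "m \<noteq> n"
  shows "(\<integral>\<^sup>+x. g (\<chi> i. if i = m then x $ m + x $ n else x $ i) \<partial>lborel) = (\<integral>\<^sup>+x. g x \<partial>lborel)"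
proof -
  let ?V = "\<lambda>f. (\<chi> i. f i) :: real^'n"
  let ?h = "\<lambda>x::real^'n. \<chi> i. if i = m then x $ m + x $ n else x $ i"
  let ?P = "\<lambda>A. \<Pi>\<^sub>M i\<in>(A::'n set). (lborel :: real measure)"
  have [measurable]: "?h \<in> borel \<rightarrow>\<^sub>M borel"
    by (intro borel_measurable_continuous_onI linear_continuous_on bounded_linearI'
        ) (auto simp: vec_eq_iff algebra_simps)
  have U: "insert m (UNIV - {m}) = (UNIV :: 'n set)" by auto
  have split: "(\<integral>\<^sup>+x. G x \<partial>lborel) = (\<integral>\<^sup>+f. (\<integral>\<^sup>+y. G (?V (f(m := y))) \<partial>lborel) \<partial>?P (UNIV - {m}))"
    if [measurable]: "G \<in> borel_measurable borel" for G :: "real^'n \<Rightarrow> ennreal"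
  proof -
    have "(\<integral>\<^sup>+x. G x \<partial>lborel) = (\<integral>\<^sup>+f. G (?V f) \<partial>?P UNIV)"
      unfolding lborel_vec by (subst nn_integral_distr) auto
    also have "\<dots> = (\<integral>\<^sup>+f. (\<integral>\<^sup>+y. G (?V (f(m := y))) \<partial>lborel) \<partial>?P (UNIV - {m}))"
      using lborel_PiM.product_nn_integral_insert[of "UNIV - {m}" m "\<lambda>f. G (?V f)"]
      unfolding U by simp
    finally show ?thesis .
  qed
  have inner: "(\<integral>\<^sup>+y. g (?h (?V (f(m := y)))) \<partial>lborel) = (\<integral>\<^sup>+y. g (?V (f(m := y))) \<partial>lborel)" for f
  proof -
    have meas: "(\<lambda>y. g (?V (f(m := y)))) \<in> borel_measurable borel"
    proof (rule measurable_compose[OF _ assms(1)], rule borel_measurable_continuous_onI)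
      have "continuous_on UNIV (\<lambda>y. (f(m := y)) i)" for i
        by (cases "i = m") (auto intro: continuous_intros)
      then show "continuous_on UNIV (\<lambda>y. ?V (f(m := y)))"
        by (intro continuous_on_vec_lambda)
    qed
    have "?h (?V (f(m := y))) = ?V (f(m := f n + 1 * y))" for y
      using mn by (auto simp: vec_eq_iff)
    then have "(\<integral>\<^sup>+y. g (?h (?V (f(m := y)))) \<partial>lborel) = (\<integral>\<^sup>+y. g (?V (f(m := f n + 1 * y))) \<partial>lborel)"
      by simp
    also have "\<dots> = (\<integral>\<^sup>+y. g (?V (f(m := y))) \<partial>lborel)"
      using nn_integral_real_affine[OF meas, of 1 "f n"] by simp
    finally show ?thesis .
  qed
  have "(\<integral>\<^sup>+x. g (?h x) \<partial>lborel) = (\<integral>\<^sup>+f. (\<integral>\<^sup>+y. g (?h (?V (f(m := y)))) \<partial>lborel) \<partial>?P (UNIV - {m}))"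
    by (rule split) measurable
  also have "\<dots> = (\<integral>\<^sup>+x. g x \<partial>lborel)"
    unfolding inner by (rule split[symmetric]) measurable
  finally show ?thesis .
qed

text \<open>A swap of coordinates maps boxes to boxes of the same volume.\<close>

lemma nn_integral_swap:
  fixes g :: "real^'n \<Rightarrow> ennreal"
  assumes [measurable]: "g \<in> borel_measurable borel" 
  shows "(\<integral>\<^sup>+x. g (\<chi> i. x $ Transposition.transpose m n i) \<partial>lborel) = (\<integral>\<^sup>+x. g x \<partial>lborel)"
proof -
  let ?h = "\<lambda>x::real^'n. \<chi> i. x $ Transposition.transpose m n i"
  have [measurable]: "?h \<in> borel \<rightarrow>\<^sub>M borel"
    by (intro borel_measurable_continuous_onI linear_continuous_on bounded_linearI')
       (auto simp: vec_eq_iff algebra_simps)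
  have "lborel = distr lborel borel ?h"
  proof (rule lborel_eqI)
    fix l u :: "real^'n"
    assume le: "\<And>b. b \<in> Basis \<Longrightarrow> l \<bullet> b \<le> u \<bullet> b"
    have le': "l $ i \<le> u $ i" for i
      using le[of "axis i 1"] by (auto simp: Basis_vec_eq inner_axis)
    have "?h x \<in> box l u \<longleftrightarrow> x \<in> box (?h l) (?h u)" for x
      by (simp add: mem_box_cart) (metis transpose_involutory)
    then have "?h -` box l u = box (?h l) (?h u)" by blast
    moreover have "?h l \<bullet> b \<le> ?h u \<bullet> b" if "b \<in> Basis" for b
      using that le' by (auto simp: Basis_vec_eq inner_axis)
    ultimately have "emeasure (distr lborel borel ?h) (box l u) =
        (\<Prod>i\<in>UNIV. u $ Transposition.transpose m n i - l $ Transposition.transpose m n i)"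
      by (subst emeasure_distr) (auto simp: prod_Basis_vec inner_axis)
    also have "(\<Prod>i\<in>UNIV. u $ Transposition.transpose m n i - l $ Transposition.transpose m n i) =
        (\<Prod>i\<in>UNIV. u $ i - l $ i)"
      using prod.permute[OF permutes_swap_id, where S=UNIV and g="\<lambda>i. u $ i - l $ i"]
      by (simp add: o_def)
    finally show "emeasure (distr lborel borel ?h) (box l u) = ennreal (\<Prod>b\<in>Basis. (u - l) \<bullet> b)"
      by (simp add: prod_Basis_vec inner_axis)
  qed simp
  then have "(\<integral>\<^sup>+x. g x \<partial>lborel) = (\<integral>\<^sup>+x. g x \<partial>distr lborel borel ?h)" by simp
  then show ?thesis by (simp add: nn_integral_distr)
qed

lemma nn_integral_diagonal:
  fixes g :: "real^'n \<Rightarrow> ennreal"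
  assumes [measurable]: "g \<in> borel_measurable borel" and "\<And>i. c i \<noteq> 0"
  shows "ennreal \<bar>\<Prod>i\<in>UNIV. c i\<bar> * (\<integral>\<^sup>+x. g (\<chi> i. c i * x $ i) \<partial>lborel) = (\<integral>\<^sup>+x. g x \<partial>lborel)"
proof -
  let ?h = "\<lambda>x::real^'n. \<chi> i. c i * x $ i"
  have [measurable]: "?h \<in> borel \<rightarrow>\<^sub>M borel"
    by (intro borel_measurable_continuous_onI linear_continuous_on bounded_linearI')
       (auto simp: vec_eq_iff algebra_simps)
  have T: "?h x = 0 + (\<Sum>j\<in>Basis. (((\<chi> i. c i) \<bullet> j) * (x \<bullet> j)) *\<^sub>R j)" for x
  proof -
    have ax: "(c j * x $ j) * axis j 1 $ i = (if j = i then c j * x $ j else 0)" for i j :: 'n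
      by (simp add: axis_def)
    have "(\<Sum>j\<in>Basis. (((\<chi> i. c i) \<bullet> j) * (x \<bullet> j)) *\<^sub>R j) = (\<Sum>j\<in>UNIV. (c j * x $ j) *\<^sub>R axis j 1)"
      unfolding Basis_vec_eq by (subst sum.reindex) (auto simp: inj_on_def axis_eq_axis inner_axis)
    then have "0 + (\<Sum>j\<in>Basis. (((\<chi> i. c i) \<bullet> j) * (x \<bullet> j)) *\<^sub>R j) = (\<Sum>j\<in>UNIV. (c j * x $ j) *\<^sub>R axis j 1)"
      by simp
    also have "\<dots> = ?h x"
      by (simp add: vec_eq_iff ax)
    finally show ?thesis ..
  qed
  have "lborel = density (distr lborel borel ?h) (\<lambda>_. (\<Prod>j\<in>Basis. \<bar>(\<chi> i. c i) \<bullet> j\<bar>))"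
    unfolding T
    by (rule lborel_affine_euclidean) (use assms(2) in \<open>auto simp: Basis_vec_eq inner_axis\<close>)
  then have "(\<integral>\<^sup>+x. g x \<partial>lborel) =
      (\<integral>\<^sup>+x. g x \<partial>density (distr lborel borel ?h) (\<lambda>_. (\<Prod>j\<in>Basis. \<bar>(\<chi> i. c i) \<bullet> j\<bar>)))"
    by simp
  also have "\<dots> = ennreal \<bar>\<Prod>i\<in>UNIV. c i\<bar> * (\<integral>\<^sup>+x. g (?h x) \<partial>lborel)"
    by (simp add: nn_integral_density nn_integral_distr nn_integral_cmult prod_Basis_vec inner_axis abs_prod)
  finally show ?thesis by simp
qed

text \<open>Every linear map is a product of diagonal maps, coordinate swaps, shears and maps of rank
  less than \<open>n\<close>, so it suffices to treat these.\<close>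

lemma nn_integral_linear:
  fixes g :: "real^'n \<Rightarrow> ennreal"
  assumes "linear f" "det (matrix f) \<noteq> 0" "g \<in> borel_measurable borel"
  shows "ennreal \<bar>det (matrix f)\<bar> * (\<integral>\<^sup>+x. g (f x) \<partial>lborel) = (\<integral>\<^sup>+x. g x \<partial>lborel)"
proof -
  define P where "P f \<longleftrightarrow> (det (matrix f) \<noteq> 0 \<longrightarrow> (\<forall>g\<in>borel_measurable borel.
      ennreal \<bar>det (matrix f)\<bar> * (\<integral>\<^sup>+x. g (f x) \<partial>lborel) = (\<integral>\<^sup>+x. g x \<partial>lborel)))"
    for f :: "real^'n \<Rightarrow> real^'n"
  have "P f"
  proof (rule induct_linear_elementary[OF assms(1)])
    fix f h :: "real^'n \<Rightarrow> real^'n"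
    assume lin: "linear f" "linear h" and f: "P f" and h: "P h"
    have det: "det (matrix (f \<circ> h)) = det (matrix f) * det (matrix h)"
      by (simp add: matrix_compose[OF lin(2,1)] det_mul)
    have [measurable]: "f \<in> borel \<rightarrow>\<^sub>M borel" "h \<in> borel \<rightarrow>\<^sub>M borel"
      using lin by (auto intro!: borel_measurable_continuous_onI linear_continuous_on simp: linear_linear)
    show "P (f \<circ> h)"
      unfolding P_def
    proof safe
      fix g :: "real^'n \<Rightarrow> ennreal"
      assume nz: "det (matrix (f \<circ> h)) \<noteq> 0" and [measurable]: "g \<in> borel_measurable borel"
      have "ennreal \<bar>det (matrix (f \<circ> h))\<bar> * (\<integral>\<^sup>+x. g ((f \<circ> h) x) \<partial>lborel) =
          ennreal \<bar>det (matrix f)\<bar> * (ennreal \<bar>det (matrix h)\<bar> * (\<integral>\<^sup>+x. g (f (h x)) \<partial>lborel))"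
        by (simp add: det abs_mult ennreal_mult' mult_ac)
      also have "ennreal \<bar>det (matrix h)\<bar> * (\<integral>\<^sup>+x. g (f (h x)) \<partial>lborel) = (\<integral>\<^sup>+x. g (f x) \<partial>lborel)"
        using h nz det unfolding P_def by (auto elim!: ballE[of _ _ "\<lambda>x. g (f x)"])
      also have "ennreal \<bar>det (matrix f)\<bar> * (\<integral>\<^sup>+x. g (f x) \<partial>lborel) = (\<integral>\<^sup>+x. g x \<partial>lborel)"
        using f nz det unfolding P_def by auto
      finally show "ennreal \<bar>det (matrix (f \<circ> h))\<bar> * (\<integral>\<^sup>+x. g ((f \<circ> h) x) \<partial>lborel) = (\<integral>\<^sup>+x. g x \<partial>lborel)" .
    qed
  next
    fix f :: "real^'n \<Rightarrow> real^'n" and i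
    assume "linear f" and 0: "\<And>x. f x $ i = 0"
    have "row i (matrix f) = 0"
      by (auto simp: row_def matrix_def vec_eq_iff 0)
    then show "P f" by (auto simp: P_def det_zero_row)
  next
    fix c :: "'n \<Rightarrow> real"
    have "det (matrix (\<lambda>x::real^'n. \<chi> i. c i * x $ i)) = (\<Prod>i\<in>UNIV. c i)"
      by (subst det_diagonal) (auto simp: matrix_def axis_def)
    then show "P (\<lambda>x. \<chi> i. c i * x $ i)"
      unfolding P_def by (auto intro: nn_integral_diagonal)
  next
    fix m n :: 'n assume "m \<noteq> n"
    let ?h = "\<lambda>v::real^'n. \<chi> i. v $ Transposition.transpose m n i"
    have "?h (?h x) = x" for x by (simp add: vec_eq_iff)
    then have "?h \<circ> ?h = id" by auto
    moreover have "linear ?h" by (rule linearI) (simp_all add: vec_eq_iff)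
    ultimately have "det (matrix ?h) * det (matrix ?h) = 1"
      by (simp flip: det_mul matrix_compose add: matrix_id)
    then have "\<bar>det (matrix ?h)\<bar> = 1"
      using power2_eq_1_iff[of "det (matrix ?h)"] by (auto simp: power2_eq_square)
    then show "P ?h"
      unfolding P_def by (auto simp: nn_integral_swap)
  next
    fix m n :: 'n assume mn: "m \<noteq> n"
    let ?h = "\<lambda>v::real^'n. \<chi> i. if i = m then v $ m + v $ n else v $ i"
    have "matrix ?h = (\<chi> k. if k = m then row m (mat 1) + 1 *s row n (mat 1) else row k (mat 1))"
      using mn by (auto simp: matrix_def axis_def row_def mat_def vec_eq_iff)
    then have "det (matrix ?h) = 1"
      by (simp add: det_row_operation[OF mn])
    then show "P ?h"
      unfolding P_def by (auto simp: nn_integral_shear[OF _ mn])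
  qed
  then show ?thesis using assms by (auto simp: P_def)
qed

lemma lborel_linear:
  assumes "linear f" "det (matrix f) \<noteq> 0"
  shows "(lborel :: (real^'n) measure) = density (distr lborel borel f) (\<lambda>_. ennreal \<bar>det (matrix f)\<bar>)"
proof (rule measure_eqI)
  have [measurable]: "f \<in> borel \<rightarrow>\<^sub>M borel"
    using assms(1) by (auto intro!: borel_measurable_continuous_onI linear_continuous_on simp: linear_linear)
  fix A :: "(real^'n) set" assume "A \<in> sets lborel"
  then have [measurable]: "A \<in> sets borel" by simp
  have "emeasure lborel A = (\<integral>\<^sup>+x. indicator A x \<partial>lborel)" by simp
  also have "\<dots> = ennreal \<bar>det (matrix f)\<bar> * (\<integral>\<^sup>+x. indicator A (f x) \<partial>lborel)"
    by (rule nn_integral_linear[OF assms, symmetric]) simp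
  also have "\<dots> = emeasure (density (distr lborel borel f) (\<lambda>_. ennreal \<bar>det (matrix f)\<bar>)) A"
    by (simp add: emeasure_density nn_integral_cmult nn_integral_distr del: nn_integral_indicator)
  finally show "emeasure lborel A = emeasure (density (distr lborel borel f) (\<lambda>_. ennreal \<bar>det (matrix f)\<bar>)) A" .
qed simp

lemma
  fixes g :: "real^'n \<Rightarrow> complex"
  assumes f: "linear f" "det (matrix f) \<noteq> 0" and g[measurable]: "g \<in> borel_measurable borel"
  shows integral_linear: "(\<integral>x. g x \<partial>lborel) = \<bar>det (matrix f)\<bar> * (\<integral>x. g (f x) \<partial>lborel)"
    and integrable_linear: "integrable lborel g \<longleftrightarrow> integrable lborel (\<lambda>x. g (f x))"
proof -
  have [measurable]: "f \<in> borel \<rightarrow>\<^sub>M borel"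
    using assms(1) by (auto intro!: borel_measurable_continuous_onI linear_continuous_on simp: linear_linear)
  show "(\<integral>x. g x \<partial>lborel) = \<bar>det (matrix f)\<bar> * (\<integral>x. g (f x) \<partial>lborel)"
    by (subst lborel_linear[OF f]) (simp add: integral_density integral_distr scaleR_conv_of_real)
  have c: "complex_of_real \<bar>det (matrix f)\<bar> \<noteq> 0" using f(2) by simp
  have "integrable lborel (\<lambda>x. complex_of_real \<bar>det (matrix f)\<bar> * g (f x)) \<longleftrightarrow> integrable lborel (\<lambda>x. g (f x))"
  proof
    assume "integrable lborel (\<lambda>x. complex_of_real \<bar>det (matrix f)\<bar> * g (f x))"
    from integrable_mult_right[OF this, of "1 / complex_of_real \<bar>det (matrix f)\<bar>"]
    show "integrable lborel (\<lambda>x. g (f x))" using c by simp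
  qed (rule integrable_mult_right)
  then show "integrable lborel g \<longleftrightarrow> integrable lborel (\<lambda>x. g (f x))"
    by (subst lborel_linear[OF f]) (simp add: integrable_density integrable_distr_eq scaleR_conv_of_real)
qed

lemma integral_translate:
  fixes g :: "real^'n \<Rightarrow> complex"
  assumes [measurable]: "g \<in> borel_measurable borel"
  shows "(\<integral>x. g (x + a) \<partial>lborel) = (\<integral>x. g x \<partial>lborel)"
proof -
  have eq: "(lborel :: (real^'n) measure) = distr lborel borel (\<lambda>x. x + a)"
    using lborel_affine[of 1 a] by (simp add: density_1 add.commute)
  show ?thesis by (subst (2) eq) (simp add: integral_distr)
qed

subsection \<open>Integrals of Schwartz functions\<close>

text \<open>An integrable majorant for rapidly decreasing functions; its product form reduces integrability to
  dimension one.\<close>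

definition decay :: "real^'n \<Rightarrow> real" where
  "decay x = (\<Prod>i\<in>UNIV. 1 / (1 + (x $ i)\<^sup>2))"

lemma integrable_decay: "integrable lborel decay"
proof -
  have "integrable lborel (\<lambda>t::real. 1 / (1 + t\<^sup>2))"
    using integrable_inverse_1_plus_square
    by (simp add: set_integrable_def einterval_def inverse_eq_divide)
  from integrable_prod_vec[of "\<lambda>_ t. 1 / (1 + t\<^sup>2)", OF this] show ?thesis
    by (simp add: decay_def[abs_def])
qed

lemma decay_pos: "decay x > 0"
  unfolding decay_def by (intro prod_pos) (auto simp: add_pos_nonneg)

lemma decay_lower_bound: "1 \<le> (1 + norm (x :: real^'n)) ^ (2 * CARD('n)) * decay x"
proof -
  have "1 + (x $ i)\<^sup>2 \<le> (1 + norm x)\<^sup>2" for i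
  proof -
    have "(x $ i)\<^sup>2 \<le> (norm x)\<^sup>2"
      using component_le_norm_cart[of x i] by (metis abs_ge_zero power2_abs power_mono)
    moreover have "(1 + norm x)\<^sup>2 = 1 + (norm x)\<^sup>2 + 2 * norm x"
      by (simp add: power2_sum)
    ultimately show ?thesis using norm_ge_zero[of x] by linarith
  qed
  then have "(\<Prod>i\<in>(UNIV::'n set). 1 + (x $ i)\<^sup>2) \<le> (\<Prod>i\<in>(UNIV::'n set). (1 + norm x)\<^sup>2)"
    by (intro prod_mono) (auto simp: add_nonneg_nonneg)
  then have "(\<Prod>i\<in>(UNIV::'n set). 1 + (x $ i)\<^sup>2) \<le> (1 + norm x) ^ (2 * CARD('n))"
    by (simp add: power_mult)
  moreover have "(\<Prod>i\<in>(UNIV::'n set). 1 + (x $ i)\<^sup>2) > 0"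
    by (intro prod_pos) (auto simp: add_pos_nonneg)
  ultimately show ?thesis
    by (simp add: decay_def prod_dividef)
qed

lemma rapidly_decreasing_le_decay:
  fixes f :: "real^'n \<Rightarrow> complex"
  assumes "(1 + norm x) ^ (2 * CARD('n)) * norm (f x) \<le> B"
  shows "norm (f x) \<le> B * decay x"
proof -
  have "norm (f x) * 1 \<le> norm (f x) * ((1 + norm x) ^ (2 * CARD('n)) * decay x)"
    by (intro mult_left_mono decay_lower_bound) auto
  also have "\<dots> = (1 + norm x) ^ (2 * CARD('n)) * norm (f x) * decay x" by simp
  also have "\<dots> \<le> B * decay x"
    using assms decay_pos[of x] by (intro mult_right_mono) auto
  finally show ?thesis by simp
qed

lemma rapidly_decreasing_decay:
  fixes f :: "real^'n \<Rightarrow> complex"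
  assumes "rapidly_decreasing f"
  obtains B where "B > 0" "\<And>x. norm (f x) \<le> B * decay x"
proof -
  obtain B where B: "\<And>x. (1 + norm x) ^ (2 * CARD('n)) * norm (f x) \<le> B"
    using assms unfolding rapidly_decreasing_def by blast
  have "norm (f x) \<le> (\<bar>B\<bar> + 1) * decay x" for x
    by (rule rapidly_decreasing_le_decay) (use B[of x] in linarith)
  then show ?thesis by (rule that[rotated]) simp
qed

lemma integrable_rapidly_decreasing:
  assumes "rapidly_decreasing f" "f \<in> borel_measurable borel"
  shows "integrable lborel f"
proof -
  obtain B where B: "B > 0" "\<And>x. norm (f x) \<le> B * decay x"
    using rapidly_decreasing_decay[OF assms(1)] by blast
  show ?thesis
    by (rule Bochner_Integration.integrable_bound[where f = "\<lambda>x. B * decay x"])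
       (use B assms(2) in \<open>auto intro!: integrable_mult_right integrable_decay
         simp: abs_mult abs_of_pos[OF decay_pos]\<close>)
qed

lemma schwartz_measurable: "f \<in> schwartz_functions \<Longrightarrow> f \<in> borel_measurable borel"
  by (simp add: schwartz_smooth smooth_measurable)

lemma schwartz_integrable: "f \<in> schwartz_functions \<Longrightarrow> integrable lborel f"
  by (simp add: integrable_rapidly_decreasing schwartz_rapid schwartz_measurable)

lemma schwartz_bounded:
  assumes "f \<in> schwartz_functions" obtains B where "B > 0" "\<And>x. norm (f x) \<le> B"
proof -
  obtain B where B: "\<And>x. (1 + norm x) ^ 0 * norm (f x) \<le> B"
    using schwartz_rapid[OF assms] unfolding rapidly_decreasing_def by metis
  have "norm (f x) \<le> \<bar>B\<bar> + 1" for x using B[of x] by simp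
  then show ?thesis by (rule that[rotated]) simp
qed

lemma norm_integral_le:
  fixes f :: "'a \<Rightarrow> 'b::{banach,second_countable_topology}"
  assumes "integrable M f" "integrable M g" "\<And>x. norm (f x) \<le> g x"
  shows "norm (\<integral>x. f x \<partial>M) \<le> (\<integral>x. g x \<partial>M)"
  by (rule order_trans[OF integral_norm_bound]) (intro integral_mono integrable_norm assms)

text \<open>Differentiation under the integral sign. The mean value inequality bounds the difference quotients by
  \<open>2 * b\<close>, so dominated convergence applies along every sequence tending to \<open>z0\<close>.\<close>

lemma has_derivative_integral:
  fixes H :: "real^'n \<Rightarrow> 'b \<Rightarrow> complex"
  assumes d: "\<And>z w. z \<in> ball z0 1 \<Longrightarrow> ((\<lambda>z. H z w) has_derivative H' z w) (at z)"
    and i: "\<And>z. z \<in> ball z0 1 \<Longrightarrow> integrable M (H z)"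
    and i': "\<And>h. integrable M (\<lambda>w. H' z0 w h)"
    and b: "\<And>z w h. z \<in> ball z0 1 \<Longrightarrow> norm (H' z w h) \<le> b w * norm h"
    and ib: "integrable M b"
  shows "((\<lambda>z. \<integral>w. H z w \<partial>M) has_derivative (\<lambda>h. \<integral>w. H' z0 w h \<partial>M)) (at z0)"
proof -
  have z0: "z0 \<in> ball z0 1" by simp
  have b0: "0 \<le> b w" for w
    using order_trans[OF norm_ge_zero b[OF z0, of w "axis undefined 1"]] by (simp add: norm_axis_1)
  have lin: "linear (H' z0 w)" for w using has_derivative_linear[OF d[OF z0]] .
  have lip: "norm (H z w - H z0 w) \<le> b w * norm (z - z0)" if "z \<in> ball z0 1" for z w
  proof (rule differentiable_bound[of "ball z0 1" "\<lambda>z. H z w" "\<lambda>z. H' z w"])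
    fix x assume "x \<in> ball z0 1"
    then show "((\<lambda>z. H z w) has_derivative H' x w) (at x within ball z0 1)"
      by (rule has_derivative_at_withinI[OF d])
    show "onorm (H' x w) \<le> b w"
      by (rule onorm_bound[OF b0 b]) fact
  qed (use that in auto)
  have bl: "bounded_linear (\<lambda>h. \<integral>w. H' z0 w h \<partial>M)"
  proof (rule bounded_linear_intro[where K = "\<integral>w. b w \<partial>M"])
    fix x y and r :: real
    show "(\<integral>w. H' z0 w (x + y) \<partial>M) = (\<integral>w. H' z0 w x \<partial>M) + (\<integral>w. H' z0 w y \<partial>M)"
      by (simp add: linear_add[OF lin] Bochner_Integration.integral_add[OF i' i'])
    show "(\<integral>w. H' z0 w (r *\<^sub>R x) \<partial>M) = r *\<^sub>R (\<integral>w. H' z0 w x \<partial>M)"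
      by (simp add: linear_cmul[OF lin])
    have "norm (\<integral>w. H' z0 w x \<partial>M) \<le> (\<integral>w. b w * norm x \<partial>M)"
      by (rule norm_integral_le[OF i' _ b[OF z0]]) (intro integrable_mult_left ib)
    then show "norm (\<integral>w. H' z0 w x \<partial>M) \<le> norm x * (\<integral>w. b w \<partial>M)"
      by (simp add: mult.commute)
  qed
  have "((\<lambda>y. norm ((\<integral>w. H y w \<partial>M) - (\<integral>w. H z0 w \<partial>M) - (\<integral>w. H' z0 w (y - z0) \<partial>M)) / norm (y - z0)) \<longlongrightarrow> 0) (at z0)"
    unfolding tendsto_at_iff_sequentially
  proof (intro allI impI)
    fix X :: "nat \<Rightarrow> real^'n"
    assume ne: "\<forall>i. X i \<in> UNIV - {z0}" and X: "X \<longlonglongrightarrow> z0"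
    obtain N where N: "\<And>k. k \<ge> N \<Longrightarrow> X k \<in> ball z0 1"
      using metric_LIMSEQ_D[OF X, of 1] by (auto simp: dist_commute)
    define q where "q k w = (H (X (k + N)) w - H z0 w - H' z0 w (X (k + N) - z0)) /\<^sub>R norm (X (k + N) - z0)" for k w
    have iq: "integrable M (q k)" for k
      unfolding q_def[abs_def] using N[of "k + N"]
      by (intro integrable_scaleR_right Bochner_Integration.integrable_diff i i' z0) auto
    have "(\<lambda>k. \<integral>w. q k w \<partial>M) \<longlonglongrightarrow> (\<integral>w. 0 \<partial>M)"
    proof (rule integral_dominated_convergence[where w = "\<lambda>w. 2 * b w"])
      show "AE w in M. (\<lambda>k. q k w) \<longlonglongrightarrow> 0"
      proof (rule AE_I2)
        fix w
        have "((\<lambda>y. norm (H y w - H z0 w - H' z0 w (y - z0)) / norm (y - z0)) \<longlongrightarrow> 0) (at z0)"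
          using d[OF z0, of w] unfolding has_derivative_iff_norm by simp
        then have "((\<lambda>y. norm (H y w - H z0 w - H' z0 w (y - z0)) / norm (y - z0)) \<circ> X) \<longlonglongrightarrow> 0"
          using ne X unfolding tendsto_at_iff_sequentially by blast
        then have "(\<lambda>k. norm (q k w)) \<longlonglongrightarrow> 0"
          using LIMSEQ_ignore_initial_segment[of _ 0 N]
          by (fastforce simp: q_def o_def divide_inverse mult.commute)
        then show "(\<lambda>k. q k w) \<longlonglongrightarrow> 0" by (rule tendsto_norm_zero_cancel)
      qed
      fix k
      show "AE w in M. norm (q k w) \<le> 2 * b w"
      proof (rule AE_I2)
        fix w
        have "norm (H (X (k + N)) w - H z0 w - H' z0 w (X (k + N) - z0)) \<le> 2 * b w * norm (X (k + N) - z0)"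
          using norm_triangle_ineq4[of "H (X (k + N)) w - H z0 w" "H' z0 w (X (k + N) - z0)"]
            lip[OF N[of "k + N"], of w] b[OF z0, of w "X (k + N) - z0"] by simp
        moreover have "norm (X (k + N) - z0) > 0" using ne by simp
        moreover have "norm (q k w) = norm (H (X (k + N)) w - H z0 w - H' z0 w (X (k + N) - z0)) / norm (X (k + N) - z0)"
          by (simp add: q_def divide_inverse mult.commute)
        ultimately show "norm (q k w) \<le> 2 * b w"
          by (simp add: pos_divide_le_eq)
      qed
    qed (use iq ib in auto)
    then have "(\<lambda>k. norm (\<integral>w. q k w \<partial>M)) \<longlonglongrightarrow> 0"
      by (simp add: tendsto_norm_zero)
    moreover have "norm (\<integral>w. q k w \<partial>M) =
        norm ((\<integral>w. H (X (k + N)) w \<partial>M) - (\<integral>w. H z0 w \<partial>M) - (\<integral>w. H' z0 w (X (k + N) - z0) \<partial>M)) / norm (X (k + N) - z0)" for k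
    proof -
      have ik: "integrable M (H (X (k + N)))" using N[of "k + N"] by (intro i) auto
      have "(\<integral>w. q k w \<partial>M) = ((\<integral>w. H (X (k + N)) w \<partial>M) - (\<integral>w. H z0 w \<partial>M) -
          (\<integral>w. H' z0 w (X (k + N) - z0) \<partial>M)) /\<^sub>R norm (X (k + N) - z0)"
        unfolding q_def
        by (simp add: ik i[OF z0] i' Bochner_Integration.integral_diff Bochner_Integration.integrable_diff)
      then show ?thesis by (simp add: divide_inverse mult.commute)
    qed
    ultimately have "(\<lambda>k. ((\<lambda>y. norm ((\<integral>w. H y w \<partial>M) - (\<integral>w. H z0 w \<partial>M) - (\<integral>w. H' z0 w (y - z0) \<partial>M)) / norm (y - z0)) \<circ> X) (k + N)) \<longlonglongrightarrow> 0"
      by (simp add: o_def)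
    then show "((\<lambda>y. norm ((\<integral>w. H y w \<partial>M) - (\<integral>w. H z0 w \<partial>M) - (\<integral>w. H' z0 w (y - z0) \<partial>M)) / norm (y - z0)) \<circ> X) \<longlonglongrightarrow> 0"
      by (rule LIMSEQ_offset)
  qed
  with bl show ?thesis unfolding has_derivative_iff_norm by simp
qed

text \<open>The integral of \<open>f(x + z)\<close> over \<open>x\<close> does not depend on \<open>z\<close>; differentiate it at \<open>z = 0\<close>.\<close>

lemma integral_partial_deriv:
  assumes f: "f \<in> schwartz_functions"
  shows "(\<integral>x. partial_deriv i f x \<partial>lborel) = 0"
proof -
  have "\<exists>B>0. \<forall>x. (1 + norm x) ^ (2 * CARD('a)) * norm (partial_deriv j f x) \<le> B" for j
  proof -
    obtain B where "\<And>x. (1 + norm x) ^ (2 * CARD('a)) * norm (partial_deriv j f x) \<le> B"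
      using schwartz_rapid[OF schwartz_partial_deriv[OF f, of j]] unfolding rapidly_decreasing_def by blast
    then have "\<forall>x. (1 + norm x) ^ (2 * CARD('a)) * norm (partial_deriv j f x) \<le> \<bar>B\<bar> + 1"
      by (meson abs_ge_self add_increasing2 order_trans zero_le_one)
    then show ?thesis by (intro exI[of _ "\<bar>B\<bar> + 1"]) auto
  qed
  then obtain B where B: "\<And>j. B j > 0"
      "\<And>j x. (1 + norm x) ^ (2 * CARD('a)) * norm (partial_deriv j f x) \<le> B j"
    by metis
  define c where "c = 2 ^ (2 * CARD('a)) * (\<Sum>j\<in>UNIV. B j)"
  have "((\<lambda>z. \<integral>w. f (w + z) \<partial>lborel) has_derivative
      (\<lambda>h. \<integral>w. (\<Sum>j\<in>UNIV. h $ j *\<^sub>R partial_deriv j f (w + 0)) \<partial>lborel)) (at 0)"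
  proof (rule has_derivative_integral[where b = "\<lambda>w. c * decay w" and
        H' = "\<lambda>z w h. \<Sum>j\<in>UNIV. h $ j *\<^sub>R partial_deriv j f (w + z)"])
    fix z w :: "real^'a" and h :: "real^'a"
    show "((\<lambda>z. f (w + z)) has_derivative (\<lambda>h. \<Sum>j\<in>UNIV. h $ j *\<^sub>R partial_deriv j f (w + z))) (at z)"
      using has_derivative_compose_affine[of id f z w] schwartz_differentiable[OF f]
      by (simp add: linear_id add.commute)
    show "integrable lborel (\<lambda>w. f (w + z))"
      using schwartz_integrable[OF schwartz_translate[OF f]] .
    show "integrable lborel (\<lambda>w. \<Sum>j\<in>UNIV. h $ j *\<^sub>R partial_deriv j f (w + 0))"
      by (intro Bochner_Integration.integrable_sum integrable_scaleR_right)
         (simp add: schwartz_integrable[OF schwartz_partial_deriv[OF f]])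
    assume z: "z \<in> ball 0 1"
    have "norm (partial_deriv j f (w + z)) \<le> (2 ^ (2 * CARD('a)) * B j) * decay w" for j
    proof (rule rapidly_decreasing_le_decay[of w "\<lambda>w. partial_deriv j f (w + z)"])
      \<comment> \<open>\<open>1 + norm w \<le> 2 * (1 + norm (w + z))\<close> for \<open>norm z < 1\<close> makes the majorant uniform in \<open>z\<close>.\<close>
      have "norm w \<le> norm (w + z) + norm z"
        by (metis add_diff_cancel_right' norm_triangle_ineq4)
      moreover have "norm z < 1" using z by simp
      ultimately have "1 + norm w \<le> 2 + 2 * norm (w + z)"
        using norm_ge_zero[of "w + z"] by linarith
      then have "1 + norm w \<le> 2 * (1 + norm (w + z))" by simp
      then have "(1 + norm w) ^ (2 * CARD('a)) \<le> (2 * (1 + norm (w + z))) ^ (2 * CARD('a))"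
        by (intro power_mono) auto
      then have "(1 + norm w) ^ (2 * CARD('a)) * norm (partial_deriv j f (w + z)) \<le>
          (2 * (1 + norm (w + z))) ^ (2 * CARD('a)) * norm (partial_deriv j f (w + z))"
        by (intro mult_right_mono) auto
      also have "\<dots> = 2 ^ (2 * CARD('a)) * ((1 + norm (w + z)) ^ (2 * CARD('a)) * norm (partial_deriv j f (w + z)))"
        by (simp add: power_mult_distrib del: distrib_left_numeral)
      also have "\<dots> \<le> 2 ^ (2 * CARD('a)) * B j" using B(2) by (intro mult_left_mono) auto
      finally show "(1 + norm w) ^ (2 * CARD('a)) * norm (partial_deriv j f (w + z)) \<le> 2 ^ (2 * CARD('a)) * B j" .
    qed
    then have "norm (h $ j *\<^sub>R partial_deriv j f (w + z)) \<le> norm h * ((2 ^ (2 * CARD('a)) * B j) * decay w)" for j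
      using component_le_norm_cart[of h j] by (simp add: mult_mono)
    then have "norm (\<Sum>j\<in>UNIV. h $ j *\<^sub>R partial_deriv j f (w + z)) \<le>
        (\<Sum>j\<in>UNIV. norm h * ((2 ^ (2 * CARD('a)) * B j) * decay w))"
      by (intro sum_norm_le) auto
    also have "\<dots> = c * decay w * norm h"
      by (simp add: c_def sum_distrib_left sum_distrib_right mult_ac)
    finally show "norm (\<Sum>j\<in>UNIV. h $ j *\<^sub>R partial_deriv j f (w + z)) \<le> c * decay w * norm h" .
  qed (intro integrable_mult_right integrable_decay)
  moreover have "(\<integral>w. f (w + z) \<partial>lborel) = (\<integral>w. f w \<partial>lborel)" for z
    by (rule integral_translate) (rule schwartz_measurable[OF f])
  ultimately have D: "((\<lambda>z::real^'a. \<integral>w. f w \<partial>lborel) has_derivative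
      (\<lambda>h. \<integral>w. (\<Sum>j\<in>UNIV. h $ j *\<^sub>R partial_deriv j f w) \<partial>lborel)) (at 0)"
    by simp
  have "(\<lambda>h. \<integral>w. (\<Sum>j\<in>UNIV. h $ j *\<^sub>R partial_deriv j f w) \<partial>lborel) = (\<lambda>h. 0)"
    by (rule has_derivative_unique[OF D]) simp
  then have "(\<integral>w. (\<Sum>j\<in>UNIV. axis i 1 $ j *\<^sub>R partial_deriv j f w) \<partial>lborel) = 0"
    by meson
  then show ?thesis by (simp add: sum_axis_scaleR)
qed

section \<open>Cutoff functions\<close>

lemma test_function_iff:
  "f \<in> test_functions \<longleftrightarrow> smooth_fun f \<and> (\<exists>R. \<forall>x. R < norm x \<longrightarrow> f x = 0)"
proof -
  have "compact (closure {x. f x \<noteq> 0}) \<longleftrightarrow> (\<exists>R. \<forall>x. R < norm x \<longrightarrow> f x = 0)"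
    unfolding compact_closure bounded_iff by (metis (mono_tags) mem_Collect_eq not_less)
  then show ?thesis by (auto simp: test_functions_def)
qed

lemma test_functionI:
  "smooth_fun f \<Longrightarrow> (\<And>x. R < norm x \<Longrightarrow> f x = 0) \<Longrightarrow> f \<in> test_functions"
  by (auto simp: test_function_iff)

lemma test_function_smooth: "f \<in> test_functions \<Longrightarrow> smooth_fun f"
  by (simp add: test_function_iff)

lemma test_function_partial_derivs:
  assumes "f \<in> test_functions" shows "partial_derivs is f \<in> test_functions"
proof -
  obtain R where R: "\<And>x. R < norm x \<Longrightarrow> f x = 0" and s: "smooth_fun f"
    using assms by (auto simp: test_function_iff)
  then have "partial_derivs is f x = 0" if "R < norm x" for x
    using partial_derivs_zero_outside that by blast
  then show ?thesis by (intro test_functionI[of _ R] smooth_partial_derivs s)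
qed

lemma test_functions_subset_schwartz: "test_functions \<subseteq> schwartz_functions"
proof
  fix f :: "real^'n \<Rightarrow> complex" assume f: "f \<in> test_functions"
  have "rapidly_decreasing g" if g: "g \<in> test_functions" for g :: "real^'n \<Rightarrow> complex"
    unfolding rapidly_decreasing_def
  proof
    fix k
    obtain R where R: "\<And>x. R < norm x \<Longrightarrow> g x = 0" and s: "smooth_fun g"
      using g by (auto simp: test_function_iff)
    have "continuous_on (cball 0 R) (\<lambda>x. (1 + norm x) ^ k * norm (g x))"
      using smooth_continuous[OF s] by (intro continuous_intros)
    then have "compact ((\<lambda>x. (1 + norm x) ^ k * norm (g x)) ` cball 0 R)"
      by (rule compact_continuous_image) (rule compact_cball)
    then obtain B where B: "\<And>x. x \<in> cball 0 R \<Longrightarrow> (1 + norm x) ^ k * norm (g x) \<le> B"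
      using compact_imp_bounded by (fastforce simp: bounded_iff)
    have "(1 + norm x) ^ k * norm (g x) \<le> max B 0" for x
      using R[of x] B[of x] by (cases "norm x \<le> R") (auto simp: max_def)
    then show "\<exists>B. \<forall>x. (1 + norm x) ^ k * norm (g x) \<le> B" by blast
  qed
  then show "f \<in> schwartz_functions"
    unfolding schwartz_iff using f test_function_smooth test_function_partial_derivs by blast
qed

lemma test_function_mult:
  assumes "f \<in> test_functions" "smooth_fun g" shows "(\<lambda>x. f x * g x) \<in> test_functions"
  using assms by (auto simp: test_function_iff smooth_mult)

lemma test_function_cmult: "f \<in> test_functions \<Longrightarrow> (\<lambda>x. a * f x) \<in> test_functions"
  by (auto simp: test_function_iff smooth_cmult)

lemma test_function_add:
  assumes "f \<in> test_functions" "g \<in> test_functions" shows "(\<lambda>x. f x + g x) \<in> test_functions"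
proof -
  obtain R S where "\<And>x. R < norm x \<Longrightarrow> f x = 0" "\<And>x. S < norm x \<Longrightarrow> g x = 0"
    using assms by (auto simp: test_function_iff)
  then show ?thesis
    using assms by (intro test_functionI[of _ "max R S"]) (auto simp: test_function_iff smooth_add)
qed

lemma test_function_zero: "(\<lambda>x. 0) \<in> test_functions"
  by (auto simp: test_function_iff smooth_const)

lemma test_function_sum:
  "(\<And>i. i \<in> I \<Longrightarrow> f i \<in> test_functions) \<Longrightarrow> (\<lambda>x. \<Sum>i\<in>I. f i x) \<in> test_functions"
  by (induction I rule: infinite_finite_induct) (auto intro: test_function_zero test_function_add)

lemma test_function_compose_linear:
  fixes f :: "real^'n \<Rightarrow> complex" and M :: "real^'m \<Rightarrow> real^'n"
  assumes "f \<in> test_functions" "linear M" "linear M'" "\<And>x. M' (M x) = x"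
  shows "(\<lambda>x. f (M x)) \<in> test_functions"
proof -
  obtain R where R: "\<And>x::real^'n. R < norm x \<Longrightarrow> f x = 0" and s: "smooth_fun f"
    using assms(1) by (auto simp: test_function_iff)
  obtain B where B: "B > 0" "\<And>x. norm (M' x) \<le> B * norm x"
    using linear_bounded_pos[OF assms(3)] by blast
  show ?thesis
  proof (rule test_functionI)
    fix x :: "real^'m" assume "B * R < norm x"
    also have "\<dots> \<le> B * norm (M x)" using B(2)[of "M x"] assms(4) by simp
    finally show "f (M x) = 0" using B(1) R by simp
  qed (rule smooth_compose_linear[OF s assms(2)])
qed

lemma test_function_translate:
  fixes f :: "real^'n \<Rightarrow> complex"
  assumes "f \<in> test_functions" shows "(\<lambda>x. f (x + a)) \<in> test_functions"
proof -
  obtain R where R: "\<And>x. R < norm x \<Longrightarrow> f x = 0" and s: "smooth_fun f"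
    using assms(1) by (auto simp: test_function_iff)
  show ?thesis
  proof (rule test_functionI)
    fix x :: "real^'n" assume "R + norm a < norm x"
    moreover have "norm x \<le> norm (x + a) + norm a"
      by (metis add_diff_cancel_right' norm_triangle_ineq4)
    ultimately show "f (x + a) = 0" by (intro R) linarith
  qed (rule smooth_translate[OF s])
qed

subsection \<open>A smooth step function\<close>

text \<open>The functions \<open>p (1/t) exp (-1/t)\<close> on the positive half line, extended by zero: a class closed under
  differentiation.\<close>

definition flat :: "real poly \<Rightarrow> real \<Rightarrow> real" where
  "flat p t = (if t > 0 then poly p (1 / t) * exp (- (1 / t)) else 0)"

lemma poly_div_exp_tendsto_0: "((\<lambda>y. poly p y / exp y) \<longlongrightarrow> (0::real)) at_top"
proof -
  have "((\<lambda>y. y ^ k * poly p y / exp y) \<longlongrightarrow> (0::real)) at_top" for k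
  proof (induction p arbitrary: k)
    case (pCons a p)
    have "((\<lambda>y. a * (y ^ k / exp y) + y ^ Suc k * poly p y / exp y) \<longlongrightarrow> a * 0 + 0) at_top"
      by (intro tendsto_intros tendsto_power_div_exp_0 pCons)
    then show ?case by (simp add: algebra_simps add_divide_distrib)
  qed simp
  from this[of 0] show ?thesis by simp
qed

text \<open>For \<open>t > 0\<close> this is the chain rule, the factor \<open>1/t\<^sup>2\<close> being absorbed into the polynomial. At \<open>0\<close> the
  exponential beats every power of \<open>1/t\<close>.\<close>

lemma flat_has_derivative:
  "(flat p has_real_derivative flat (monom 1 2 * (p - pderiv p)) t) (at t)"
proof -
  consider "t > 0" | "t < 0" | "t = 0" by linarith
  then show ?thesis
  proof cases
    case 1
    have "((\<lambda>t. poly p (1 / t) * exp (- (1 / t))) has_real_derivative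
        flat (monom 1 2 * (p - pderiv p)) t) (at t)"
      using 1 by (auto intro!: derivative_eq_intros poly_DERIV[THEN DERIV_chain2]
          simp: flat_def poly_monom power2_eq_square field_simps)
    then show ?thesis
      by (rule has_field_derivative_transform_within_open[of _ _ _ "{0<..}"]) (use 1 in \<open>auto simp: flat_def\<close>)
  next
    case 2
    have "((\<lambda>t. 0) has_real_derivative flat (monom 1 2 * (p - pderiv p)) t) (at t)"
      using 2 by (simp add: flat_def)
    then show ?thesis
      by (rule has_field_derivative_transform_within_open[of _ _ _ "{..<0}"]) (use 2 in \<open>auto simp: flat_def\<close>)
  next
    case 3
    have "((\<lambda>h. flat p h / h) \<longlongrightarrow> 0) (at 0)"
      unfolding at_eq_sup_left_right
    proof (rule filterlim_sup)
      show "((\<lambda>h. flat p h / h) \<longlongrightarrow> 0) (at_left 0)"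
        by (rule tendsto_eventually) (auto simp: flat_def eventually_at_filter)
      have "((\<lambda>h. poly (pCons 0 p) (inverse h) / exp (inverse h)) \<longlongrightarrow> 0) (at_right (0::real))"
        by (rule filterlim_compose[OF poly_div_exp_tendsto_0 filterlim_inverse_at_top_right])
      moreover have "eventually (\<lambda>h. poly (pCons 0 p) (inverse h) / exp (inverse h) = flat p h / h) (at_right 0)"
        by (auto simp: eventually_at_filter flat_def field_simps exp_minus intro!: always_eventually)
      ultimately show "((\<lambda>h. flat p h / h) \<longlongrightarrow> 0) (at_right 0)"
        by (rule Lim_transform_eventually)
    qed
    then show ?thesis
      using 3 by (simp add: DERIV_def flat_def)
  qed
qed

lemma coordinate_has_derivative:
  assumes "(h has_real_derivative h') (at (x $ i))"
  shows "((\<lambda>x::real^'n. complex_of_real (h (x $ i))) has_derivative (\<lambda>v. complex_of_real (h' * v $ i))) (at x)"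
proof -
  have "((\<lambda>x::real^'n. x $ i) has_derivative (\<lambda>v. v $ i)) (at x)"
    by (rule bounded_linear.has_derivative[OF bounded_linear_vec_nth has_derivative_ident])
  from has_derivative_compose[OF this assms[THEN has_field_derivative_imp_has_derivative]]
  show ?thesis by (rule has_derivative_of_real)
qed

lemma partial_deriv_coordinate:
  assumes "\<And>t. (h has_real_derivative h' t) (at t)"
  shows "partial_deriv j (\<lambda>x::real^'n. complex_of_real (h (x $ i))) =
    (\<lambda>x. of_real (axis j 1 $ i) * complex_of_real (h' (x $ i)))"
  using partial_deriv_eqI[OF coordinate_has_derivative[OF assms]] by (auto simp: mult.commute)

lemma smooth_flat: "smooth_fun (\<lambda>x::real^'n. complex_of_real (flat p (x $ i)))"
proof (rule smooth_fun_coinduct[where G = "range (\<lambda>p (x::real^'n). complex_of_real (flat p (x $ i)))"])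
  fix g :: "real^'n \<Rightarrow> complex" and j x
  assume "g \<in> range (\<lambda>p (x::real^'n). complex_of_real (flat p (x $ i)))"
  then obtain p where g: "g = (\<lambda>x. complex_of_real (flat p (x $ i)))" by auto
  show "g differentiable (at x)"
    unfolding g using coordinate_has_derivative[OF flat_has_derivative] by (rule differentiableI)
  show "partial_deriv j g \<in> complex_span (range (\<lambda>p (x::real^'n). complex_of_real (flat p (x $ i))))"
    unfolding g partial_deriv_coordinate[OF flat_has_derivative]
    by (intro complex_span.scale complex_span.base rangeI)
qed (intro complex_span.base rangeI)

definition bump :: "real \<Rightarrow> real" where
  "bump t = flat 1 t * flat 1 (1 - t)"

text \<open>The integral starts at \<open>-1\<close>, to the left of the support of \<open>bump\<close>, so that the fundamental theorem of
  calculus applies at every point of the support, including \<open>0\<close>.\<close>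

definition smooth_step :: "real \<Rightarrow> real" where
  "smooth_step t = integral {-1..t} bump / integral {-1..1} bump"

lemma continuous_flat: "continuous_on S (flat p)"
  by (meson DERIV_isCont continuous_at_imp_continuous_on flat_has_derivative)

lemma continuous_bump: "continuous_on S bump"
  unfolding bump_def[abs_def]
  by (intro continuous_intros continuous_on_compose2[OF continuous_flat[of UNIV]]) auto

lemma bump_nonneg: "bump t \<ge> 0" and bump_pos: "0 < t \<Longrightarrow> t < 1 \<Longrightarrow> bump t > 0"
  and bump_zero: "t \<le> 0 \<or> t \<ge> 1 \<Longrightarrow> bump t = 0"
  by (auto simp: bump_def flat_def)

lemma smooth_bump: "smooth_fun (\<lambda>x::real^'n. complex_of_real (bump (x $ i)))"
proof -
  have "smooth_fun (\<lambda>x::real^'n. complex_of_real (flat 1 ((- x + axis i 1) $ i)))"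
    by (rule smooth_compose_affine[OF smooth_flat, where M = uminus]) (auto intro: linearI)
  then have r: "smooth_fun (\<lambda>x::real^'n. complex_of_real (flat 1 (1 - x $ i)))"
    by (simp add: axis_def)
  have "smooth_fun (\<lambda>x::real^'n. complex_of_real (flat 1 (x $ i)) * complex_of_real (flat 1 (1 - x $ i)))"
    by (intro smooth_mult smooth_flat r)
  then show ?thesis by (simp add: bump_def)
qed

lemma bump_integral_pos: "integral {-1..1} bump > 0"
proof -
  have "integral {-1..0} bump < integral {-1..1} bump"
  proof (rule DERIV_pos_imp_increasing_open[where f = "\<lambda>x. integral {-1..x} bump" and a = 0 and b = 1])
    fix x :: real assume x: "0 < x" "x < 1"
    have "((\<lambda>x. integral {-1..x} bump) has_real_derivative bump x) (at x within {-1..1})"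
      by (rule integral_has_real_derivative[OF continuous_bump]) (use x in auto)
    then show "\<exists>y. ((\<lambda>x. integral {-1..x} bump) has_real_derivative y) (at x) \<and> y > 0"
      using at_within_Icc_at[of "-1" x 1] bump_pos x by auto
  next
    have "continuous_on {-1..1} (\<lambda>x. integral {-1..x} bump)"
      by (rule indefinite_integral_continuous_1) (intro integrable_continuous_real continuous_bump)
    then show "continuous_on {0..1} (\<lambda>x. integral {-1..x} bump)"
      by (rule continuous_on_subset) auto
  qed simp
  moreover have "integral {-1..0} bump \<ge> 0"
    by (intro Henstock_Kurzweil_Integration.integral_nonneg integrable_continuous_real continuous_bump bump_nonneg)
  ultimately show ?thesis by linarith
qed

lemma smooth_step_has_derivative:
  "(smooth_step has_real_derivative (bump t / integral {-1..1} bump)) (at t)"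
proof (cases "t > -1")
  case True
  have "((\<lambda>x. integral {-1..x} bump) has_real_derivative bump t) (at t within {-1..t + 1})"
    by (rule integral_has_real_derivative[OF continuous_bump]) (use True in auto)
  then have "((\<lambda>x. integral {-1..x} bump) has_real_derivative bump t) (at t)"
    using at_within_Icc_at[of "-1" t "t + 1"] True by auto
  then show ?thesis
    unfolding smooth_step_def[abs_def] by (rule DERIV_cdivide)
next
  case False
  have "((\<lambda>t. 0) has_real_derivative (bump t / integral {-1..1} bump)) (at t)"
    using False by (simp add: bump_zero)
  then show ?thesis
  proof (rule has_field_derivative_transform_within_open[of _ _ _ "{..<0}"])
    fix t :: real assume "t \<in> {..<0}"
    then have "integral {-1..t} bump = integral {-1..t} (\<lambda>x. 0)"
      by (intro integral_cong) (auto simp: bump_zero)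
    then show "0 = smooth_step t" by (simp add: smooth_step_def)
  qed (use False in auto)
qed

lemma smooth_step_left: "t \<le> 0 \<Longrightarrow> smooth_step t = 0"
proof -
  assume "t \<le> 0"
  then have "integral {-1..t} bump = integral {-1..t} (\<lambda>x. 0)"
    by (intro integral_cong) (auto simp: bump_zero)
  then show ?thesis by (simp add: smooth_step_def)
qed

lemma smooth_step_right:
  assumes "t \<ge> 1" shows "smooth_step t = 1"
proof -
  have "integral {-1..1} bump + integral {1..t} bump = integral {-1..t} bump"
    by (rule Henstock_Kurzweil_Integration.integral_combine)
       (use assms in \<open>auto intro: integrable_continuous_real continuous_bump\<close>)
  moreover have "integral {1..t} bump = integral {1..t} (\<lambda>x. 0)"
    by (intro integral_cong) (auto simp: bump_zero)
  ultimately show ?thesis using bump_integral_pos by (simp add: smooth_step_def)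
qed

lemma smooth_fun_step: "smooth_fun (\<lambda>x::real^'n. complex_of_real (smooth_step (x $ i)))"
proof (rule smooth_fun_coinduct[where
      G = "insert (\<lambda>x::real^'n. complex_of_real (smooth_step (x $ i))) {f. smooth_fun f}"])
  let ?G = "insert (\<lambda>x::real^'n. complex_of_real (smooth_step (x $ i))) {f. smooth_fun f}"
  fix g :: "real^'n \<Rightarrow> complex" and j x
  assume "g \<in> ?G"
  then consider "g = (\<lambda>x. complex_of_real (smooth_step (x $ i)))" | "smooth_fun g" by auto
  then have "g differentiable (at x) \<and> partial_deriv j g \<in> complex_span ?G"
  proof cases
    case 1
    have "smooth_fun (\<lambda>x::real^'n. complex_of_real (bump (x $ i) / integral {-1..1} bump))"
      using smooth_cmult[OF smooth_bump, of "1 / complex_of_real (integral {-1..1} bump)"] by simp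
    then have "(\<lambda>x::real^'n. complex_of_real (bump (x $ i) / integral {-1..1} bump)) \<in> ?G"
      by blast
    then have "partial_deriv j g \<in> complex_span ?G"
      unfolding 1 partial_deriv_coordinate[OF smooth_step_has_derivative]
      by (intro complex_span.scale complex_span.base)
    moreover have "g differentiable (at x)"
      unfolding 1 using coordinate_has_derivative[OF smooth_step_has_derivative] by (rule differentiableI)
    ultimately show ?thesis by blast
  next
    case 2
    then have "partial_deriv j g \<in> ?G" using smooth_partial_deriv by blast
    with 2 show ?thesis by (blast intro: smooth_differentiable complex_span.base)
  qed
  then show "g differentiable (at x)" "partial_deriv j g \<in> complex_span ?G" by auto
qed (intro complex_span.base insertI1)

subsection \<open>A periodic partition of unity\<close>

definition partition_profile :: "real \<Rightarrow> real" where
  "partition_profile t = smooth_step (t + 1) - smooth_step t"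

definition int_box :: "nat \<Rightarrow> (int^'n::finite) set" where
  "int_box m = {\<kappa>. \<forall>i. \<bar>\<kappa> $ i\<bar> \<le> int m}"

lemma partition_profile_zero: "\<bar>t\<bar> \<ge> 1 \<Longrightarrow> partition_profile t = 0"
  unfolding partition_profile_def
  by (cases "t \<ge> 1") (auto simp: smooth_step_left smooth_step_right abs_if split: if_splits)

text \<open>The translates of \<open>smooth_step\<close> telescope.\<close>

lemma partition_profile_sum:
  assumes "\<bar>t\<bar> \<le> real m"
  shows "(\<Sum>k\<in>{-int m..int m}. partition_profile (t - real_of_int k)) = 1"
proof -
  have "(\<Sum>k\<in>{-int n..int n}. partition_profile (t - real_of_int k)) =
      smooth_step (t + n + 1) - smooth_step (t - n)" for n :: nat
  proof (induction n)
    case (Suc n)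
    have "{-int (Suc n)..int (Suc n)} = insert (int n + 1) (insert (- int n - 1) {-int n..int n})"
      by auto
    then show ?case
      using Suc by (simp add: partition_profile_def algebra_simps)
  qed (simp add: partition_profile_def)
  also have "smooth_step (t + m + 1) - smooth_step (t - m) = 1"
    using assms by (simp add: smooth_step_left smooth_step_right)
  finally show ?thesis .
qed

lemma int_box_bij: "bij_betw vec_lambda (PiE UNIV (\<lambda>_. {-int m..int m})) (int_box m :: (int^'n::finite) set)"
  by (rule bij_betwI[where g = vec_nth]) (auto simp: int_box_def abs_le_iff minus_le_iff PiE_def Pi_def)

lemma finite_int_box [simp]: "finite (int_box m :: (int^'n::finite) set)"
  using bij_betw_finite[OF int_box_bij[of m]] finite_PiE[OF finite, of UNIV "\<lambda>_. {-int m..int m}"] by auto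

lemma sum_int_box_prod:
  fixes f :: "'n::finite \<Rightarrow> int \<Rightarrow> 'b::comm_semiring_1"
  shows "(\<Sum>\<kappa>\<in>int_box m. \<Prod>i\<in>UNIV. f i (\<kappa> $ i)) = (\<Prod>i\<in>UNIV. \<Sum>k\<in>{-int m..int m}. f i k)"
  by (subst sum.reindex_bij_betw[OF int_box_bij, symmetric], subst prod_sum_PiE) auto

definition partition_fun :: "real^'n::finite \<Rightarrow> complex" where
  "partition_fun x = (\<Prod>i\<in>UNIV. complex_of_real (partition_profile (x $ i)))"

lemma partition_fun_sum:
  fixes x :: "real^'n::finite"
  assumes "\<And>i. \<bar>x $ i\<bar> \<le> real m"
  shows "(\<Sum>\<kappa>\<in>int_box m. partition_fun (x - of_int_vec \<kappa>)) = 1"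
proof -
  have "(\<Sum>\<kappa>\<in>int_box m. partition_fun (x - of_int_vec \<kappa>)) =
    (\<Prod>i\<in>UNIV. \<Sum>k\<in>{-int m..int m}. complex_of_real (partition_profile (x $ i - real_of_int k)))"
    unfolding partition_fun_def
    by (simp add: of_int_vec_def
        sum_int_box_prod[where f = "\<lambda>i k. complex_of_real (partition_profile (x $ i - real_of_int k))"])
  also have "\<dots> = 1"
    using partition_profile_sum[OF assms] by (simp flip: of_real_sum)
  finally show ?thesis .
qed

lemma partition_fun_zero: "\<bar>x $ i\<bar> \<ge> 1 \<Longrightarrow> partition_fun x = 0"
  unfolding partition_fun_def by (rule prod_zero) (auto intro!: exI[of _ i] simp: partition_profile_zero)

lemma smooth_partition_fun: "smooth_fun (partition_fun :: real^'n::finite \<Rightarrow> complex)"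
  unfolding partition_fun_def[abs_def]
proof (rule smooth_prod)
  fix i :: 'n
  have "smooth_fun (\<lambda>x::real^'n. complex_of_real (smooth_step ((x + axis i 1) $ i)))"
    by (rule smooth_translate[OF smooth_fun_step])
  then have r: "smooth_fun (\<lambda>x::real^'n. complex_of_real (smooth_step (x $ i + 1)))"
    by (simp add: axis_def)
  have "smooth_fun (\<lambda>x::real^'n. complex_of_real (smooth_step (x $ i + 1)) - complex_of_real (smooth_step (x $ i)))"
    by (intro smooth_diff smooth_fun_step r)
  then show "smooth_fun (\<lambda>x::real^'n. complex_of_real (partition_profile (x $ i)))"
    by (simp add: partition_profile_def)
qed

lemma partition_fun_test: "(partition_fun :: real^'n::finite \<Rightarrow> complex) \<in> test_functions"
proof (rule test_functionI[OF smooth_partition_fun])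
  fix x :: "real^'n" assume x: "real CARD('n) < norm x"
  have "\<exists>i. \<bar>x $ i\<bar> \<ge> 1"
  proof (rule ccontr)
    assume "\<not> ?thesis"
    then have "(\<Sum>i\<in>UNIV. \<bar>x $ i\<bar>) \<le> (\<Sum>i\<in>(UNIV::'n set). 1)"
      by (intro sum_mono) (auto simp: not_le less_imp_le)
    then show False using norm_le_l1_cart[of x] x by simp
  qed
  then show "partition_fun x = 0" by (auto intro: partition_fun_zero)
qed

lemma norm_bound_int_box:
  fixes x :: "real^'n::finite"
  obtains m :: nat where "\<And>i. \<bar>x $ i\<bar> \<le> real m"
proof -
  obtain m :: nat where "norm x \<le> real m" using real_arch_simple by blast
  then show ?thesis using component_le_norm_cart[of x] by (intro that[of m]) (meson order_trans)
qed

text \<open>So the choice of a partition of unity in \<open>fourier_coeff\<close> does pick one.\<close>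

lemma periodic_partition_exists: "periodic_partition (partition_fun :: real^'n::finite \<Rightarrow> complex)"
  unfolding periodic_partition_def
proof (intro conjI allI)
  fix x :: "real^'n"
  obtain m where m: "\<And>i. \<bar>x $ i\<bar> \<le> real m" using norm_bound_int_box[of x] by blast
  have z: "partition_fun (x - of_int_vec \<kappa>) = 0" if "\<kappa> \<notin> int_box (m + 1)" for \<kappa>
  proof -
    obtain i where i: "int (m + 1) < \<bar>\<kappa> $ i\<bar>" using \<open>\<kappa> \<notin> _\<close> by (auto simp: int_box_def not_le)
    then have "real (m + 1) < \<bar>real_of_int (\<kappa> $ i)\<bar>" by linarith
    then have "\<bar>(x - of_int_vec \<kappa>) $ i\<bar> \<ge> 1"
      using m[of i] by (simp add: of_int_vec_def)
    then show ?thesis by (rule partition_fun_zero)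
  qed
  have "((\<lambda>\<kappa>. partition_fun (x - of_int_vec \<kappa>)) has_sum (\<Sum>\<kappa>\<in>int_box (m + 1). partition_fun (x - of_int_vec \<kappa>))) (int_box (m + 1))"
    by (rule has_sum_finite) simp
  also have "?this \<longleftrightarrow> ((\<lambda>\<kappa>. partition_fun (x - of_int_vec \<kappa>)) has_sum (\<Sum>\<kappa>\<in>int_box (m + 1). partition_fun (x - of_int_vec \<kappa>))) UNIV"
    by (rule has_sum_cong_neutral) (auto simp: z)
  also have "(\<Sum>\<kappa>\<in>int_box (m + 1). partition_fun (x - of_int_vec \<kappa>)) = 1"
  proof (rule partition_fun_sum)
    show "\<bar>x $ i\<bar> \<le> real (m + 1)" for i using m[of i] by simp
  qed
  finally show "((\<lambda>\<kappa>. partition_fun (x - of_int_vec \<kappa>)) has_sum 1) UNIV" .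
qed (rule partition_fun_test)

section \<open>Fourier inversion for Schwartz functions\<close>

definition inv_fourier :: "(real^'n \<Rightarrow> complex) \<Rightarrow> real^'n \<Rightarrow> complex" where
  "inv_fourier h y = (\<integral>w. character y w * h w \<partial>lborel)"

lemma character_commute: "character x y = character y x"
  by (simp add: character_def inner_commute)

lemma character_pair_measurable [measurable]:
  "(\<lambda>(x, y). character x y) \<in> borel_measurable (borel \<Otimes>\<^sub>M borel :: ((real^'n) \<times> (real^'n)) measure)"
  unfolding character_def cis_conv_exp by measurable

lemma integrable_character_mult:
  assumes "integrable lborel h" shows "integrable lborel (\<lambda>w. character y w * h w)"
proof (rule Bochner_Integration.integrable_bound[OF assms])
  have [measurable]: "h \<in> borel_measurable borel" using borel_measurable_integrable[OF assms] by simp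
  show "(\<lambda>w. character y w * h w) \<in> borel_measurable lborel" by measurable
qed (simp add: norm_mult)

lemma Fubini_dominated:
  fixes f :: "real^'m \<Rightarrow> real^'n \<Rightarrow> complex"
  assumes f[measurable]: "(\<lambda>(x, y). f x y) \<in> borel_measurable (borel \<Otimes>\<^sub>M borel)"
    and a: "integrable lborel a" and b: "integrable lborel b"
    and le: "\<And>x y. norm (f x y) \<le> a x * b y"
  shows "(\<integral>y. (\<integral>x. f x y \<partial>lborel) \<partial>lborel) = (\<integral>x. (\<integral>y. f x y \<partial>lborel) \<partial>lborel)"
proof -
  have [measurable]: "a \<in> borel_measurable borel" "b \<in> borel_measurable borel"
    using borel_measurable_integrable[OF a] borel_measurable_integrable[OF b] by simp_all
  have i2: "integrable lborel (f x)" for x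
    by (rule Bochner_Integration.integrable_bound[where f = "\<lambda>y. a x * b y"])
       (use le b in \<open>auto intro: order_trans[OF _ abs_ge_self]\<close>)
  have i: "integrable (lborel \<Otimes>\<^sub>M lborel) (\<lambda>(x, y). f x y)"
  proof (rule lborel_pair.Fubini_integrable)
    show "integrable lborel (\<lambda>x. \<integral>y. norm (case (x, y) of (x, y) \<Rightarrow> f x y) \<partial>lborel)"
    proof (rule Bochner_Integration.integrable_bound[where f = "\<lambda>x. a x * (\<integral>y. b y \<partial>lborel)"])
      show "AE x in lborel. norm (\<integral>y. norm (case (x, y) of (x, y) \<Rightarrow> f x y) \<partial>lborel)
          \<le> norm (a x * (\<integral>y. b y \<partial>lborel))"
      proof (rule AE_I2)
        fix x
        have "(\<integral>y. norm (f x y) \<partial>lborel) \<le> (\<integral>y. a x * b y \<partial>lborel)"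
          by (intro integral_mono integrable_norm i2 integrable_mult_right b le)
        then show "norm (\<integral>y. norm (case (x, y) of (x, y) \<Rightarrow> f x y) \<partial>lborel)
          \<le> norm (a x * (\<integral>y. b y \<partial>lborel))" by simp
      qed
    qed (use a in auto)
  qed (use i2 in auto)
  show "(\<integral>y. (\<integral>x. f x y \<partial>lborel) \<partial>lborel) = (\<integral>x. (\<integral>y. f x y \<partial>lborel) \<partial>lborel)"
    by (rule lborel_pair.Fubini_integral[OF i])
qed

subsection \<open>Gaussians\<close>

definition gaussian :: "real^'n \<Rightarrow> complex" where
  "gaussian x = (\<Prod>i\<in>UNIV. complex_of_real (exp (- (x $ i)\<^sup>2 / 2)))"

definition gaussian_fourier :: "real^'n \<Rightarrow> complex" where
  "gaussian_fourier y = (\<Prod>i\<in>UNIV. complex_of_real (normal_density 0 (1 / (2 * pi)) (y $ i)))"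

lemma exp_square_eq: "exp (- t\<^sup>2 / 2) = sqrt (2 * pi) * std_normal_density t"
  by (simp add: std_normal_density_def)

lemma integrable_exp_square: "integrable lborel (\<lambda>t::real. complex_of_real (exp (- t\<^sup>2 / 2)))"
  unfolding exp_square_eq by (intro integrable_of_real integrable_mult_right integrable_normal_density zero_less_one)

text \<open>The characteristic function of the standard normal distribution, rescaled from \<open>exp (i s t)\<close> to
  \<open>exp (2 \<pi> i s t)\<close>.\<close>

lemma inv_fourier_exp_square:
  "(\<integral>t. cis (2 * pi * (s * t)) * complex_of_real (exp (- t\<^sup>2 / 2)) \<partial>lborel) =
     complex_of_real (normal_density 0 (1 / (2 * pi)) s)"
proof -
  have "(\<integral>t. iexp (2 * pi * s * t) \<partial>std_normal_distribution) = complex_of_real (exp (- (2 * pi * s)\<^sup>2 / 2))"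
    using fun_cong[OF char_std_normal_distribution, of "2 * pi * s"] by (simp add: char_def)
  then have "(\<integral>t. std_normal_density t *\<^sub>R iexp (2 * pi * s * t) \<partial>lborel) = complex_of_real (exp (- (2 * pi * s)\<^sup>2 / 2))"
    by (subst (asm) integral_density) auto
  then have "(\<integral>t. sqrt (2 * pi) *\<^sub>R (std_normal_density t *\<^sub>R iexp (2 * pi * s * t)) \<partial>lborel) =
      sqrt (2 * pi) *\<^sub>R complex_of_real (exp (- (2 * pi * s)\<^sup>2 / 2))"
    by (simp only: integral_scaleR_right)
  moreover have "sqrt (2 * pi) *\<^sub>R (std_normal_density t *\<^sub>R iexp (2 * pi * s * t)) =
      cis (2 * pi * (s * t)) * complex_of_real (exp (- t\<^sup>2 / 2))" for t
    by (simp only: exp_square_eq scaleR_conv_of_real cis_conv_exp of_real_mult mult_ac)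
  moreover have "sqrt (2 * pi) * exp (- (2 * pi * s)\<^sup>2 / 2) = normal_density 0 (1 / (2 * pi)) s"
  proof -
    have "sqrt (2 * pi * (1 / (2 * pi))\<^sup>2) = 1 / sqrt (2 * pi)"
      by (simp add: real_sqrt_mult real_sqrt_divide real_div_sqrt power2_eq_square field_simps)
    then show ?thesis
      by (simp add: normal_density_def power2_eq_square field_simps)
  qed
  ultimately show ?thesis
    by (simp only: of_real_mult [symmetric] scaleR_conv_of_real)
qed

lemma integrable_gaussian: "integrable lborel (gaussian :: real^'n \<Rightarrow> complex)"
  unfolding gaussian_def[abs_def] by (intro integrable_prod_vec integrable_exp_square)

lemma integrable_gaussian_fourier: "integrable lborel (gaussian_fourier :: real^'n \<Rightarrow> complex)"
  unfolding gaussian_fourier_def[abs_def]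
  by (intro integrable_prod_vec integrable_of_real integrable_normal_density) simp

lemma integral_gaussian_fourier: "(\<integral>y. gaussian_fourier y \<partial>(lborel :: (real^'n) measure)) = 1"
  unfolding gaussian_fourier_def by (subst integral_prod_vec) auto

lemma cis_sum: "cis (\<Sum>i\<in>I. f i) = (\<Prod>i\<in>I. cis (f i))"
  by (induction I rule: infinite_finite_induct) (auto simp: cis_mult[symmetric])

lemma character_prod: "character y x = (\<Prod>i\<in>UNIV. cis (2 * pi * (y $ i * x $ i)))"
  by (simp add: character_def inner_vec_def sum_distrib_left cis_sum)

lemma inv_fourier_gaussian: "inv_fourier gaussian = gaussian_fourier"
proof
  fix y :: "real^'n"
  have "integrable lborel (\<lambda>t. cis (2 * pi * (y $ i * t)) * complex_of_real (exp (- t\<^sup>2 / 2)))" for i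
    by (rule Bochner_Integration.integrable_bound[OF integrable_exp_square])
       (auto simp: norm_mult cis_conv_exp)
  then have "(\<integral>x. (\<Prod>i\<in>UNIV. cis (2 * pi * (y $ i * x $ i)) * complex_of_real (exp (- (x $ i)\<^sup>2 / 2))) \<partial>lborel) =
      gaussian_fourier y"
    by (subst integral_prod_vec) (simp_all only: inv_fourier_exp_square gaussian_fourier_def)
  then show "inv_fourier gaussian y = gaussian_fourier y"
    by (simp add: inv_fourier_def character_prod gaussian_def prod.distrib)
qed

lemma norm_gaussian_le_1: "norm (gaussian x) \<le> 1"
  unfolding gaussian_def by (simp add: prod_norm[symmetric] norm_prod_le prod_le_1)

lemma continuous_gaussian: "continuous_on S (gaussian :: real^'n \<Rightarrow> complex)"
  unfolding gaussian_def[abs_def] by (intro continuous_intros) auto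

lemma gaussian_0: "gaussian 0 = 1"
  by (simp add: gaussian_def)

subsection \<open>The inversion formula\<close>

text \<open>Insert the factor \<open>gaussian (\<omega> / n)\<close> to make the double integral absolutely convergent, exchange
  the integrals and rescale. The transform of the Gaussian is a probability density (\<open>gaussian_fourier\<close> is a product of
  normal densities), which in the limit is concentrated at \<open>- b\<close>.\<close>

theorem fourier_inversion:
  fixes h :: "real^'n \<Rightarrow> complex"
  assumes cont: "continuous_on UNIV h" and bdd: "\<And>x. norm (h x) \<le> B"
    and i: "integrable lborel h" and iF: "integrable lborel (inv_fourier h)"
  shows "(\<integral>w. character b w * inv_fourier h w \<partial>lborel) = h (- b)"
proof -
  have [measurable]: "h \<in> borel_measurable borel" by (rule borel_measurable_continuous_onI[OF cont])
  have [measurable]: "inv_fourier h \<in> borel_measurable borel"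
    using borel_measurable_integrable[OF iF] by simp
  have [measurable]: "gaussian \<in> borel_measurable (borel :: (real^'n) measure)"
    by (rule borel_measurable_continuous_onI[OF continuous_gaussian])
  have [measurable]: "gaussian_fourier \<in> borel_measurable (borel :: (real^'n) measure)"
    using borel_measurable_integrable[OF integrable_gaussian_fourier] by simp
  define c where "c n = real (Suc n)" for n
  have c: "c n > 0" for n by (simp add: c_def)
  have c_lim: "(\<lambda>n. 1 / c n) \<longlonglongrightarrow> 0"
    unfolding c_def using LIMSEQ_inverse_real_of_nat by (simp add: inverse_eq_divide)
  have lin: "linear (\<lambda>x::real^'n. c n *\<^sub>R x)" for n by (rule linear_scaleR)
  have det: "det (matrix (\<lambda>x::real^'n. c n *\<^sub>R x)) \<noteq> 0" for n
    using det_nz_iff_inj[OF lin] c[of n] by (auto simp: inj_on_def)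
  define I where "I n = (\<integral>w. gaussian ((1 / c n) *\<^sub>R w) * (character b w * inv_fourier h w) \<partial>lborel)" for n
  have "I \<longlonglongrightarrow> (\<integral>w. 1 * (character b w * inv_fourier h w) \<partial>lborel)"
    unfolding I_def
  proof (rule integral_dominated_convergence[where w = "\<lambda>w. norm (inv_fourier h w)"])
    show "AE w in lborel. (\<lambda>n. gaussian ((1 / c n) *\<^sub>R w) * (character b w * inv_fourier h w)) \<longlonglongrightarrow>
        1 * (character b w * inv_fourier h w)"
    proof (rule AE_I2)
      fix w :: "real^'n"
      have "isCont gaussian (0 :: real^'n)"
        using continuous_on_eq_continuous_at[of UNIV gaussian] continuous_gaussian by auto
      moreover have "(\<lambda>n. (1 / c n) *\<^sub>R w) \<longlonglongrightarrow> 0"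
        using tendsto_scaleR[OF c_lim tendsto_const, of w] by simp
      ultimately have "(\<lambda>n. gaussian ((1 / c n) *\<^sub>R w)) \<longlonglongrightarrow> gaussian (0 :: real^'n)"
        by (rule isCont_tendsto_compose)
      then show "(\<lambda>n. gaussian ((1 / c n) *\<^sub>R w) * (character b w * inv_fourier h w)) \<longlonglongrightarrow>
          1 * (character b w * inv_fourier h w)"
        by (intro tendsto_intros) (simp add: gaussian_0)
    qed
    show "AE w in lborel. norm (gaussian ((1 / c n) *\<^sub>R w) * (character b w * inv_fourier h w)) \<le> norm (inv_fourier h w)" for n
      by (intro AE_I2) (simp add: norm_mult mult_left_le_one_le norm_gaussian_le_1)
  qed (use iF in auto)
  moreover have "I n = (\<integral>s. h ((1 / c n) *\<^sub>R s - b) * gaussian_fourier s \<partial>lborel)" for n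
  proof -
    define g where "g w = gaussian ((1 / c n) *\<^sub>R w)" for w :: "real^'n"
    have [measurable]: "g \<in> borel_measurable borel" unfolding g_def[abs_def] by measurable
    let ?d = "\<bar>det (matrix (\<lambda>x::real^'n. c n *\<^sub>R x))\<bar>"
    have ig: "integrable lborel g"
      by (subst integrable_linear[OF lin[of n] det]) (use c[of n] integrable_gaussian in \<open>simp_all add: g_def\<close>)
    have e: "character (x + b) w = character w x * character b w" for x w
      by (simp add: character_add_left character_commute[of x w])
    have "I n = (\<integral>w. (\<integral>x. g w * character (x + b) w * h x \<partial>lborel) \<partial>lborel)"
      unfolding I_def inv_fourier_def
      by (simp add: g_def e mult_ac flip: Bochner_Integration.integral_mult_right_zero)
    also have "\<dots> = (\<integral>x. (\<integral>w. g w * character (x + b) w * h x \<partial>lborel) \<partial>lborel)"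
      by (rule Fubini_dominated[where a = "\<lambda>x. norm (h x)" and b = "\<lambda>w. norm (g w)"])
         (use i ig in \<open>auto simp: norm_mult\<close>)
    also have "\<dots> = (\<integral>x. ?d * gaussian_fourier (c n *\<^sub>R (x + b)) * h x \<partial>lborel)"
    proof -
      have "(\<integral>w. g w * character (x + b) w * h x \<partial>lborel) = ?d * gaussian_fourier (c n *\<^sub>R (x + b)) * h x" for x
      proof -
        have "(\<integral>w. g w * character (x + b) w \<partial>lborel) = ?d * (\<integral>w. g (c n *\<^sub>R w) * character (x + b) (c n *\<^sub>R w) \<partial>lborel)"
          by (rule integral_linear[OF lin det]) measurable
        also have "(\<integral>w. g (c n *\<^sub>R w) * character (x + b) (c n *\<^sub>R w) \<partial>lborel) = inv_fourier gaussian (c n *\<^sub>R (x + b))"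
          using c[of n] by (simp add: inv_fourier_def g_def character_def mult_ac)
        finally show ?thesis by (simp add: inv_fourier_gaussian)
      qed
      then show ?thesis by (simp only:)
    qed
    also have "\<dots> = (\<integral>x. ?d * gaussian_fourier (c n *\<^sub>R x) * h (x - b) \<partial>lborel)"
    proof -
      have "(\<lambda>x. ?d * gaussian_fourier (c n *\<^sub>R x) * h (x - b)) \<in> borel_measurable borel" by measurable
      from integral_translate[OF this, of b] show ?thesis by simp
    qed
    also have "\<dots> = ?d * (\<integral>x. gaussian_fourier (c n *\<^sub>R x) * h (x - b) \<partial>lborel)"
      by (simp add: mult.assoc)
    also have "\<dots> = (\<integral>s. gaussian_fourier s * h ((1 / c n) *\<^sub>R s - b) \<partial>lborel)"
    proof -
      have "(\<lambda>s. gaussian_fourier s * h ((1 / c n) *\<^sub>R s - b)) \<in> borel_measurable borel" by measurable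
      from integral_linear[OF lin[of n] det this] show ?thesis using c[of n] by simp
    qed
    finally show ?thesis by (simp add: mult.commute)
  qed
  moreover have "(\<lambda>n. \<integral>s. h ((1 / c n) *\<^sub>R s - b) * gaussian_fourier s \<partial>lborel) \<longlonglongrightarrow>
      (\<integral>s. h (- b) * gaussian_fourier s \<partial>(lborel :: (real^'n) measure))"
  proof (rule integral_dominated_convergence[where w = "\<lambda>s. B * norm (gaussian_fourier s)"])
    show "AE s in lborel. (\<lambda>n. h ((1 / c n) *\<^sub>R s - b) * gaussian_fourier s) \<longlonglongrightarrow> h (- b) * gaussian_fourier s"
    proof (rule AE_I2)
      fix s :: "real^'n"
      have "isCont h (- b)" using cont continuous_on_eq_continuous_at[of UNIV h] by auto
      moreover have "(\<lambda>n. (1 / c n) *\<^sub>R s - b) \<longlonglongrightarrow> - b"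
        using tendsto_diff[OF tendsto_scaleR[OF c_lim tendsto_const] tendsto_const, of s b] by simp
      ultimately have "(\<lambda>n. h ((1 / c n) *\<^sub>R s - b)) \<longlonglongrightarrow> h (- b)"
        by (rule isCont_tendsto_compose)
      then show "(\<lambda>n. h ((1 / c n) *\<^sub>R s - b) * gaussian_fourier s) \<longlonglongrightarrow> h (- b) * gaussian_fourier s"
        by (intro tendsto_intros)
    qed
    show "AE s in lborel. norm (h ((1 / c n) *\<^sub>R s - b) * gaussian_fourier s) \<le> B * norm (gaussian_fourier s)" for n
      using bdd by (intro AE_I2) (simp add: norm_mult mult_right_mono)
  qed (use integrable_gaussian_fourier in auto)
  moreover have "(\<integral>s. h (- b) * gaussian_fourier s \<partial>(lborel :: (real^'n) measure)) = h (- b)"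
    by (simp add: integral_gaussian_fourier)
  ultimately show ?thesis
    using LIMSEQ_unique by (metis (no_types, lifting) ext mult_1)
qed

section \<open>Phase space and the partial Fourier transform\<close>

lemma join_nth [simp]: "join x w $ Inl i = x $ i" "join x w $ Inr i = w $ i"
  by (simp_all add: join_def)

lemma part_nth: "fst_part z $ i = z $ Inl i" "snd_part z $ i = z $ Inr i"
  by (simp_all add: fst_part_def snd_part_def)

lemma part_join [simp]: "fst_part (join x w) = x" "snd_part (join x w) = w"
  by (simp_all add: vec_eq_iff part_nth)

lemma vec_sum_eq_iff:
  "(z :: 'a^('d::finite+'d)) = z' \<longleftrightarrow> (\<forall>i. z $ Inl i = z' $ Inl i) \<and> (\<forall>i. z $ Inr i = z' $ Inr i)"
  unfolding vec_eq_iff by (metis sumE)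

lemma join_part [simp]: "join (fst_part z) (snd_part z) = z"
  by (simp add: vec_sum_eq_iff part_nth)

lemma linear_fst_part: "linear fst_part" and linear_snd_part: "linear snd_part"
  by (auto intro!: linearI simp: vec_eq_iff part_nth)

lemma join_add: "join (x + x') (w + w') = join x w + join x' w'"
  by (simp add: vec_sum_eq_iff)

lemma join_scaleR: "join (r *\<^sub>R x) (r *\<^sub>R w) = r *\<^sub>R join x w"
  by (simp add: vec_sum_eq_iff)

lemma linear_join:
  assumes "linear f" "linear g" shows "linear (\<lambda>x. join (f x) (g x))"
  by (rule linearI) (simp_all add: linear_add[OF assms(1)] linear_add[OF assms(2)]
      linear_cmul[OF assms(1)] linear_cmul[OF assms(2)] join_add join_scaleR)

lemma sum_UNIV_sum:
  "(\<Sum>k\<in>(UNIV :: ('d::finite+'d) set). f k) = (\<Sum>i\<in>UNIV. f (Inl i)) + (\<Sum>i\<in>UNIV. f (Inr i))"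
  unfolding UNIV_Plus_UNIV[symmetric] by (subst sum.Plus) (simp_all add: o_def)

lemma prod_UNIV_sum:
  "(\<Prod>k\<in>(UNIV :: ('d::finite+'d) set). f k) = (\<Prod>i\<in>UNIV. f (Inl i)) * (\<Prod>i\<in>UNIV. f (Inr i))"
  unfolding UNIV_Plus_UNIV[symmetric] by (subst prod.Plus) (simp_all add: o_def)

lemma inner_join: "join x w \<bullet> z = x \<bullet> fst_part z + w \<bullet> snd_part z"
  by (simp add: inner_vec_def sum_UNIV_sum part_nth)

lemma norm_join_sq: "(norm (join x w))\<^sup>2 = (norm x)\<^sup>2 + (norm w)\<^sup>2"
  by (simp add: power2_norm_eq_inner inner_join)

lemma norm_join_ge: "norm x \<le> norm (join x w)" "norm w \<le> norm (join x w)"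
  by (rule power2_le_imp_le; simp add: norm_join_sq)+

lemma character_join: "character (join a b) z = character a (fst_part z) * character b (snd_part z)"
  by (simp add: character_def inner_join cis_mult distrib_left)

lemma measurable_join [measurable]:
  "(\<lambda>(x, y). join x y) \<in> (borel \<Otimes>\<^sub>M borel :: ((real^'d::finite) \<times> (real^'d)) measure) \<rightarrow>\<^sub>M borel"
proof -
  have "linear (\<lambda>(x, y). join x y :: real^('d+'d))"
    by (rule linearI) (auto simp: join_add join_scaleR)
  then have "continuous_on UNIV (\<lambda>(x, y). join x y :: real^('d+'d))"
    by (simp add: linear_continuous_on linear_conv_bounded_linear)
  then show ?thesis unfolding borel_prod by (rule borel_measurable_continuous_onI)
qed

lemma emeasure_lborel_box_vec:
  assumes "\<And>i. l $ i \<le> (u :: real^'n) $ i"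
  shows "emeasure lborel (box l u) = ennreal (\<Prod>i\<in>UNIV. u $ i - l $ i)"
proof -
  have "l \<bullet> b \<le> u \<bullet> b" if "b \<in> Basis" for b
    using that assms by (auto simp: inner_axis Basis_vec_eq)
  then show ?thesis by (simp add: prod_Basis_vec inner_axis)
qed

text \<open>The same argument as for \<open>lborel_vec\<close>, for the splitting of phase space into two factors. It makes Fubini's
  theorem available for them.\<close>

lemma lborel_join:
  "(lborel :: (real^('d::finite+'d)) measure) = distr (lborel \<Otimes>\<^sub>M lborel) borel (\<lambda>(x, y). join x y)"
proof (rule lborel_eqI)
  fix l u :: "real^('d+'d)"
  assume le: "\<And>b. b \<in> Basis \<Longrightarrow> l \<bullet> b \<le> u \<bullet> b"
  have le': "l $ i \<le> u $ i" for i
    using le[of "axis i 1"] by (auto simp: Basis_vec_eq inner_axis)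
  have "join x y \<in> box l u \<longleftrightarrow> x \<in> box (fst_part l) (fst_part u) \<and> y \<in> box (snd_part l) (snd_part u)" for x y
    by (auto simp: mem_box_cart part_nth split_sum_all)
  then have eq: "(\<lambda>(x, y). join x y) -` box l u \<inter> space (lborel \<Otimes>\<^sub>M lborel) =
      box (fst_part l) (fst_part u) \<times> box (snd_part l) (snd_part u)"
    by (auto simp: space_pair_measure)
  have "emeasure (distr (lborel \<Otimes>\<^sub>M lborel) borel (\<lambda>(x, y). join x y)) (box l u) =
      emeasure (lborel \<Otimes>\<^sub>M lborel) (box (fst_part l) (fst_part u) \<times> box (snd_part l) (snd_part u))"
    by (subst emeasure_distr) (auto simp: eq)
  also have "\<dots> = emeasure lborel (box (fst_part l) (fst_part u)) * emeasure lborel (box (snd_part l) (snd_part u))"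
    by (rule lborel.emeasure_pair_measure_Times) auto
  also have "\<dots> = ennreal (\<Prod>i\<in>UNIV. u $ Inl i - l $ Inl i) * ennreal (\<Prod>i\<in>UNIV. u $ Inr i - l $ Inr i)"
    using le' by (simp add: emeasure_lborel_box_vec part_nth)
  also have "\<dots> = ennreal (\<Prod>b\<in>Basis. (u - l) \<bullet> b)"
    by (simp add: prod_Basis_vec inner_axis prod_UNIV_sum ennreal_mult prod_nonneg le')
  finally show "emeasure (distr (lborel \<Otimes>\<^sub>M lborel) borel (\<lambda>(x, y). join x y)) (box l u) =
      ennreal (\<Prod>b\<in>Basis. (u - l) \<bullet> b)" .
qed simp

lemma integral_join:
  fixes g :: "real^('d::finite+'d) \<Rightarrow> complex"
  assumes g: "integrable lborel g"
  shows "(\<integral>z. g z \<partial>lborel) = (\<integral>x. (\<integral>y. g (join x y) \<partial>lborel) \<partial>lborel)"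
proof -
  have [measurable]: "g \<in> borel_measurable borel" using borel_measurable_integrable[OF g] by simp
  have "integrable (lborel \<Otimes>\<^sub>M lborel) (\<lambda>p. g ((\<lambda>(x, y). join x y) p))"
    using g unfolding lborel_join by (subst (asm) integrable_distr_eq) auto
  then have i: "integrable (lborel \<Otimes>\<^sub>M lborel) (\<lambda>(x, y). g (join x y))"
    by (simp add: case_prod_unfold)
  have "(\<integral>z. g z \<partial>lborel) = (\<integral>p. g ((\<lambda>(x, y). join x y) p) \<partial>(lborel \<Otimes>\<^sub>M lborel))"
    unfolding lborel_join by (subst integral_distr) auto
  also have "\<dots> = (\<integral>x. (\<integral>y. g (join x y) \<partial>lborel) \<partial>lborel)"
    using lborel_pair.integral_fst[OF i] by (simp add: case_prod_unfold)
  finally show ?thesis .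
qed

text \<open>The weight splits: \<open>1 + norm z \<le> (1 + norm x) * (1 + norm w)\<close> for \<open>z = join x w\<close>.\<close>

lemma schwartz_tensor:
  assumes f: "f \<in> schwartz_functions" and g: "g \<in> schwartz_functions"
  shows "(\<lambda>z :: real^('d::finite+'d). g (fst_part z) * f (snd_part z)) \<in> schwartz_functions"
proof -
  let ?T = "\<lambda>g f (z :: real^('d+'d)). g (fst_part z) * (f (snd_part z) :: complex)"
  let ?G = "{?T g f |g f. g \<in> schwartz_functions \<and> f \<in> schwartz_functions}"
  have mem: "?T g f \<in> ?G" if "g \<in> schwartz_functions" "f \<in> schwartz_functions" for f g
    using that by blast
  show ?thesis
  proof (rule schwartz_coinduct[where G = ?G])
    fix h :: "real^('d+'d) \<Rightarrow> complex" and k x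
    assume "h \<in> ?G"
    then obtain f g where h: "h = ?T g f" and fg: "f \<in> schwartz_functions" "g \<in> schwartz_functions"
      by auto
    have Dg: "((\<lambda>z. g (fst_part z + 0)) has_derivative
        (\<lambda>v. \<Sum>i\<in>UNIV. fst_part v $ i *\<^sub>R partial_deriv i g (fst_part x + 0))) (at x)" for x
      by (intro has_derivative_compose_affine linear_fst_part schwartz_differentiable fg)
    have Df: "((\<lambda>z. f (snd_part z + 0)) has_derivative
        (\<lambda>v. \<Sum>i\<in>UNIV. snd_part v $ i *\<^sub>R partial_deriv i f (snd_part x + 0))) (at x)" for x
      by (intro has_derivative_compose_affine linear_snd_part schwartz_differentiable fg)
    have D: "(h has_derivative (\<lambda>v. g (fst_part x) * (\<Sum>i\<in>UNIV. v $ Inr i *\<^sub>R partial_deriv i f (snd_part x)) +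
        (\<Sum>i\<in>UNIV. v $ Inl i *\<^sub>R partial_deriv i g (fst_part x)) * f (snd_part x))) (at x)" for x
      unfolding h using has_derivative_mult[OF Dg[of x] Df[of x]] by (simp add: part_nth)
    then show "h differentiable (at x)" unfolding differentiable_def by blast
    have ax: "axis (Inl j) (1::real) $ Inl i = axis j 1 $ i" "axis (Inr j) (1::real) $ Inr i = axis j 1 $ i"
      "axis (Inl j) (1::real) $ Inr i = 0" "axis (Inr j) (1::real) $ Inl i = 0" for i j :: 'd
      by (auto simp: axis_def)
    show "partial_deriv k h \<in> complex_span ?G"
    proof (cases k)
      case (Inl j)
      have "partial_deriv k h = ?T (partial_deriv j g) f"
        using partial_deriv_eqI[OF D, of k] by (auto simp: Inl ax sum_axis_scaleR)
      moreover have "?T (partial_deriv j g) f \<in> ?G" by (rule mem) (intro schwartz_partial_deriv fg)+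
      ultimately show ?thesis by (simp only:) (rule complex_span.base)
    next
      case (Inr j)
      have "partial_deriv k h = ?T g (partial_deriv j f)"
        using partial_deriv_eqI[OF D, of k] by (auto simp: Inr ax sum_axis_scaleR)
      moreover have "?T g (partial_deriv j f) \<in> ?G" by (rule mem) (intro schwartz_partial_deriv fg)+
      ultimately show ?thesis by (simp only:) (rule complex_span.base)
    qed
    show "rapidly_decreasing h"
      unfolding rapidly_decreasing_def
    proof
      fix m
      obtain A B where A: "\<And>x. (1 + norm x) ^ m * norm (g x) \<le> A" and B: "\<And>x. (1 + norm x) ^ m * norm (f x) \<le> B"
        using schwartz_rapid[OF fg(1)] schwartz_rapid[OF fg(2)] unfolding rapidly_decreasing_def by metis
      have "A \<ge> 0" using A[of 0] norm_ge_zero order_trans by (metis mult_1 norm_zero power_one add.right_neutral)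
      have "(1 + norm z) ^ m * norm (h z) \<le> A * B" for z
      proof -
        have "norm z \<le> norm (fst_part z) + norm (snd_part z)"
        proof (rule power2_le_imp_le)
          have "(norm z)\<^sup>2 = (norm (fst_part z))\<^sup>2 + (norm (snd_part z))\<^sup>2"
            using norm_join_sq[of "fst_part z" "snd_part z"] by simp
          then show "(norm z)\<^sup>2 \<le> (norm (fst_part z) + norm (snd_part z))\<^sup>2"
            by (simp add: power2_sum)
        qed simp
        moreover have "0 \<le> norm (fst_part z) * norm (snd_part z)" by simp
        ultimately have "1 + norm z \<le> (1 + norm (fst_part z)) * (1 + norm (snd_part z))"
          unfolding distrib_left distrib_right by linarith
        then have "(1 + norm z) ^ m \<le> ((1 + norm (fst_part z)) * (1 + norm (snd_part z))) ^ m"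
          by (intro power_mono) auto
        then have "(1 + norm z) ^ m * norm (h z) \<le> ((1 + norm (fst_part z)) * (1 + norm (snd_part z))) ^ m * norm (h z)"
          by (intro mult_right_mono) auto
        also have "\<dots> = ((1 + norm (fst_part z)) ^ m * norm (g (fst_part z))) * ((1 + norm (snd_part z)) ^ m * norm (f (snd_part z)))"
          by (simp add: h norm_mult power_mult_distrib mult_ac)
        also have "\<dots> \<le> A * B" by (intro mult_mono A B \<open>A \<ge> 0\<close>) auto
        finally show ?thesis .
      qed
      then show "\<exists>B. \<forall>x. (1 + norm x) ^ m * norm (h x) \<le> B" by blast
    qed
  qed (rule complex_span.base, rule mem, fact+)
qed

subsection \<open>Slices\<close>

lemma linear_join_snd: "linear (join (0 :: real^'d::finite))"
  by (auto intro!: linearI simp: vec_sum_eq_iff)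

lemma schwartz_slice:
  assumes "\<Psi> \<in> schwartz_functions"
  shows "(\<lambda>w. \<Psi> (join x w)) \<in> schwartz_functions"
proof -
  have "(\<lambda>w. \<Psi> (join 0 w + join x 0)) \<in> schwartz_functions"
  proof (rule schwartz_compose_affine[OF assms linear_join_snd, where c = 1])
    show "1 + norm w \<le> 1 * (1 + norm (join 0 w + join x 0))" for w
      using norm_join_ge(2)[of w x] by (simp flip: join_add)
  qed simp
  then show ?thesis by (simp flip: join_add)
qed

lemma partial_deriv_slice:
  assumes "\<Psi> \<in> schwartz_functions"
  shows "partial_deriv i (\<lambda>w. \<Psi> (join x w)) = (\<lambda>w. partial_deriv (Inr i) \<Psi> (join x w))"
proof
  fix w :: "real^'a"
  have "partial_deriv i (\<lambda>w. \<Psi> (join 0 w + join x 0)) w =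
     (\<Sum>j\<in>UNIV. join 0 (axis i 1) $ j *\<^sub>R partial_deriv j \<Psi> (join 0 w + join x 0))"
    by (rule partial_deriv_compose_affine[OF linear_join_snd schwartz_differentiable[OF assms]])
  also have "\<dots> = partial_deriv (Inr i) \<Psi> (join 0 w + join x 0)"
    by (simp add: sum_UNIV_sum sum_axis_scaleR)
  finally show "partial_deriv i (\<lambda>w. \<Psi> (join x w)) w = partial_deriv (Inr i) \<Psi> (join x w)"
    by (simp flip: join_add)
qed

lemma schwartz_slice_decay:
  fixes \<Psi> :: "real^('d::finite+'d) \<Rightarrow> complex"
  assumes "\<Psi> \<in> schwartz_functions"
  obtains B where "B > 0" "\<And>x w. norm (\<Psi> (join x w)) \<le> B * decay w"
proof -
  obtain B where B: "\<And>z. (1 + norm z) ^ (2 * CARD('d)) * norm (\<Psi> z) \<le> B"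
    using schwartz_rapid[OF assms] unfolding rapidly_decreasing_def by blast
  have "norm (\<Psi> (join x w)) \<le> (\<bar>B\<bar> + 1) * decay w" for x w
  proof (rule rapidly_decreasing_le_decay[of w "\<lambda>w. \<Psi> (join x w)"])
    have "(1 + norm w) ^ (2 * CARD('d)) * norm (\<Psi> (join x w)) \<le> (1 + norm (join x w)) ^ (2 * CARD('d)) * norm (\<Psi> (join x w))"
      using norm_join_ge(2)[of w x] by (intro mult_right_mono power_mono) auto
    also have "\<dots> \<le> \<bar>B\<bar> + 1" using B[of "join x w"] by linarith
    finally show "(1 + norm w) ^ (2 * CARD('d)) * norm (\<Psi> (join x w)) \<le> \<bar>B\<bar> + 1" .
  qed
  then show ?thesis by (rule that[rotated]) simp
qed

lemma inv_fourier_snd_eq: "inv_fourier_snd \<Psi> z = inv_fourier (\<lambda>w. \<Psi> (join (fst_part z) w)) (snd_part z)"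
  by (simp add: inv_fourier_snd_def inv_fourier_def character_def inner_commute mult.commute)

text \<open>Along the first factor the derivative passes to \<open>\<Psi>\<close>; along the second it acts on the character and brings
  down the frequency. Either way it is the transform of a Schwartz function.\<close>

lemma has_derivative_inv_fourier_snd:
  fixes \<Psi> :: "real^('d::finite+'d) \<Rightarrow> complex"
  assumes \<Psi>: "\<Psi> \<in> schwartz_functions"
  defines "D \<equiv> (\<lambda>k. case k of Inl i \<Rightarrow> partial_deriv (Inl i) \<Psi>
      | Inr i \<Rightarrow> (\<lambda>z. (2 * pi * \<i>) * (z $ Inr i *\<^sub>R \<Psi> z)))"
  shows "(inv_fourier_snd \<Psi> has_derivative (\<lambda>h. \<Sum>k\<in>UNIV. h $ k *\<^sub>R inv_fourier_snd (D k) z)) (at z)"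
proof -
  have D: "D k \<in> schwartz_functions" for k
    unfolding D_def using \<Psi>
    by (cases k) (auto intro: schwartz_partial_deriv schwartz_cmult schwartz_coordinate_mult)
  have "\<exists>B>0. \<forall>x w. norm (D k (join x w)) \<le> B * decay w" for k
    using schwartz_slice_decay[OF D[of k]] by metis
  then obtain B where B: "\<And>k. B k > 0" "\<And>k x w. norm (D k (join x w)) \<le> B k * decay w"
    by metis
  have iD: "integrable lborel (\<lambda>w. character (snd_part z) w * D k (join (fst_part z) w))" for k z
    by (intro integrable_character_mult schwartz_integrable schwartz_slice D)
  have "((\<lambda>z. \<integral>w. character (snd_part z) w * \<Psi> (join (fst_part z) w) \<partial>lborel) has_derivative
    (\<lambda>h. \<integral>w. (\<Sum>k\<in>UNIV. h $ k *\<^sub>R (character (snd_part z) w * D k (join (fst_part z) w))) \<partial>lborel)) (at z)"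
  proof (rule has_derivative_integral[where b = "\<lambda>w. (\<Sum>k\<in>UNIV. B k) * decay w"])
    fix z :: "real^('d+'d)" and w
    have 1: "((\<lambda>z. \<Psi> (join (fst_part z) 0 + join 0 w)) has_derivative
        (\<lambda>h. \<Sum>j\<in>UNIV. join (fst_part h) 0 $ j *\<^sub>R partial_deriv j \<Psi> (join (fst_part z) 0 + join 0 w))) (at z)"
      by (intro has_derivative_compose_affine[where M = "\<lambda>z. join (fst_part z) 0"] schwartz_differentiable \<Psi>
          linear_join linear_fst_part linear_zero)
    have 2: "((\<lambda>z. character w (snd_part z)) has_derivative
        (\<lambda>h. (2 * pi * (w \<bullet> snd_part h)) *\<^sub>R (\<i> * character w (snd_part z)))) (at z)"
      by (rule has_derivative_compose[OF linear_imp_has_derivative[OF linear_snd_part] character_has_derivative])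
    have "character (snd_part z) w * (\<Sum>j\<in>UNIV. join (fst_part h) 0 $ j *\<^sub>R partial_deriv j \<Psi> (join (fst_part z) w)) +
        ((2 * pi * (w \<bullet> snd_part h)) *\<^sub>R (\<i> * character (snd_part z) w)) * \<Psi> (join (fst_part z) w) =
        (\<Sum>k\<in>UNIV. h $ k *\<^sub>R (character (snd_part z) w * D k (join (fst_part z) w)))" for h
      by (simp add: sum_UNIV_sum part_nth D_def inner_vec_def sum_distrib_left sum_distrib_right
          scaleR_conv_of_real of_real_sum mult_ac)
    then show "((\<lambda>z. character (snd_part z) w * \<Psi> (join (fst_part z) w)) has_derivative
        (\<lambda>h. \<Sum>k\<in>UNIV. h $ k *\<^sub>R (character (snd_part z) w * D k (join (fst_part z) w)))) (at z)"
      using has_derivative_mult[OF 2 1] by (simp add: character_commute[of w] flip: join_add)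
  next
    show "integrable lborel (\<lambda>w. character (snd_part z) w * \<Psi> (join (fst_part z) w))" for z
      by (intro integrable_character_mult schwartz_integrable schwartz_slice \<Psi>)
    show "integrable lborel (\<lambda>w. \<Sum>k\<in>UNIV. h $ k *\<^sub>R (character (snd_part z) w * D k (join (fst_part z) w)))" for h
      by (intro Bochner_Integration.integrable_sum integrable_scaleR_right iD)
    show "norm (\<Sum>k\<in>UNIV. h $ k *\<^sub>R (character (snd_part z) w * D k (join (fst_part z) w))) \<le>
        (\<Sum>k\<in>UNIV. B k) * decay w * norm h" for z w and h :: "real^('d+'d)"
    proof -
      have "norm (h $ k *\<^sub>R (character (snd_part z) w * D k (join (fst_part z) w))) \<le> norm h * (B k * decay w)" for k
        using component_le_norm_cart[of h k] B(2)[of k "fst_part z" w] by (simp add: norm_mult mult_mono)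
      then have "norm (\<Sum>k\<in>UNIV. h $ k *\<^sub>R (character (snd_part z) w * D k (join (fst_part z) w))) \<le>
          (\<Sum>k\<in>UNIV. norm h * (B k * decay w))"
        by (intro sum_norm_le)
      also have "\<dots> = (\<Sum>k\<in>UNIV. B k) * decay w * norm h"
        by (simp add: sum_distrib_left sum_distrib_right mult_ac)
      finally show ?thesis .
    qed
  qed (intro integrable_mult_right integrable_decay)
  moreover have "(\<integral>w. (\<Sum>k\<in>UNIV. h $ k *\<^sub>R (character (snd_part z) w * D k (join (fst_part z) w))) \<partial>lborel) =
      (\<Sum>k\<in>UNIV. h $ k *\<^sub>R inv_fourier_snd (D k) z)" for h
    by (subst Bochner_Integration.integral_sum) (simp_all add: inv_fourier_snd_eq inv_fourier_def iD)
  ultimately show ?thesis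
    by (simp add: inv_fourier_snd_eq[abs_def] inv_fourier_def)
qed

text \<open>Integration by parts: the derivative of the product \<open>character y w * h w\<close> has integral zero.\<close>

lemma inv_fourier_partial_deriv:
  assumes h: "h \<in> schwartz_functions"
  shows "inv_fourier (partial_deriv i h) y = - (2 * pi * \<i>) * (y $ i *\<^sub>R inv_fourier h y)"
proof -
  have "0 = (\<integral>w. partial_deriv i (\<lambda>w. character y w * h w) w \<partial>lborel)"
    using integral_partial_deriv[OF schwartz_character_mult[OF h]] by simp
  also have "\<dots> = (\<integral>w. (2 * pi * \<i> * (y $ i)) * (character y w * h w) + character y w * partial_deriv i h w \<partial>lborel)"
    by (simp add: partial_deriv_mult partial_deriv_character smooth_differentiable[OF smooth_character]
        schwartz_differentiable[OF h] mult_ac add.commute)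
  also have "\<dots> = (2 * pi * \<i> * (y $ i)) * inv_fourier h y + inv_fourier (partial_deriv i h) y"
    using integrable_character_mult[OF schwartz_integrable[OF h]]
      integrable_character_mult[OF schwartz_integrable[OF schwartz_partial_deriv[OF h]]]
    by (simp add: inv_fourier_def)
  finally show ?thesis
    by (simp add: scaleR_conv_of_real add_eq_0_iff mult_ac)
qed

text \<open>The class of all partial inverse Fourier transforms is closed under partial derivatives and
  under multiplication by coordinates, and consists of bounded functions.\<close>

lemma schwartz_inv_fourier_snd:
  fixes \<Psi> :: "real^('d::finite+'d) \<Rightarrow> complex"
  assumes "\<Psi> \<in> schwartz_functions"
  shows "inv_fourier_snd \<Psi> \<in> schwartz_functions"
proof (rule schwartz_coinduct_bounded[where G = "inv_fourier_snd ` schwartz_functions"])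
  fix g :: "real^('d+'d) \<Rightarrow> complex" and k x
  assume "g \<in> inv_fourier_snd ` schwartz_functions"
  then obtain \<Psi> where g: "g = inv_fourier_snd \<Psi>" and \<Psi>: "\<Psi> \<in> schwartz_functions" by auto
  define D where "D = (\<lambda>k. case k of Inl i \<Rightarrow> partial_deriv (Inl i) \<Psi>
      | Inr i \<Rightarrow> (\<lambda>z. (2 * pi * \<i>) * (z $ Inr i *\<^sub>R \<Psi> z)))"
  have der: "(g has_derivative (\<lambda>h. \<Sum>k\<in>UNIV. h $ k *\<^sub>R inv_fourier_snd (D k) z)) (at z)" for z
    unfolding g D_def by (rule has_derivative_inv_fourier_snd[OF \<Psi>])
  then show "g differentiable (at x)" unfolding differentiable_def by blast
  have D: "D k \<in> schwartz_functions"
    unfolding D_def using \<Psi>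
    by (cases k) (auto intro: schwartz_partial_deriv schwartz_cmult schwartz_coordinate_mult)
  have "(\<Sum>j\<in>UNIV. axis k 1 $ j *\<^sub>R inv_fourier_snd (D j) z) = inv_fourier_snd (D k) z" for z
    by (rule sum_axis_scaleR)
  then have "partial_deriv k g = inv_fourier_snd (D k)"
    using partial_deriv_eqI[OF der] by auto
  then show "partial_deriv k g \<in> complex_span (inv_fourier_snd ` schwartz_functions)"
    using D by (simp add: complex_span.base)
  show "(\<lambda>z. z $ k *\<^sub>R g z) \<in> complex_span (inv_fourier_snd ` schwartz_functions)"
  proof (cases k)
    case (Inl i)
    have "(\<lambda>z. z $ k *\<^sub>R g z) = inv_fourier_snd (\<lambda>z. z $ k *\<^sub>R \<Psi> z)"
      by (rule ext) (simp add: g Inl inv_fourier_snd_def part_nth)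
    then show ?thesis
      using schwartz_coordinate_mult[OF \<Psi>] by (simp add: complex_span.base)
  next
    case (Inr i)
    have "z $ k *\<^sub>R g z = (\<i> / (2 * pi)) * inv_fourier_snd (partial_deriv k \<Psi>) z" for z
    proof -
      have "inv_fourier_snd (partial_deriv k \<Psi>) z = - (2 * pi * \<i>) * (snd_part z $ i *\<^sub>R g z)"
        using inv_fourier_partial_deriv[OF schwartz_slice[OF \<Psi>], of i "fst_part z" "snd_part z"]
        by (simp add: g Inr inv_fourier_snd_eq partial_deriv_slice[OF \<Psi>])
      then show ?thesis by (simp add: Inr part_nth scaleR_conv_of_real)
    qed
    then have "(\<lambda>z. z $ k *\<^sub>R g z) = (\<lambda>z. (\<i> / (2 * pi)) * inv_fourier_snd (partial_deriv k \<Psi>) z)" by blast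
    then show ?thesis
      using schwartz_partial_deriv[OF \<Psi>, of k] by (simp only:) (intro complex_span.scale complex_span.base imageI)
  qed
  obtain B where B: "\<And>x w. norm (\<Psi> (join x w)) \<le> B * decay w"
    using schwartz_slice_decay[OF \<Psi>] by metis
  have "norm (g z) \<le> (\<integral>w. B * decay w \<partial>(lborel :: (real^'d) measure))" for z
    unfolding g inv_fourier_snd_eq inv_fourier_def
    by (rule norm_integral_le)
       (use B integrable_character_mult[OF schwartz_integrable[OF schwartz_slice[OF \<Psi>]]]
         in \<open>auto intro!: integrable_mult_right integrable_decay simp: norm_mult\<close>)
  then show "\<exists>B. \<forall>x. norm (g x) \<le> B" by blast
qed (use assms in \<open>auto intro: complex_span.base\<close>)

text \<open>In the second variable, pairing with the character undoes the partial transform.\<close>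

lemma integral_character_inv_fourier_snd:
  assumes \<Psi>: "\<Psi> \<in> schwartz_functions"
  shows "(\<integral>z. character (join a b) z * inv_fourier_snd \<Psi> z \<partial>lborel) = (\<integral>u. character a u * \<Psi> (join u (- b)) \<partial>lborel)"
proof -
  have "(\<integral>z. character (join a b) z * inv_fourier_snd \<Psi> z \<partial>lborel) =
      (\<integral>u. (\<integral>w. character (join a b) (join u w) * inv_fourier_snd \<Psi> (join u w) \<partial>lborel) \<partial>lborel)"
    by (intro integral_join integrable_character_mult schwartz_integrable schwartz_inv_fourier_snd \<Psi>)
  also have "\<dots> = (\<integral>u. character a u * (\<integral>w. character b w * inv_fourier (\<lambda>w. \<Psi> (join u w)) w \<partial>lborel) \<partial>lborel)"
    by (simp add: character_join inv_fourier_snd_eq mult.assoc)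
  also have "\<dots> = (\<integral>u. character a u * \<Psi> (join u (- b)) \<partial>lborel)"
  proof -
    have "(\<integral>w. character b w * inv_fourier (\<lambda>w. \<Psi> (join u w)) w \<partial>lborel) = \<Psi> (join u (- b))" for u
    proof -
      have s: "(\<lambda>w. \<Psi> (join u w)) \<in> schwartz_functions" by (rule schwartz_slice[OF \<Psi>])
      obtain B where "\<And>w. norm (\<Psi> (join u w)) \<le> B" using schwartz_bounded[OF s] by metis
      moreover have "integrable lborel (inv_fourier (\<lambda>w. \<Psi> (join u w)))"
        using schwartz_integrable[OF schwartz_slice[OF schwartz_inv_fourier_snd[OF \<Psi>], of u]]
        by (simp add: inv_fourier_snd_eq)
      ultimately show ?thesis
        using smooth_continuous[OF schwartz_smooth[OF s]] schwartz_integrable[OF s]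
        by (intro fourier_inversion[where h = "\<lambda>w. \<Psi> (join u w)"])
    qed
    then show ?thesis by simp
  qed
  finally show ?thesis .
qed

section \<open>Quantization of characters\<close>

text \<open>The substitution that relates the symbol to the Schwartz kernel of the operator.\<close>

definition kernel_map :: "real \<Rightarrow> real^('d::finite+'d) \<Rightarrow> real^('d+'d)" where
  "kernel_map \<tau> z = join ((1 - \<tau>) *\<^sub>R fst_part z + \<tau> *\<^sub>R snd_part z) (fst_part z - snd_part z)"

definition kernel_map_inv :: "real \<Rightarrow> real^('d::finite+'d) \<Rightarrow> real^('d+'d)" where
  "kernel_map_inv \<tau> z = join (fst_part z + \<tau> *\<^sub>R snd_part z) (fst_part z - (1 - \<tau>) *\<^sub>R snd_part z)"

lemma linear_kernel_map: "linear (kernel_map \<tau>)"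
  by (rule linearI) (auto simp: kernel_map_def vec_sum_eq_iff part_nth algebra_simps)

lemma linear_kernel_map_inv: "linear (kernel_map_inv \<tau>)"
  by (rule linearI) (auto simp: kernel_map_inv_def vec_sum_eq_iff part_nth algebra_simps)

lemma kernel_map_inverse: "kernel_map \<tau> (kernel_map_inv \<tau> z) = z" "kernel_map_inv \<tau> (kernel_map \<tau> z) = z"
  by (auto simp: kernel_map_def kernel_map_inv_def vec_sum_eq_iff part_nth algebra_simps)

lemma matrix_inv_inverse:
  fixes A :: "real^'n^'m"
  assumes "invertible A"
  shows "A ** matrix_inv A = mat 1" "matrix_inv A ** A = mat 1"
  using assms someI_ex[of "\<lambda>A'. A ** A' = mat 1 \<and> A' ** A = mat 1"]
  unfolding invertible_def matrix_inv_def by auto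

lemma matrix_inv_kernel_matrix: "matrix_inv (kernel_matrix \<tau>) *v z = kernel_map_inv \<tau> z"
proof -
  have K: "kernel_matrix \<tau> = matrix (kernel_map \<tau>)"
    by (simp add: kernel_matrix_def kernel_map_def[abs_def])
  have Kv: "kernel_matrix \<tau> *v z = kernel_map \<tau> z" for z :: "real^('a+'a)"
    unfolding K by (rule matrix_works) (simp add: linear_kernel_map linear_matrix_vector_mul_eq)
  have "kernel_matrix \<tau> ** matrix (kernel_map_inv \<tau>) = (mat 1 :: real^('a+'a)^('a+'a))"
    "matrix (kernel_map_inv \<tau>) ** kernel_matrix \<tau> = (mat 1 :: real^('a+'a)^('a+'a))"
    unfolding K matrix_compose[OF linear_kernel_map_inv linear_kernel_map, symmetric]
      matrix_compose[OF linear_kernel_map linear_kernel_map_inv, symmetric]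
    by (simp_all add: o_def kernel_map_inverse matrix_id_mat_1[unfolded id_def])
  then have "invertible (kernel_matrix \<tau> :: real^('a+'a)^('a+'a))"
    unfolding invertible_def by blast
  then have "matrix_inv (kernel_matrix \<tau>) ** kernel_matrix \<tau> = (mat 1 :: real^('a+'a)^('a+'a))"
    by (rule matrix_inv_inverse(2))
  then have "matrix_inv (kernel_matrix \<tau>) *v (kernel_matrix \<tau> *v kernel_map_inv \<tau> z) = kernel_map_inv \<tau> z"
    by (simp add: matrix_vector_mul_assoc)
  then show ?thesis by (simp add: Kv kernel_map_inverse)
qed

definition shear :: "real \<Rightarrow> real^('d::finite+'d) \<Rightarrow> real^('d+'d)" where
  "shear t z = join (fst_part z + t *\<^sub>R snd_part z) (snd_part z)"

text \<open>Shears form a one-parameter group, and conjugation with a dilation of the first factor doubles the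
  parameter. So the determinant is its own square.\<close>

lemma det_shear: "det (matrix (shear t :: real^('d::finite+'d) \<Rightarrow> _)) = 1"
proof -
  let ?S = "\<lambda>t. shear t :: real^('d+'d) \<Rightarrow> real^('d+'d)"
  let ?D = "\<lambda>r (z :: real^('d+'d)). join (r *\<^sub>R fst_part z) (snd_part z)"
  have lin: "linear (?S t)" for t
    by (rule linearI) (auto simp: shear_def vec_sum_eq_iff part_nth algebra_simps)
  have linD: "linear (?D r)" for r
    by (rule linearI) (auto simp: vec_sum_eq_iff part_nth algebra_simps)
  have add: "det (matrix (?S (s + t))) = det (matrix (?S s)) * det (matrix (?S t))" for s t
  proof -
    have "?S (s + t) = ?S s \<circ> ?S t"
      by (auto simp: shear_def vec_sum_eq_iff part_nth algebra_simps)
    then show ?thesis by (simp add: matrix_compose lin det_mul)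
  qed
  have "det (matrix (?D 2)) * det (matrix (?S t)) = det (matrix (?D 2 \<circ> ?S t))"
    by (simp only: matrix_compose[OF lin linD] det_mul)
  also have "?D 2 \<circ> ?S t = ?S (t + t) \<circ> ?D 2"
    by (auto simp: shear_def vec_sum_eq_iff part_nth algebra_simps)
  also have "det (matrix (?S (t + t) \<circ> ?D 2)) = det (matrix (?S (t + t))) * det (matrix (?D 2))"
    by (simp only: matrix_compose[OF linD lin] det_mul)
  finally have "det (matrix (?D 2)) * det (matrix (?S t)) = det (matrix (?S (t + t))) * det (matrix (?D 2))" .
  moreover have "det (matrix (?D 2)) \<noteq> 0"
    using det_nz_iff_inj[OF linD, of 2] by (auto simp: inj_def vec_sum_eq_iff part_nth)
  ultimately have double: "det (matrix (?S (t + t))) = det (matrix (?S t))"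
    by simp
  have "det (matrix (?S t)) = det (matrix (?S t)) * det (matrix (?S t))"
    by (rule trans[OF sym[OF double] add])
  moreover have "det (matrix (?S t)) \<noteq> 0"
  proof -
    have "?S (t + (- t)) = id" by (auto simp: shear_def)
    then have "det (matrix (?S t)) * det (matrix (?S (- t))) = 1"
      using add[of t "- t"] by (simp only: matrix_id_mat_1 det_I)
    then show ?thesis by auto
  qed
  ultimately show ?thesis by simp
qed

text \<open>The substitution is a shear, followed by the swap of the two factors and another shear. The swap is an
  involution, so its determinant is \<open>1\<close> or \<open>- 1\<close>.\<close>

lemma abs_det_kernel_matrix: "\<bar>det (kernel_matrix \<tau> :: real^('d::finite+'d)^('d+'d))\<bar> = 1"
proof -
  let ?P = "\<lambda>z :: real^('d+'d). join (snd_part z) (fst_part z)"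
  have lin: "linear (shear t :: real^('d+'d) \<Rightarrow> _)" for t
    by (rule linearI) (auto simp: shear_def vec_sum_eq_iff part_nth algebra_simps)
  have linP: "linear ?P"
    by (rule linearI) (auto simp: vec_sum_eq_iff part_nth)
  have "?P \<circ> ?P = id" by auto
  then have "det (matrix ?P) * det (matrix ?P) = 1"
    by (simp flip: det_mul matrix_compose[OF linP linP])
  then have P: "\<bar>det (matrix ?P)\<bar> = 1"
    using power2_eq_1_iff[of "det (matrix ?P)"] by (auto simp: power2_eq_square)
  have "kernel_map \<tau> = shear (1 - \<tau>) \<circ> (?P \<circ> shear (- 1))"
    by (auto simp: kernel_map_def shear_def vec_sum_eq_iff part_nth algebra_simps)
  then have "det (matrix (kernel_map \<tau> :: real^('d+'d) \<Rightarrow> _)) = det (matrix ?P)"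
    by (simp add: matrix_compose linear_compose[OF lin linP] lin linP det_mul det_shear del: o_apply)
  then show ?thesis
    using P by (simp add: kernel_matrix_def kernel_map_def[abs_def])
qed

lemma symplectic_J_mult: "symplectic_J *v \<zeta> = join (- snd_part \<zeta>) (fst_part \<zeta>)"
proof -
  have delta: "(if i = j then r else 0) * \<zeta> $ k j = (if j = i then r * \<zeta> $ k i else 0)"
    for i j :: 'a and k :: "'a \<Rightarrow> 'a + 'a" and r :: real
    by simp
  have "(symplectic_J *v \<zeta>) $ Inl i = - \<zeta> $ Inr i" for i
    by (simp add: matrix_vector_mult_def symplectic_J_def sum_UNIV_sum delta)
  moreover have "(symplectic_J *v \<zeta>) $ Inr i = \<zeta> $ Inl i" for i
    using delta[of _ _ 1] by (simp add: matrix_vector_mult_def symplectic_J_def sum_UNIV_sum)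
  ultimately show ?thesis by (simp add: vec_sum_eq_iff part_nth)
qed

lemma tf_shift_eq:
  "tf_shift z u = (\<lambda>g. u (\<lambda>t. character (snd_part z) (t + fst_part z) * g (t + fst_part z)))"
  by (simp add: tf_shift_def dist_modulate_def dist_translate_def character_def)

lemma schwartz_shift_argument:
  assumes "g \<in> schwartz_functions"
  shows "(\<lambda>t. character w (t + a) * g (t + a)) \<in> schwartz_functions"
  using schwartz_translate[OF schwartz_character_mult[OF assms]] .

lemma schwartz_kernel_pullback:
  assumes "f \<in> schwartz_functions" "g \<in> schwartz_functions"
  shows "(\<lambda>z. g (fst_part (kernel_map_inv \<tau> z)) * f (snd_part (kernel_map_inv \<tau> z))) \<in> schwartz_functions"
  by (rule schwartz_compose_invertible[OF schwartz_tensor[OF assms] linear_kernel_map_inv linear_kernel_map])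
     (rule kernel_map_inverse)

lemma Op_eq:
  assumes "f \<in> schwartz_functions" "g \<in> schwartz_functions"
  shows "Op \<tau> p f g = p (inv_fourier_snd (\<lambda>z. g (fst_part (kernel_map_inv \<tau> z)) * f (snd_part (kernel_map_inv \<tau> z))))"
  using assms schwartz_kernel_pullback[OF assms, of \<tau>]
  by (simp add: Op_def op_kernel_def dist_compose_def abs_det_kernel_matrix dist_inv_fourier_snd_def
      matrix_inv_kernel_matrix)

text \<open>A character is quantized to a time frequency shift: the partial inverse Fourier transform of
  \<open>character (join a b)\<close> is concentrated on \<open>y = - b\<close>, by Fourier inversion.\<close>

lemma Op_character:
  assumes f: "f \<in> schwartz_functions" and g: "g \<in> schwartz_functions"
  shows "(\<integral>z. character \<zeta> z * inv_fourier_snd (\<lambda>z. g (fst_part (kernel_map_inv \<tau> z)) * f (snd_part (kernel_map_inv \<tau> z))) z \<partial>lborel) =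
    character (fst_part \<zeta>) (\<tau> *\<^sub>R snd_part \<zeta>) * tf_shift (symplectic_J *v \<zeta>) (dist_of_fun f) g"
proof -
  define a where "a = fst_part \<zeta>"
  define b where "b = snd_part \<zeta>"
  have "\<zeta> = join a b" by (simp add: a_def b_def)
  then have "(\<integral>z. character \<zeta> z * inv_fourier_snd (\<lambda>z. g (fst_part (kernel_map_inv \<tau> z)) * f (snd_part (kernel_map_inv \<tau> z))) z \<partial>lborel) =
      (\<integral>u. character a u * (g (u - \<tau> *\<^sub>R b) * f (u + (1 - \<tau>) *\<^sub>R b)) \<partial>lborel)"
    using integral_character_inv_fourier_snd[OF schwartz_kernel_pullback[OF f g, of \<tau>], of a b]
    by (simp add: kernel_map_inv_def)
  also have "\<dots> = (\<integral>u. character a (u + \<tau> *\<^sub>R b) * (g (u + \<tau> *\<^sub>R b - \<tau> *\<^sub>R b) * f (u + \<tau> *\<^sub>R b + (1 - \<tau>) *\<^sub>R b)) \<partial>lborel)"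
  proof -
    have [measurable]: "f \<in> borel_measurable borel" "g \<in> borel_measurable borel"
      using f g by (simp_all add: schwartz_measurable)
    have "(\<lambda>u. character a u * (g (u - \<tau> *\<^sub>R b) * f (u + (1 - \<tau>) *\<^sub>R b))) \<in> borel_measurable borel"
      by measurable
    from integral_translate[OF this, of "\<tau> *\<^sub>R b"] show ?thesis by simp
  qed
  also have "\<dots> = (\<integral>u. character a (\<tau> *\<^sub>R b) * (f (u + b) * (character a u * g u)) \<partial>lborel)"
    by (simp add: character_add algebra_simps)
  also have "\<dots> = character a (\<tau> *\<^sub>R b) * (\<integral>u. f (u + b) * (character a u * g u) \<partial>lborel)"
    by simp
  also have "(\<integral>u. f (u + b) * (character a u * g u) \<partial>lborel) = (\<integral>t. f t * (character a (t - b) * g (t - b)) \<partial>lborel)"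
  proof -
    have [measurable]: "f \<in> borel_measurable borel" "g \<in> borel_measurable borel"
      using f g by (simp_all add: schwartz_measurable)
    have "(\<lambda>t. f t * (character a (t - b) * g (t - b))) \<in> borel_measurable borel"
      by measurable
    from integral_translate[OF this, of b] show ?thesis by simp
  qed
  also have "\<dots> = tf_shift (symplectic_J *v \<zeta>) (dist_of_fun f) g"
    using schwartz_shift_argument[OF g, of a "- b"]
    by (simp add: tf_shift_eq symplectic_J_mult dist_of_fun_def a_def b_def)
  finally show ?thesis by (simp add: a_def b_def)
qed

section \<open>Fourier series of periodic distributions\<close>

subsection \<open>The unit cube and its translates\<close>

text \<open>Half open, so that the integer translates partition the line; centred at \<open>0\<close>, where the Fejer kernel
  concentrates.\<close>

definition unit_interval :: "real set" where
  "unit_interval = {-1/2..<1/2}"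

definition unit_cube :: "real^'n::finite \<Rightarrow> real" where
  "unit_cube y = (\<Prod>i\<in>UNIV. indicator unit_interval (y $ i))"

definition int_character :: "int^'n::finite \<Rightarrow> real^'n \<Rightarrow> complex" where
  "int_character \<kappa> = character (of_int_vec \<kappa>)"

lemma of_int_vec_add: "of_int_vec (\<kappa> + \<mu>) = of_int_vec \<kappa> + of_int_vec \<mu>"
  by (simp add: of_int_vec_def vec_eq_iff)

lemma of_int_vec_minus: "of_int_vec (- \<kappa>) = - of_int_vec \<kappa>"
  by (simp add: of_int_vec_def vec_eq_iff)

lemma of_int_vec_zero: "of_int_vec 0 = 0"
  by (simp add: of_int_vec_def vec_eq_iff)

lemma int_character_mult: "int_character \<kappa> x * int_character \<mu> x = int_character (\<kappa> + \<mu>) x"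
  by (simp add: int_character_def of_int_vec_add character_add_left)

lemma character_of_int_vec: "character (of_int_vec \<kappa>) (of_int_vec \<mu>) = 1"
proof -
  have "of_int_vec \<kappa> \<bullet> of_int_vec \<mu> = real_of_int (\<Sum>i\<in>UNIV. \<kappa> $ i * \<mu> $ i)"
    by (simp add: inner_vec_def of_int_vec_def)
  then show ?thesis
    unfolding character_def by (simp only:) (rule cis_multiple_2pi, rule Ints_of_int)
qed

lemma int_character_periodic: "int_character \<kappa> (x + of_int_vec \<mu>) = int_character \<kappa> x"
  by (simp add: int_character_def character_add character_of_int_vec)

lemma sum_unit_interval:
  assumes "\<bar>t\<bar> + 1 \<le> real m"
  shows "(\<Sum>k\<in>{-int m..int m}. indicator unit_interval (t - real_of_int k)) = (1::real)"
proof -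
  let ?k = "\<lfloor>t + 1/2\<rfloor>"
  have "t - real_of_int k \<in> unit_interval \<longleftrightarrow> k = ?k" for k
    unfolding unit_interval_def by (auto simp: floor_eq_iff) linarith+
  then have "(\<Sum>k\<in>{-int m..int m}. indicator unit_interval (t - real_of_int k)) =
      (\<Sum>k\<in>{-int m..int m}. if k = ?k then 1 else (0::real))"
    by (intro sum.cong) (auto simp: indicator_def)
  also have "\<dots> = 1"
  proof -
    have "- int m \<le> ?k" "?k \<le> int m" using assms by linarith+
    then show ?thesis by simp
  qed
  finally show ?thesis .
qed

lemma sum_unit_cube:
  assumes "\<And>i. \<bar>y $ i\<bar> + 1 \<le> real m"
  shows "(\<Sum>\<kappa>\<in>int_box m. unit_cube (y - of_int_vec \<kappa>)) = 1"
  unfolding unit_cube_def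
  using sum_int_box_prod[of "\<lambda>i k. indicator unit_interval (y $ i - real_of_int k) :: real" m]
  by (simp add: of_int_vec_def sum_unit_interval[OF assms])

lemma unit_cube_measurable [measurable]: "unit_cube \<in> borel_measurable borel"
proof -
  have "(\<lambda>y::real^'a. indicator unit_interval (y $ i) :: real) \<in> borel_measurable borel" for i
    by (rule measurable_compose[where f = "\<lambda>y::real^'a. y $ i" and N = borel])
       (auto simp: unit_interval_def intro!: borel_measurable_continuous_onI continuous_intros borel_measurable_indicator)
  then show ?thesis unfolding unit_cube_def[abs_def] by (intro borel_measurable_prod)
qed

lemma unit_cube_bounds: "0 \<le> unit_cube y" "unit_cube y \<le> 1"
  unfolding unit_cube_def by (auto intro!: prod_nonneg prod_le_1 simp: indicator_def)

text \<open>The integral is cut along the lattice cubes, and each piece is moved to the cube at the origin.\<close>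

lemma integral_unit_cube_decomposition:
  fixes G :: "real^'n::finite \<Rightarrow> complex"
  assumes G: "integrable lborel G" and supp: "\<And>y. G y \<noteq> 0 \<Longrightarrow> norm y + 1 \<le> real m"
  shows "(\<integral>y. G y \<partial>lborel) = (\<Sum>\<kappa>\<in>int_box m. \<integral>y. unit_cube y * G (y + of_int_vec \<kappa>) \<partial>lborel)"
proof -
  have [measurable]: "G \<in> borel_measurable borel" using borel_measurable_integrable[OF G] by simp
  have i: "integrable lborel (\<lambda>y. unit_cube (y - of_int_vec \<kappa>) * G y)" for \<kappa>
    by (rule Bochner_Integration.integrable_bound[OF G])
       (auto simp: norm_mult abs_of_nonneg unit_cube_bounds intro!: mult_left_le_one_le)
  have e: "G y = (\<Sum>\<kappa>\<in>int_box m. unit_cube (y - of_int_vec \<kappa>) * G y)" for y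
  proof (cases "G y = 0")
    case False
    have "\<bar>y $ i\<bar> + 1 \<le> real m" for i
      using supp[OF False] component_le_norm_cart[of y i] by linarith
    then have "complex_of_real (\<Sum>\<kappa>\<in>int_box m. unit_cube (y - of_int_vec \<kappa>)) = 1"
      by (simp only: sum_unit_cube of_real_1)
    then show ?thesis by (simp flip: sum_distrib_right)
  qed simp
  have "(\<integral>y. G y \<partial>lborel) = (\<integral>y. (\<Sum>\<kappa>\<in>int_box m. unit_cube (y - of_int_vec \<kappa>) * G y) \<partial>lborel)"
    by (rule Bochner_Integration.integral_cong[OF refl e])
  also have "\<dots> = (\<Sum>\<kappa>\<in>int_box m. \<integral>y. unit_cube (y - of_int_vec \<kappa>) * G y \<partial>lborel)"
    by (rule Bochner_Integration.integral_sum) (rule i)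
  also have "\<dots> = (\<Sum>\<kappa>\<in>int_box m. \<integral>y. unit_cube y * G (y + of_int_vec \<kappa>) \<partial>lborel)"
  proof (rule sum.cong[OF refl])
    fix \<kappa> :: "int^'n"
    have "(\<lambda>y. unit_cube (y - of_int_vec \<kappa>) * G y) \<in> borel_measurable borel" by measurable
    from integral_translate[OF this, of "of_int_vec \<kappa>"]
    show "(\<integral>y. unit_cube (y - of_int_vec \<kappa>) * G y \<partial>lborel) = (\<integral>y. unit_cube y * G (y + of_int_vec \<kappa>) \<partial>lborel)"
      by simp
  qed
  finally show ?thesis .
qed

lemma unit_interval_character:
  shows "integrable lborel (\<lambda>t. complex_of_real (indicator unit_interval t) * cis (2 * pi * (real_of_int m * t)))"
    and "(\<integral>t. complex_of_real (indicator unit_interval t) * cis (2 * pi * (real_of_int m * t)) \<partial>lborel) = (if m = 0 then 1 else 0)"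
proof -
  define F where "F t = (if m = 0 then complex_of_real t else cis (2 * pi * (real_of_int m * t)) / (2 * pi * \<i> * m))" for t :: real
  have F: "(F has_vector_derivative cis (2 * pi * (real_of_int m * t))) (at t within S)" for t S
  proof (cases "m = 0")
    case True
    have "((\<lambda>t. complex_of_real t) has_vector_derivative 1) (at t within S)"
      using has_vector_derivative_of_real[OF DERIV_ident] by simp
    then show ?thesis using True by (simp add: F_def[abs_def])
  next
    case False
    have "((\<lambda>t. \<i> * complex_of_real (2 * pi * (real_of_int m * t))) has_vector_derivative \<i> * complex_of_real (2 * pi * (real_of_int m * 1))) (at t within S)"
      by (intro has_vector_derivative_mult_right has_vector_derivative_of_real) (auto intro!: derivative_eq_intros)
    from field_vector_diff_chain_within[OF this DERIV_exp[THEN DERIV_subset], OF subset_UNIV]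
    have "((\<lambda>t. exp (\<i> * complex_of_real (2 * pi * (real_of_int m * t))) / (2 * pi * \<i> * m)) has_vector_derivative
       (\<i> * complex_of_real (2 * pi * (real_of_int m * 1)) * exp (\<i> * complex_of_real (2 * pi * (real_of_int m * t)))) / (2 * pi * \<i> * m)) (at t within S)"
      by (intro has_vector_derivative_divide) (simp add: o_def)
    then show ?thesis using False by (simp add: F_def[abs_def] cis_conv_exp)
  qed
  have c: "continuous_on S (\<lambda>t. cis (2 * pi * (real_of_int m * t)))" for S
    unfolding cis_conv_exp by (intro continuous_intros)
  have hb: "has_bochner_integral lborel (\<lambda>t. indicator {-1/2..1/2} t *\<^sub>R cis (2 * pi * (real_of_int m * t))) (F (1/2) - F (-1/2))"
    by (rule has_bochner_integral_FTC_Icc[OF _ F c]) simp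
  have AE: "AE t in lborel. indicator {-1/2..1/2} t *\<^sub>R cis (2 * pi * (real_of_int m * t)) =
      complex_of_real (indicator unit_interval t) * cis (2 * pi * (real_of_int m * t))"
    using AE_lborel_singleton[of "1/2 :: real"]
    by eventually_elim (auto simp: unit_interval_def indicator_def)
  have meas [measurable]: "(\<lambda>t. cis (2 * pi * (real_of_int m * t))) \<in> borel_measurable borel"
    by (rule borel_measurable_continuous_onI[OF c])
  have [measurable]: "unit_interval \<in> sets borel" by (simp add: unit_interval_def)
  have hb': "has_bochner_integral lborel (\<lambda>t. complex_of_real (indicator unit_interval t) * cis (2 * pi * (real_of_int m * t))) (F (1/2) - F (-1/2))"
    using hb by (subst has_bochner_integral_cong_AE[OF _ _ AE, symmetric]) measurable
  moreover have "F (1/2) - F (-1/2) = (if m = 0 then 1 else 0)"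
  proof (cases "m = 0")
    case False
    have "cis (2 * pi * (real_of_int m * (1/2))) = cis (2 * pi * (real_of_int m * (-1/2))) * cis (2 * pi * real_of_int m)"
      by (simp add: cis_mult algebra_simps)
    also have "cis (2 * pi * real_of_int m) = 1" by (rule cis_multiple_2pi) simp
    finally show ?thesis using False by (simp add: F_def)
  qed (simp add: F_def)
  ultimately show "integrable lborel (\<lambda>t. complex_of_real (indicator unit_interval t) * cis (2 * pi * (real_of_int m * t)))"
    "(\<integral>t. complex_of_real (indicator unit_interval t) * cis (2 * pi * (real_of_int m * t)) \<partial>lborel) = (if m = 0 then 1 else 0)"
    by (auto simp: has_bochner_integral_iff)
qed

lemma integral_unit_cube_character:
  "(\<integral>y. unit_cube y * int_character \<kappa> y \<partial>lborel) = (if \<kappa> = 0 then 1 else 0)"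
proof -
  have "(\<integral>y. unit_cube y * int_character \<kappa> y \<partial>lborel) =
      (\<integral>y. (\<Prod>i\<in>UNIV. complex_of_real (indicator unit_interval (y $ i)) * cis (2 * pi * (real_of_int (\<kappa> $ i) * y $ i))) \<partial>lborel)"
    by (simp add: unit_cube_def int_character_def character_prod of_int_vec_def prod.distrib)
  also have "\<dots> = (\<Prod>i\<in>UNIV. if \<kappa> $ i = 0 then 1 else 0)"
    by (subst integral_prod_vec) (simp_all add: unit_interval_character)
  also have "\<dots> = (if \<kappa> = 0 then 1 else 0)"
    by (auto simp: vec_eq_iff)
  finally show ?thesis .
qed

subsection \<open>Partitions of unity\<close>

lemma periodic_partition_sum:
  fixes x :: "real^'n::finite"
  assumes \<phi>: "periodic_partition \<phi>" and R: "\<And>x. R < norm x \<Longrightarrow> \<phi> x = 0" and m: "norm x + R \<le> real m"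
  shows "(\<Sum>\<kappa>\<in>int_box m. \<phi> (x - of_int_vec \<kappa>)) = 1"
proof -
  have z: "\<phi> (x - of_int_vec \<kappa>) = 0" if \<kappa>: "\<kappa> \<notin> int_box m" for \<kappa>
  proof -
    obtain i where "int m < \<bar>\<kappa> $ i\<bar>" using \<kappa> by (auto simp: int_box_def not_le)
    then have "real m < \<bar>of_int_vec \<kappa> $ i\<bar>" by (simp add: of_int_vec_def)
    also have "\<dots> \<le> norm (of_int_vec \<kappa>)" by (rule component_le_norm_cart)
    also have "\<dots> \<le> norm (x - of_int_vec \<kappa>) + norm x"
      using norm_triangle_ineq4[of x "x - of_int_vec \<kappa>"] by simp
    finally show ?thesis using m by (intro R) linarith
  qed
  have "((\<lambda>\<kappa>. \<phi> (x - of_int_vec \<kappa>)) has_sum (\<Sum>\<kappa>\<in>int_box m. \<phi> (x - of_int_vec \<kappa>))) (int_box m)"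
    by (rule has_sum_finite) simp
  also have "?this \<longleftrightarrow> ((\<lambda>\<kappa>. \<phi> (x - of_int_vec \<kappa>)) has_sum (\<Sum>\<kappa>\<in>int_box m. \<phi> (x - of_int_vec \<kappa>))) UNIV"
    by (rule has_sum_cong_neutral) (auto simp: z)
  finally show ?thesis
    using \<phi> has_sum_unique unfolding periodic_partition_def by blast
qed

lemma sum_int_box_minus: "(\<Sum>\<kappa>\<in>int_box m. f (- \<kappa>)) = (\<Sum>\<kappa>\<in>int_box m. f \<kappa>)"
  by (rule sum.reindex_bij_witness[of _ uminus uminus]) (auto simp: int_box_def)

text \<open>The translates of \<open>\<phi>\<close> add up to \<open>1\<close>, so the integral of a periodic function against \<open>\<phi>\<close> is its integral over
  one period. For characters the latter is the orthogonality relation.\<close>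

lemma integral_partition_character:
  assumes \<phi>: "periodic_partition \<phi>"
  shows "(\<integral>x. \<phi> x * int_character \<kappa> x \<partial>lborel) = (if \<kappa> = 0 then 1 else 0)"
proof -
  have test: "\<phi> \<in> test_functions" using \<phi> by (simp add: periodic_partition_def)
  then obtain R where R: "\<And>x. R < norm x \<Longrightarrow> \<phi> x = 0" by (auto simp: test_function_iff)
  have S: "\<phi> \<in> schwartz_functions" using test test_functions_subset_schwartz by blast
  obtain m :: nat where m: "\<bar>R\<bar> + 1 + CARD('a) \<le> real m" using real_arch_simple by blast
  have i: "integrable lborel (\<lambda>x. \<phi> x * int_character \<kappa> x)"
    using integrable_character_mult[OF schwartz_integrable[OF S]] by (simp add: int_character_def mult.commute)
  have meas [measurable]: "\<phi> \<in> borel_measurable borel" by (rule schwartz_measurable[OF S])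
  have "(\<integral>x. \<phi> x * int_character \<kappa> x \<partial>lborel) =
      (\<Sum>\<mu>\<in>int_box m. \<integral>y. unit_cube y * (\<phi> (y + of_int_vec \<mu>) * int_character \<kappa> (y + of_int_vec \<mu>)) \<partial>lborel)"
  proof (rule integral_unit_cube_decomposition[OF i])
    fix y assume "\<phi> y * int_character \<kappa> y \<noteq> 0"
    then have "norm y \<le> R" using R[of y] by fastforce
    then show "norm y + 1 \<le> real m" using m by linarith
  qed
  also have "\<dots> = (\<integral>y. (\<Sum>\<mu>\<in>int_box m. unit_cube y * (\<phi> (y + of_int_vec \<mu>) * int_character \<kappa> (y + of_int_vec \<mu>))) \<partial>lborel)"
  proof (rule Bochner_Integration.integral_sum[symmetric])
    fix \<mu> :: "int^'a"
    show "integrable lborel (\<lambda>y. unit_cube y * (\<phi> (y + of_int_vec \<mu>) * int_character \<kappa> (y + of_int_vec \<mu>)))"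
    proof (rule Bochner_Integration.integrable_bound)
      show "integrable lborel (\<lambda>y. \<phi> (y + of_int_vec \<mu>))"
        by (rule schwartz_integrable[OF schwartz_translate[OF S]])
      show "AE y in lborel. norm (unit_cube y * (\<phi> (y + of_int_vec \<mu>) * int_character \<kappa> (y + of_int_vec \<mu>))) \<le> norm (\<phi> (y + of_int_vec \<mu>))"
        by (intro AE_I2) (simp add: int_character_def norm_mult unit_cube_bounds mult_left_le_one_le)
    qed (simp add: int_character_def)
  qed
  also have "\<dots> = (\<integral>y. unit_cube y * int_character \<kappa> y \<partial>lborel)"
  proof (rule Bochner_Integration.integral_cong[OF refl])
    fix y :: "real^'a"
    show "(\<Sum>\<mu>\<in>int_box m. unit_cube y * (\<phi> (y + of_int_vec \<mu>) * int_character \<kappa> (y + of_int_vec \<mu>))) =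
        unit_cube y * int_character \<kappa> y"
    proof (cases "unit_cube y = 0")
      case False
      have "\<bar>y $ i\<bar> \<le> 1" for i
      proof -
        have "indicator unit_interval (y $ i) \<noteq> (0::real)"
          using False by (auto simp: unit_cube_def)
        then show ?thesis by (auto simp: unit_interval_def indicator_def split: if_splits)
      qed
      then have "(\<Sum>i\<in>UNIV. \<bar>y $ i\<bar>) \<le> (\<Sum>i\<in>(UNIV::'a set). 1)" by (intro sum_mono)
      then have "norm y \<le> CARD('a)" using norm_le_l1_cart[of y] by simp
      then have "(\<Sum>\<mu>\<in>int_box m. \<phi> (y - of_int_vec \<mu>)) = 1"
        using m by (intro periodic_partition_sum[OF \<phi>, where R = R] R) linarith+
      then have "(\<Sum>\<mu>\<in>int_box m. \<phi> (y + of_int_vec \<mu>)) = 1"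
        using sum_int_box_minus[of "\<lambda>\<mu>. \<phi> (y + of_int_vec \<mu>)" m] by (simp add: of_int_vec_minus)
      then show ?thesis
        by (simp add: int_character_periodic flip: sum_distrib_left sum_distrib_right)
    qed simp
  qed
  also have "\<dots> = (if \<kappa> = 0 then 1 else 0)" by (rule integral_unit_cube_character)
  finally show ?thesis .
qed

subsection \<open>The Fejer kernel\<close>

definition fejer :: "nat \<Rightarrow> real \<Rightarrow> real" where
  "fejer K t = (norm (\<Sum>j<K. cis (2 * pi * (real j * t))))\<^sup>2 / K"

lemma fejer_nonneg: "fejer K t \<ge> 0"
  by (simp add: fejer_def)

lemma fejer_eq_sum:
  "complex_of_real (fejer K t) = complex_of_real (1 / K) * (\<Sum>j<K. \<Sum>l<K. cis (2 * pi * (real_of_int (int j - int l) * t)))"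
proof -
  have "complex_of_real (fejer K t) = complex_of_real (1 / K) *
      ((\<Sum>j<K. cis (2 * pi * (real j * t))) * cnj (\<Sum>l<K. cis (2 * pi * (real l * t))))"
    using complex_norm_square[of "\<Sum>j<K. cis (2 * pi * (real j * t))"]
    by (simp add: fejer_def del: cnj_sum)
  also have "(\<Sum>j<K. cis (2 * pi * (real j * t))) * cnj (\<Sum>l<K. cis (2 * pi * (real l * t))) =
      (\<Sum>j<K. \<Sum>l<K. cis (2 * pi * (real j * t)) * cis (- (2 * pi * (real l * t))))"
    by (simp add: sum_product cis_cnj)
  also have "\<dots> = (\<Sum>j<K. \<Sum>l<K. cis (2 * pi * (real_of_int (int j - int l) * t)))"
    by (simp add: cis_mult algebra_simps)
  finally show ?thesis by simp
qed

lemma continuous_fejer: "continuous_on S (fejer K)"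
  unfolding fejer_def[abs_def] cis_conv_exp by (cases "K = 0") (auto intro!: continuous_intros)

lemma fejer_le: "fejer K t \<le> K"
proof -
  have "norm (\<Sum>j<K. cis (2 * pi * (real j * t))) \<le> (\<Sum>j<K. 1)"
    by (rule sum_norm_le) simp
  then have "(norm (\<Sum>j<K. cis (2 * pi * (real j * t))))\<^sup>2 \<le> (real K)\<^sup>2"
    by (intro power_mono) auto
  then show ?thesis
    by (cases "K = 0") (simp_all add: fejer_def power2_eq_square divide_le_eq)
qed

text \<open>A weak form of Jordan's inequality. Up to \<open>\<pi> / 3\<close> the derivative of the sine is at least \<open>1/2\<close>; from there to
  \<open>\<pi> / 2\<close> the sine itself is at least \<open>1/2\<close>.\<close>

lemma sin_pi_ge:
  assumes "0 \<le> s" "s \<le> 1/2" shows "s \<le> sin (pi * s)"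
proof (cases "s \<le> 1/3")
  case True
  have "sin 0 - 0 / 2 \<le> sin (pi * s) - (pi * s) / 2"
  proof (rule DERIV_nonneg_imp_nondecreasing[of 0 "pi * s" "\<lambda>x. sin x - x / 2"])
    fix x assume x: "0 \<le> x" "x \<le> pi * s"
    have "pi * s \<le> pi * (1/3)" using True by (intro mult_left_mono) auto
    from order_trans[OF x(2) this] have "x \<le> pi / 3" by simp
    then have "cos (pi / 3) \<le> cos x" using x(1) by (intro cos_monotone_0_pi_le) auto
    then have "cos x - 1 / 2 \<ge> 0" by (simp add: cos_60)
    moreover have "((\<lambda>x. sin x - x / 2) has_real_derivative cos x - 1 / 2) (at x)"
      by (auto intro!: derivative_eq_intros)
    ultimately show "\<exists>y. ((\<lambda>x. sin x - x / 2) has_real_derivative y) (at x) \<and> 0 \<le> y" by blast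
  qed (use assms in simp)
  moreover have "2 * s \<le> pi * s" using assms(1) pi_ge_two by (intro mult_right_mono)
  ultimately show ?thesis by simp
next
  case False
  have "pi / 3 \<le> pi * s" "pi * s \<le> pi / 2"
    using mult_left_mono[of "1/3" s pi] mult_left_mono[of s "1/2" pi] False assms by auto
  then have "sin (pi / 3) \<le> sin (pi * s)"
    by (intro sin_monotone_2pi_le) (use pi_gt_zero in linarith)+
  moreover have "1 / 2 \<le> sin (pi / 3)"
    using real_le_rsqrt[of 1 3] by (simp add: sin_60)
  ultimately show ?thesis using assms(2) by linarith
qed

text \<open>The geometric series telescopes: multiplied by \<open>cis (2 \<pi> t) - 1\<close>, whose modulus is
  \<open>2 \<bar>sin (\<pi> t)\<bar> \<ge> 2 \<bar>t\<bar>\<close>, the sum of the characters has modulus at most 2.\<close>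

lemma fejer_moment:
  assumes "\<bar>t\<bar> \<le> 1/2" "K > 0"
  shows "fejer K t * t\<^sup>2 \<le> 1 / K"
proof -
  define z where "z = cis (2 * pi * t)"
  have "cis (2 * pi * (real j * t)) = z ^ j" for j
    by (simp add: z_def Complex.DeMoivre mult_ac)
  then have "(\<Sum>j<K. cis (2 * pi * (real j * t))) = (\<Sum>j<K. z ^ j)" by simp
  then have "(\<Sum>j<K. cis (2 * pi * (real j * t))) * (z - 1) = z ^ K - 1"
    using power_diff_1_eq[of z K] by (simp add: mult.commute)
  moreover have "norm (z ^ K - 1) \<le> 2"
    using norm_triangle_ineq4[of "z ^ K" 1] by (simp add: z_def norm_power)
  ultimately have le: "norm (\<Sum>j<K. cis (2 * pi * (real j * t))) * norm (z - 1) \<le> 2"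
    by (metis norm_mult)
  have "norm (z - 1) = 2 * \<bar>sin (pi * t)\<bar>"
  proof -
    have "(norm (z - 1))\<^sup>2 = (cos (2 * (pi * t)) - 1)\<^sup>2 + (sin (2 * (pi * t)))\<^sup>2"
      by (simp add: cmod_power2 z_def mult.assoc)
    also have "\<dots> = (2 * \<bar>sin (pi * t)\<bar>)\<^sup>2"
    proof -
      have "cos (2 * (pi * t)) = 1 - 2 * (sin (pi * t))\<^sup>2" by (rule cos_double_sin)
      moreover have "(sin (2 * (pi * t)))\<^sup>2 = 4 * (sin (pi * t))\<^sup>2 * (1 - (sin (pi * t))\<^sup>2)"
        by (simp add: sin_double power_mult_distrib cos_squared_eq)
      ultimately show ?thesis by (simp add: power2_eq_square algebra_simps)
    qed
    finally show ?thesis by (rule power2_eq_imp_eq) auto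
  qed
  moreover have "\<bar>t\<bar> \<le> \<bar>sin (pi * t)\<bar>"
    using sin_pi_ge[of t] sin_pi_ge[of "- t"] assms(1) by (cases "t \<ge> 0") auto
  ultimately have "2 * \<bar>t\<bar> \<le> norm (z - 1)" by linarith
  then have "norm (\<Sum>j<K. cis (2 * pi * (real j * t))) * (2 * \<bar>t\<bar>) \<le> 2"
    using le by (meson mult_left_mono norm_ge_zero order_trans)
  then have "(norm (\<Sum>j<K. cis (2 * pi * (real j * t))) * (2 * \<bar>t\<bar>))\<^sup>2 \<le> 2\<^sup>2"
    by (intro power_mono) auto
  then show ?thesis
    using assms(2) by (simp add: fejer_def power_mult_distrib field_simps)
qed

text \<open>Over one period the Fejer kernel is a probability density. Its first absolute moment is small by
  \<open>2 * \<bar>t\<bar> \<le> 1 / sqrt K + sqrt K * t\<^sup>2\<close> and the pointwise bound \<open>fejer_moment\<close>.\<close>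

lemma
  shows integral_fejer: "integrable lborel (\<lambda>t. indicator unit_interval t * fejer K t)"
    and integral_fejer_eq: "K > 0 \<Longrightarrow> (\<integral>t. indicator unit_interval t * fejer K t \<partial>lborel) = 1"
    and integrable_fejer_abs: "integrable lborel (\<lambda>t. indicator unit_interval t * fejer K t * \<bar>t\<bar>)"
    and integral_fejer_abs: "K > 0 \<Longrightarrow> (\<integral>t. indicator unit_interval t * fejer K t * \<bar>t\<bar> \<partial>lborel) \<le> 1 / sqrt K"
proof -
  have [measurable]: "fejer K \<in> borel_measurable borel"
    by (rule borel_measurable_continuous_onI[OF continuous_fejer])
  have [measurable]: "unit_interval \<in> sets borel" by (simp add: unit_interval_def)
  have I: "integrable lborel (indicator unit_interval :: real \<Rightarrow> real)"
    by (simp add: unit_interval_def)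
  have mI: "(\<integral>t. indicator unit_interval t \<partial>lborel) = (1 :: real)"
    by (simp add: unit_interval_def)
  have bd: "\<bar>t\<bar> \<le> 1/2" if "t \<in> unit_interval" for t using that by (auto simp: unit_interval_def)
  show 1: "integrable lborel (\<lambda>t. indicator unit_interval t * fejer K t)"
    by (rule Bochner_Integration.integrable_bound[where f = "\<lambda>t. real K * (indicator unit_interval t :: real)"])
       (use I in \<open>auto simp: abs_of_nonneg[OF fejer_nonneg] fejer_le indicator_times_eq_if(1)
          intro!: AE_I2\<close>)
  show 2: "integrable lborel (\<lambda>t. indicator unit_interval t * fejer K t * \<bar>t\<bar>)"
  proof (rule Bochner_Integration.integrable_bound[OF 1])
    show "AE t in lborel. norm (indicator unit_interval t * fejer K t * \<bar>t\<bar>) \<le> norm (indicator unit_interval t * fejer K t)"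
    proof (rule AE_I2)
      fix t :: real
      show "norm (indicator unit_interval t * fejer K t * \<bar>t\<bar>) \<le> norm (indicator unit_interval t * fejer K t)"
        using bd[of t] fejer_nonneg[of K t]
        by (cases "t \<in> unit_interval") (auto simp: abs_mult intro!: mult_right_le_one_le)
    qed
  qed measurable
  assume K: "K > 0"
  have i: "integrable lborel (\<lambda>t. complex_of_real (indicator unit_interval t) * cis (2 * pi * (real_of_int m * t)))" for m
    by (rule unit_interval_character)
  have "complex_of_real (\<integral>t. indicator unit_interval t * fejer K t \<partial>lborel) =
      (\<integral>t. complex_of_real (indicator unit_interval t * fejer K t) \<partial>lborel)"
    by (simp only: integral_complex_of_real)
  also have "\<dots> = (\<integral>t. complex_of_real (1 / K) * (\<Sum>j<K. \<Sum>l<K. complex_of_real (indicator unit_interval t) * cis (2 * pi * (real_of_int (int j - int l) * t))) \<partial>lborel)"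
    by (simp only: of_real_mult fejer_eq_sum sum_distrib_left mult.left_commute)
  also have "\<dots> = complex_of_real (1 / K) * (\<Sum>j<K. \<Sum>l<K. if int j - int l = 0 then 1 else 0)"
    by (subst integral_mult_right_zero, subst Bochner_Integration.integral_sum,
        intro Bochner_Integration.integrable_sum i, subst Bochner_Integration.integral_sum, rule i)
       (simp only: unit_interval_character)
  also have "\<dots> = 1" using K by (simp cong: if_cong)
  finally show "(\<integral>t. indicator unit_interval t * fejer K t \<partial>lborel) = 1"
    using of_real_eq_1_iff by blast
  note one = this
  have "(\<integral>t. indicator unit_interval t * fejer K t * \<bar>t\<bar> \<partial>lborel) \<le>
      (\<integral>t. (indicator unit_interval t * fejer K t) * (1 / (2 * sqrt K)) + (1 / (2 * sqrt K)) * indicator unit_interval t \<partial>lborel)"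
  proof (rule integral_mono[OF 2])
    show "integrable lborel (\<lambda>t. (indicator unit_interval t * fejer K t) * (1 / (2 * sqrt K)) + (1 / (2 * sqrt K)) * indicator unit_interval t)"
      by (intro Bochner_Integration.integrable_add integrable_mult_left integrable_mult_right 1 I)
    fix t :: real
    show "indicator unit_interval t * fejer K t * \<bar>t\<bar> \<le>
      (indicator unit_interval t * fejer K t) * (1 / (2 * sqrt K)) + (1 / (2 * sqrt K)) * indicator unit_interval t"
    proof (cases "t \<in> unit_interval")
      case True
      have s: "sqrt K > 0" "sqrt K * sqrt K = K" using K by auto
      have "2 * \<bar>t\<bar> \<le> 1 / sqrt K + sqrt K * t\<^sup>2"
      proof -
        have "0 \<le> (1 - sqrt K * \<bar>t\<bar>)\<^sup>2 / sqrt K" using s by simp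
        also have "\<dots> = 1 / sqrt K + sqrt K * t\<^sup>2 - 2 * \<bar>t\<bar>"
          using s by (simp add: power2_eq_square field_simps)
        finally show ?thesis by simp
      qed
      then have "fejer K t * (2 * \<bar>t\<bar>) \<le> fejer K t * (1 / sqrt K + sqrt K * t\<^sup>2)"
        by (intro mult_left_mono fejer_nonneg)
      also have "\<dots> = fejer K t / sqrt K + sqrt K * (fejer K t * t\<^sup>2)" by (simp add: algebra_simps)
      also have "\<dots> \<le> fejer K t / sqrt K + sqrt K * (1 / K)"
        using fejer_moment[OF bd[OF True] K] s by (intro add_left_mono mult_left_mono) auto
      also have "sqrt K * (1 / K) = 1 / sqrt K" using s by (simp add: field_simps)
      finally show ?thesis using True s by (simp add: field_simps)
    qed simp
  qed
  also have "\<dots> = 1 / (2 * sqrt K) + 1 / (2 * sqrt K)"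
    by (subst Bochner_Integration.integral_add) (use 1 I one mI in auto)
  finally show "(\<integral>t. indicator unit_interval t * fejer K t * \<bar>t\<bar> \<partial>lborel) \<le> 1 / sqrt K" by simp
qed

definition fejer_kernel :: "nat \<Rightarrow> real^'n::finite \<Rightarrow> real" where
  "fejer_kernel K y = (\<Prod>i\<in>UNIV. fejer K (y $ i))"

lemma fejer_kernel_nonneg: "fejer_kernel K y \<ge> 0"
  unfolding fejer_kernel_def by (intro prod_nonneg) (simp add: fejer_nonneg)

lemma unit_cube_fejer: "unit_cube y * fejer_kernel K y = (\<Prod>i\<in>UNIV. indicator unit_interval (y $ i) * fejer K (y $ i))"
  by (simp add: unit_cube_def fejer_kernel_def prod.distrib)

lemma integrable_unit_cube_fejer: "integrable lborel (\<lambda>y::real^'n::finite. unit_cube y * fejer_kernel K y)"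
  unfolding unit_cube_fejer by (intro integrable_prod_vec integral_fejer)

lemma integral_unit_cube_fejer: "K > 0 \<Longrightarrow> (\<integral>y. unit_cube y * fejer_kernel K y \<partial>(lborel :: (real^'n::finite) measure)) = 1"
  unfolding unit_cube_fejer by (subst integral_prod_vec) (simp_all add: integral_fejer integral_fejer_eq)

text \<open>For the summand \<open>\<bar>y $ i\<bar>\<close> only the factor \<open>i\<close> of the product integral differs from \<open>1\<close>; it is the one-dimensional first
  moment.\<close>

lemma
  shows integrable_unit_cube_fejer_norm: "integrable lborel (\<lambda>y::real^'n::finite. unit_cube y * fejer_kernel K y * (\<Sum>i\<in>UNIV. \<bar>y $ i\<bar>))"
    and integral_unit_cube_fejer_norm: "K > 0 \<Longrightarrow>
      (\<integral>y. unit_cube y * fejer_kernel K y * (\<Sum>i\<in>UNIV. \<bar>y $ i\<bar>) \<partial>(lborel :: (real^'n::finite) measure)) \<le> CARD('n) / sqrt K"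
proof -
  define f where "f i j t = indicator unit_interval t * fejer K t * (if j = i then \<bar>t\<bar> else 1)" for i j :: 'n and t
  have f: "integrable lborel (f i j)" for i j
    unfolding f_def using integral_fejer[of K] integrable_fejer_abs[of K] by (cases "i = j") simp_all
  have e: "unit_cube y * fejer_kernel K y * \<bar>y $ i\<bar> = (\<Prod>j\<in>UNIV. f i j (y $ j))" for i and y :: "real^'n"
    by (simp add: unit_cube_fejer f_def prod.distrib)
  have s: "unit_cube y * fejer_kernel K y * (\<Sum>i\<in>UNIV. \<bar>y $ i\<bar>) = (\<Sum>i\<in>UNIV. \<Prod>j\<in>UNIV. f i j (y $ j))" for y :: "real^'n"
    by (simp add: sum_distrib_left e)
  show "integrable lborel (\<lambda>y::real^'n. unit_cube y * fejer_kernel K y * (\<Sum>i\<in>UNIV. \<bar>y $ i\<bar>))"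
    unfolding s by (intro Bochner_Integration.integrable_sum integrable_prod_vec f)
  assume K: "K > 0"
  have "(\<integral>y. (\<Prod>j\<in>UNIV. f i j (y $ j)) \<partial>(lborel :: (real^'n) measure)) \<le> 1 / sqrt K" for i
  proof -
    define a where "a = (\<integral>t. indicator unit_interval t * fejer K t * \<bar>t\<bar> \<partial>lborel)"
    have "(\<integral>t. f i j t \<partial>lborel) = (if j = i then a else 1)" for j
      by (simp add: f_def a_def integral_fejer_eq[OF K])
    then have "(\<integral>y. (\<Prod>j\<in>UNIV. f i j (y $ j)) \<partial>(lborel :: (real^'n) measure)) = a"
      by (subst integral_prod_vec[OF f]) simp
    also have "\<dots> \<le> 1 / sqrt K" using integral_fejer_abs[OF K] by (simp add: a_def)
    finally show ?thesis .
  qed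
  then have "(\<Sum>i\<in>UNIV. \<integral>y. (\<Prod>j\<in>UNIV. f i j (y $ j)) \<partial>(lborel :: (real^'n) measure)) \<le> (\<Sum>i\<in>(UNIV::'n set). 1 / sqrt K)"
    by (intro sum_mono)
  then show "(\<integral>y. unit_cube y * fejer_kernel K y * (\<Sum>i\<in>UNIV. \<bar>y $ i\<bar>) \<partial>(lborel :: (real^'n) measure)) \<le> CARD('n) / sqrt K"
    unfolding s by (subst Bochner_Integration.integral_sum) (auto intro: integrable_prod_vec f)
qed

subsection \<open>Trigonometric polynomials\<close>

definition trig_polynomials :: "(real^'n::finite \<Rightarrow> complex) set" where
  "trig_polynomials = complex_span (range int_character)"

lemma trig_polynomial_const: "(\<lambda>x. a) \<in> trig_polynomials"
proof -
  have "(\<lambda>x::real^'a. a * int_character 0 x) \<in> trig_polynomials"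
    unfolding trig_polynomials_def by (intro complex_span.scale complex_span.base rangeI)
  then show ?thesis by (simp add: int_character_def of_int_vec_zero)
qed

lemma trig_polynomial_mult:
  assumes "S \<in> trig_polynomials" "T \<in> trig_polynomials"
  shows "(\<lambda>x. S x * T x) \<in> trig_polynomials"
  using assms(1) unfolding trig_polynomials_def
proof induction
  case (base g)
  then obtain \<kappa> where g: "g = int_character \<kappa>" by auto
  show ?case
    using assms(2) unfolding trig_polynomials_def
  proof induction
    case (base h)
    then obtain \<mu> where "h = int_character \<mu>" by auto
    then show ?case by (simp add: g int_character_mult complex_span.base)
  next
    case (add f h)
    then show ?case using complex_span.add[OF add(3,4)] by (simp add: distrib_left)
  next
    case (scale f a)
    then show ?case using complex_span.scale[OF scale(2), of a] by (simp add: mult_ac)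
  qed (simp add: complex_span.zero)
next
  case (add f g)
  then show ?case using complex_span.add[OF add(3,4)] by (simp add: distrib_right)
next
  case (scale f a)
  then show ?case using complex_span.scale[OF scale(2), of a] by (simp add: mult_ac)
qed (simp add: complex_span.zero)

lemma trig_polynomial_prod:
  "(\<And>i. i \<in> I \<Longrightarrow> T i \<in> trig_polynomials) \<Longrightarrow> (\<lambda>x. \<Prod>i\<in>I. T i x) \<in> trig_polynomials"
  by (induction I rule: infinite_finite_induct) (simp_all add: trig_polynomial_const trig_polynomial_mult)

lemma fejer_kernel_trig: "(\<lambda>y::real^'n::finite. complex_of_real (fejer_kernel K y)) \<in> trig_polynomials"
proof -
  have "(\<lambda>y::real^'n. complex_of_real (fejer K (y $ i))) \<in> trig_polynomials" for i
  proof -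
    have c: "int_character (axis i m) y = cis (2 * pi * (real_of_int m * y $ i))" for m and y :: "real^'n"
    proof -
      have "of_int_vec (axis i m) = (axis i (real_of_int m) :: real^'n)"
        by (simp add: of_int_vec_def axis_def vec_eq_iff)
      then show ?thesis by (simp add: int_character_def character_def inner_axis')
    qed
    have "(\<lambda>y::real^'n. complex_of_real (1 / K) * (\<Sum>j<K. \<Sum>l<K. int_character (axis i (int j - int l)) y)) \<in> trig_polynomials"
      unfolding trig_polynomials_def by (intro complex_span.scale complex_span_sum complex_span.base rangeI)
    then show ?thesis by (simp only: c fejer_eq_sum)
  qed
  then show ?thesis
    using trig_polynomial_prod[of UNIV "\<lambda>i (y::real^'n). complex_of_real (fejer K (y $ i))"]
    by (simp add: fejer_kernel_def)
qed

lemma trig_polynomial_smooth: "T \<in> trig_polynomials \<Longrightarrow> smooth_fun T"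
  unfolding trig_polynomials_def
  by (induction rule: complex_span.induct)
     (auto simp: int_character_def intro: smooth_const smooth_character smooth_add smooth_cmult)

lemma trig_polynomial_periodic: "T \<in> trig_polynomials \<Longrightarrow> T (y + of_int_vec \<mu>) = T y"
  unfolding trig_polynomials_def
  by (induction rule: complex_span.induct) (auto simp: int_character_periodic)

lemma trig_polynomial_bounded: "T \<in> trig_polynomials \<Longrightarrow> \<exists>B. \<forall>y. norm (T y) \<le> B"
  unfolding trig_polynomials_def
proof (induction rule: complex_span.induct)
  case (base g)
  then show ?case by (auto simp: int_character_def intro!: exI[of _ 1])
next
  case (add f g)
  then obtain A B where "\<forall>y. norm (f y) \<le> A" "\<forall>y. norm (g y) \<le> B" by blast
  then have "\<forall>y. norm (f y + g y) \<le> A + B" by (meson add_mono norm_triangle_ineq order_trans)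
  then show ?case by blast
next
  case (scale f a)
  then obtain A where "\<forall>y. norm (f y) \<le> A" by blast
  then have "\<forall>y. norm (a * f y) \<le> norm a * A" by (simp add: norm_mult mult_left_mono)
  then show ?case by blast
qed auto

text \<open>With \<open>f (x + y)\<close> in place of \<open>f (x - y)\<close>. For an even \<open>T\<close>, such as the Fejer kernel, this is the usual
  convolution.\<close>

definition convolve :: "(real^'n::finite \<Rightarrow> complex) \<Rightarrow> (real^'n \<Rightarrow> complex) \<Rightarrow> real^'n \<Rightarrow> complex" where
  "convolve T f x = (\<integral>y. T y * f (x + y) \<partial>lborel)"

lemma integrable_convolve:
  assumes T: "T \<in> trig_polynomials" and f: "f \<in> schwartz_functions"
  shows "integrable lborel (\<lambda>y. T y * f (x + y))"
proof -
  obtain B where B: "\<And>y. norm (T y) \<le> B" using trig_polynomial_bounded[OF T] by blast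
  have [measurable]: "T \<in> borel_measurable borel" using trig_polynomial_smooth[OF T] by (rule smooth_measurable)
  have i: "integrable lborel (\<lambda>y. f (x + y))"
    using schwartz_integrable[OF schwartz_translate[OF f, of x]] by (simp add: add.commute)
  have [measurable]: "(\<lambda>y. f (x + y)) \<in> borel_measurable borel" using borel_measurable_integrable[OF i] by simp
  show ?thesis
  proof (rule Bochner_Integration.integrable_bound[where f = "\<lambda>y. of_real B * f (x + y)"])
    have "B \<ge> 0" using B[of 0] norm_ge_zero order_trans by blast
    then show "AE y in lborel. norm (T y * f (x + y)) \<le> norm (of_real B * f (x + y))"
      using B by (intro AE_I2) (simp add: norm_mult mult_right_mono)
  qed (auto intro: i)
qed

text \<open>For a character, the average is a multiple of the inverse character; by linearity everything
  reduces to this case.\<close>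

lemma convolve_trig:
  fixes f :: "real^'n::finite \<Rightarrow> complex"
  assumes "T \<in> trig_polynomials" "f \<in> schwartz_functions"
  shows "convolve T f \<in> trig_polynomials \<and> partial_deriv i (convolve T f) = convolve T (partial_deriv i f)"
  using assms(1) unfolding trig_polynomials_def
proof (induction rule: complex_span.induct)
  case zero
  have "convolve (\<lambda>y. 0) f = (\<lambda>x. 0)" for f :: "real^'n \<Rightarrow> complex" by (auto simp: convolve_def)
  moreover have "partial_deriv i (\<lambda>x. 0) = (\<lambda>x. 0)" by (auto simp: partial_deriv_def)
  ultimately show ?case by (simp add: complex_span.zero)
next
  case (base g)
  then obtain \<kappa> where g: "g = int_character \<kappa>" by auto
  have c: "convolve g h = (\<lambda>x. inv_fourier h (of_int_vec \<kappa>) * int_character (- \<kappa>) x)"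
    if h: "h \<in> schwartz_functions" for h
  proof
    fix x
    have [measurable]: "h \<in> borel_measurable borel" by (rule schwartz_measurable[OF h])
    have "(\<lambda>y. character (of_int_vec \<kappa>) (y - x) * h y) \<in> borel_measurable borel" by measurable
    from integral_translate[OF this, of x]
    have "convolve g h x = (\<integral>y. character (of_int_vec \<kappa>) (y - x) * h y \<partial>lborel)"
      by (simp add: convolve_def g int_character_def add.commute)
    also have "\<dots> = (\<integral>y. int_character (- \<kappa>) x * (character (of_int_vec \<kappa>) y * h y) \<partial>lborel)"
    proof -
      have "character (of_int_vec \<kappa>) (y - x) = int_character (- \<kappa>) x * character (of_int_vec \<kappa>) y" for y
        by (simp add: int_character_def of_int_vec_minus character_def cis_mult algebra_simps)
      then show ?thesis by (simp add: mult.assoc)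
    qed
    also have "\<dots> = inv_fourier h (of_int_vec \<kappa>) * int_character (- \<kappa>) x"
      by (simp add: inv_fourier_def mult.commute)
    finally show "convolve g h x = inv_fourier h (of_int_vec \<kappa>) * int_character (- \<kappa>) x" .
  qed
  have d: "partial_deriv i (convolve g f) x = convolve g (partial_deriv i f) x" for x
  proof -
    have "partial_deriv i (convolve g f) x =
        inv_fourier f (of_int_vec \<kappa>) * (2 * pi * \<i> * (of_int_vec (- \<kappa>) $ i) * int_character (- \<kappa>) x)"
      unfolding c[OF assms(2)] int_character_def
      by (subst partial_deriv_cmult) (simp_all add: partial_deriv_character smooth_differentiable[OF smooth_character])
    then show ?thesis
      unfolding c[OF schwartz_partial_deriv[OF assms(2)]] inv_fourier_partial_deriv[OF assms(2)]
      by (simp add: of_int_vec_minus scaleR_conv_of_real)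
  qed
  have "convolve g f \<in> complex_span (range int_character)"
    unfolding c[OF assms(2)] by (intro complex_span.scale complex_span.base rangeI)
  with d show ?case by auto
next
  case (add S T)
  have mem: "S \<in> trig_polynomials" "T \<in> trig_polynomials" using add by (auto simp: trig_polynomials_def)
  have c: "convolve (\<lambda>y. S y + T y) h = (\<lambda>x. convolve S h x + convolve T h x)" if "h \<in> schwartz_functions" for h
    using integrable_convolve[OF mem(1) that] integrable_convolve[OF mem(2) that]
    by (auto simp: convolve_def distrib_right)
  have "smooth_fun (convolve S f)" "smooth_fun (convolve T f)"
    using add by (auto intro: trig_polynomial_smooth simp: trig_polynomials_def)
  then have "partial_deriv i (\<lambda>x. convolve S f x + convolve T f x) = (\<lambda>x. partial_deriv i (convolve S f) x + partial_deriv i (convolve T f) x)"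
    by (auto simp: partial_deriv_add smooth_differentiable)
  then show ?case
    using add by (auto simp: c assms(2) schwartz_partial_deriv intro: complex_span.add)
next
  case (scale T a)
  have c: "convolve (\<lambda>y. a * T y) h = (\<lambda>x. a * convolve T h x)" for h
    by (auto simp: convolve_def mult.assoc)
  have "smooth_fun (convolve T f)"
    using scale by (auto intro: trig_polynomial_smooth simp: trig_polynomials_def)
  then have "partial_deriv i (\<lambda>x. a * convolve T f x) = (\<lambda>x. a * partial_deriv i (convolve T f) x)"
    by (auto simp: partial_deriv_cmult smooth_differentiable)
  then show ?case
    using scale by (auto simp: c intro: complex_span.scale)
qed

lemma convolve_partial_derivs:
  assumes "T \<in> trig_polynomials" "f \<in> schwartz_functions"
  shows "partial_derivs is (convolve T f) = convolve T (partial_derivs is f)"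
proof (induction "is")
  case (Cons i "is")
  then show ?case
    using convolve_trig[OF assms(1) schwartz_partial_derivs[OF assms(2)]]
    by (simp add: partial_derivs_Cons del: partial_derivs.simps)
qed simp

text \<open>The integral over \<open>real^'n\<close> is cut into periods; on each of them the Fejer kernel averages \<open>g\<close> around a translate of
  \<open>x\<close>. Averaging a Lipschitz function against a probability density moves its value by at most the Lipschitz
  constant times the first absolute moment.\<close>

lemma fejer_approximation:
  fixes g :: "real^'n::finite \<Rightarrow> complex"
  assumes g: "g \<in> schwartz_functions" and R: "\<And>x. R < norm x \<Longrightarrow> g x = 0"
    and lip: "\<And>x y. norm (g x - g y) \<le> \<Lambda> * norm (x - y)" and "\<Lambda> \<ge> 0"
    and m: "2 * R + 1 \<le> real m" and x: "norm x \<le> R" and K: "K > 0"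
  shows "norm ((\<Sum>\<kappa>\<in>int_box m. g (x + of_int_vec \<kappa>)) - convolve (\<lambda>y. complex_of_real (fejer_kernel K y)) g x)
    \<le> card (int_box m :: (int^'n) set) * (\<Lambda> * (CARD('n) / sqrt K))"
proof -
  let ?T = "\<lambda>y. complex_of_real (fejer_kernel K y)"
  have T: "?T \<in> trig_polynomials" by (rule fejer_kernel_trig)
  have [measurable]: "?T \<in> borel_measurable borel" using trig_polynomial_smooth[OF T] by (rule smooth_measurable)
  have [measurable]: "g \<in> borel_measurable borel" by (rule schwartz_measurable[OF g])
  obtain B where B: "\<And>x. norm (g x) \<le> B" using schwartz_bounded[OF g] by metis
  have iT: "integrable lborel (\<lambda>y::real^'n. complex_of_real (unit_cube y * fejer_kernel K y))"
    by (intro integrable_of_real integrable_unit_cube_fejer)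
  have ig: "integrable lborel (\<lambda>y. complex_of_real (unit_cube y * fejer_kernel K y) * g (z + y))" for z
  proof (rule Bochner_Integration.integrable_bound[where f = "\<lambda>y. of_real B * complex_of_real (unit_cube y * fejer_kernel K y)"])
    have "B \<ge> 0" using B[of 0] norm_ge_zero order_trans by blast
    then show "AE y in lborel. norm (complex_of_real (unit_cube y * fejer_kernel K y) * g (z + y)) \<le>
        norm (of_real B * complex_of_real (unit_cube y * fejer_kernel K y))"
      using B by (intro AE_I2) (simp add: norm_mult mult.commute[of _ "g _"] mult_right_mono del: of_real_mult)
  qed (use iT in auto)
  have "convolve ?T g x = (\<Sum>\<kappa>\<in>int_box m. \<integral>y. unit_cube y * (?T (y + of_int_vec \<kappa>) * g (x + (y + of_int_vec \<kappa>))) \<partial>lborel)"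
    unfolding convolve_def
  proof (rule integral_unit_cube_decomposition[OF integrable_convolve[OF T g]])
    fix y assume "?T y * g (x + y) \<noteq> 0"
    then have "norm (x + y) \<le> R" using R[of "x + y"] by fastforce
    moreover have "norm y \<le> norm (x + y) + norm x"
      using norm_triangle_ineq4[of "x + y" x] by simp
    ultimately show "norm y + 1 \<le> real m" using m x by linarith
  qed
  also have "\<dots> = (\<Sum>\<kappa>\<in>int_box m. \<integral>y. complex_of_real (unit_cube y * fejer_kernel K y) * g (x + of_int_vec \<kappa> + y) \<partial>lborel)"
    by (simp add: trig_polynomial_periodic[OF T] add_ac mult.assoc)
  finally have conv: "convolve ?T g x = (\<Sum>\<kappa>\<in>int_box m. \<integral>y. complex_of_real (unit_cube y * fejer_kernel K y) * g (x + of_int_vec \<kappa> + y) \<partial>lborel)" .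
  have one: "norm (g z - (\<integral>y. complex_of_real (unit_cube y * fejer_kernel K y) * g (z + y) \<partial>lborel)) \<le> \<Lambda> * (CARD('n) / sqrt K)" for z
  proof -
    have "(\<integral>y. complex_of_real (unit_cube y * fejer_kernel K y) \<partial>(lborel :: (real^'n) measure)) = 1"
      by (simp only: integral_complex_of_real integral_unit_cube_fejer[OF K] of_real_1)
    then have "g z = (\<integral>y. complex_of_real (unit_cube y * fejer_kernel K y) * g z \<partial>(lborel :: (real^'n) measure))"
      by (simp del: of_real_mult)
    then have "g z - (\<integral>y. complex_of_real (unit_cube y * fejer_kernel K y) * g (z + y) \<partial>lborel) =
        (\<integral>y. complex_of_real (unit_cube y * fejer_kernel K y) * g z - complex_of_real (unit_cube y * fejer_kernel K y) * g (z + y) \<partial>lborel)"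
      using Bochner_Integration.integral_diff[OF integrable_mult_left[OF iT, of "g z"] ig[of z]] by simp
    also have "norm \<dots> \<le> (\<integral>y. \<Lambda> * (unit_cube y * fejer_kernel K y * (\<Sum>i\<in>UNIV. \<bar>y $ i\<bar>)) \<partial>(lborel :: (real^'n) measure))"
    proof (rule norm_integral_le)
      show "integrable lborel (\<lambda>y. complex_of_real (unit_cube y * fejer_kernel K y) * g z - complex_of_real (unit_cube y * fejer_kernel K y) * g (z + y))"
        by (intro Bochner_Integration.integrable_diff integrable_mult_left iT ig)
      show "integrable lborel (\<lambda>y::real^'n. \<Lambda> * (unit_cube y * fejer_kernel K y * (\<Sum>i\<in>UNIV. \<bar>y $ i\<bar>)))"
        by (intro integrable_mult_right integrable_unit_cube_fejer_norm)
      fix y :: "real^'n"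
      have nn: "0 \<le> unit_cube y * fejer_kernel K y" by (simp add: unit_cube_bounds fejer_kernel_nonneg)
      have "norm (complex_of_real (unit_cube y * fejer_kernel K y) * g z - complex_of_real (unit_cube y * fejer_kernel K y) * g (z + y)) =
          (unit_cube y * fejer_kernel K y) * norm (g z - g (z + y))"
        using nn by (simp add: norm_mult flip: right_diff_distrib del: of_real_mult)
      also have "\<dots> \<le> (unit_cube y * fejer_kernel K y) * (\<Lambda> * (\<Sum>i\<in>UNIV. \<bar>y $ i\<bar>))"
      proof (intro mult_left_mono nn)
        have "norm (g z - g (z + y)) \<le> \<Lambda> * norm y" using lip[of z "z + y"] by simp
        also have "\<dots> \<le> \<Lambda> * (\<Sum>i\<in>UNIV. \<bar>y $ i\<bar>)" by (intro mult_left_mono norm_le_l1_cart assms)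
        finally show "norm (g z - g (z + y)) \<le> \<Lambda> * (\<Sum>i\<in>UNIV. \<bar>y $ i\<bar>)" .
      qed
      finally show "norm (complex_of_real (unit_cube y * fejer_kernel K y) * g z - complex_of_real (unit_cube y * fejer_kernel K y) * g (z + y)) \<le>
          \<Lambda> * (unit_cube y * fejer_kernel K y * (\<Sum>i\<in>UNIV. \<bar>y $ i\<bar>))"
        by (simp add: mult_ac)
    qed
    also have "\<dots> \<le> \<Lambda> * (CARD('n) / sqrt K)"
      using mult_left_mono[OF integral_unit_cube_fejer_norm[OF K, where 'n = 'n] \<open>\<Lambda> \<ge> 0\<close>] by simp
    finally show ?thesis .
  qed
  have "norm ((\<Sum>\<kappa>\<in>int_box m. g (x + of_int_vec \<kappa>)) - convolve ?T g x) \<le>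
      (\<Sum>\<kappa>\<in>(int_box m :: (int^'n) set). \<Lambda> * (CARD('n) / sqrt K))"
    unfolding conv sum_subtractf[symmetric] by (intro sum_norm_le one)
  then show ?thesis by simp
qed

lemma schwartz_lipschitz:
  assumes "g \<in> schwartz_functions"
  obtains \<Lambda> where "\<Lambda> \<ge> 0" "\<And>x y. norm (g x - g y) \<le> \<Lambda> * norm (x - y)"
proof -
  have "\<exists>B>0. \<forall>x. norm (partial_deriv i g x) \<le> B" for i
    using schwartz_bounded[OF schwartz_partial_deriv[OF assms, of i]] by metis
  then obtain B where B: "\<And>i. B i > 0" "\<And>i x. norm (partial_deriv i g x) \<le> B i" by metis
  have "norm (g x - g y) \<le> (\<Sum>i\<in>UNIV. B i) * norm (x - y)" for x y
  proof (rule differentiable_bound[of UNIV g])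
    fix x :: "real^'a"
    show "(g has_derivative (\<lambda>h. \<Sum>i\<in>UNIV. h $ i *\<^sub>R partial_deriv i g x)) (at x within UNIV)"
      using has_derivative_partial[OF schwartz_differentiable[OF assms]] by simp
    show "onorm (\<lambda>h. \<Sum>i\<in>UNIV. h $ i *\<^sub>R partial_deriv i g x) \<le> (\<Sum>i\<in>UNIV. B i)"
    proof (rule onorm_bound)
      show "0 \<le> (\<Sum>i\<in>UNIV. B i)" using B(1) by (intro sum_nonneg) (simp add: less_imp_le)
      fix h :: "real^'a"
      have "norm (h $ i *\<^sub>R partial_deriv i g x) \<le> B i * norm h" for i
        using mult_mono[OF component_le_norm_cart[of h i] B(2)[of i x]] by (simp add: mult.commute)
      then show "norm (\<Sum>i\<in>UNIV. h $ i *\<^sub>R partial_deriv i g x) \<le> (\<Sum>i\<in>UNIV. B i) * norm h"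
        unfolding sum_distrib_right by (intro sum_norm_le)
    qed
  qed auto
  moreover have "0 \<le> (\<Sum>i\<in>UNIV. B i)" using B(1) by (intro sum_nonneg) (simp add: less_imp_le)
  ultimately show ?thesis using that by blast
qed

subsection \<open>Uniqueness of the Fourier coefficients\<close>

text \<open>By periodicity, \<open>D f\<close> is the value of \<open>D\<close> at \<open>\<phi>\<close> times the periodization \<open>P\<close> of \<open>f\<close>. The Fejer means of \<open>P\<close> are
  trigonometric polynomials, on whose products with \<open>\<phi>\<close> the functional vanishes, and they converge to \<open>P\<close> with all
  derivatives. The continuity hypothesis refers to this mode of convergence, with supports in a fixed ball.\<close>

theorem periodic_functional_eq_zero:
  fixes D :: "'n::finite functional"
  assumes add: "\<And>f g. f \<in> test_functions \<Longrightarrow> g \<in> test_functions \<Longrightarrow> D (\<lambda>x. f x + g x) = D f + D g"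
    and scale: "\<And>a f. f \<in> test_functions \<Longrightarrow> D (\<lambda>x. a * f x) = a * D f"
    and per: "\<And>f \<kappa>. f \<in> test_functions \<Longrightarrow> D (\<lambda>x. f (x + of_int_vec \<kappa>)) = D f"
    and cont: "\<And>h R. (\<And>K. h K \<in> test_functions) \<Longrightarrow> (\<And>K x. R < norm x \<Longrightarrow> h K x = 0) \<Longrightarrow>
        (\<And>is. uniform_limit UNIV (\<lambda>K. partial_derivs is (h K)) (\<lambda>x. 0) sequentially) \<Longrightarrow>
        (\<lambda>K. D (h K)) \<longlonglongrightarrow> 0"
    and \<phi>: "periodic_partition \<phi>"
    and coeff: "\<And>\<kappa>. D (\<lambda>x. \<phi> x * int_character \<kappa> x) = 0"
    and f: "f \<in> test_functions"
  shows "D f = 0"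
proof -
  have \<phi>t: "\<phi> \<in> test_functions" using \<phi> by (simp add: periodic_partition_def)
  obtain R1 R2 where R12: "\<And>x. R1 < norm x \<Longrightarrow> \<phi> x = 0" "\<And>x. R2 < norm x \<Longrightarrow> f x = 0"
    using \<phi>t f by (auto simp: test_function_iff)
  define R where "R = max 0 (max R1 R2)"
  have R0: "R \<ge> 0" and R\<phi>: "\<And>x. R < norm x \<Longrightarrow> \<phi> x = 0" and Rf: "\<And>x. R < norm x \<Longrightarrow> f x = 0"
    using R12 by (auto simp: R_def)
  obtain m :: nat where m: "2 * R + 1 \<le> real m" using real_arch_simple by blast
  have fS: "f \<in> schwartz_functions" and \<phi>S: "\<phi> \<in> schwartz_functions"
    using f \<phi>t test_functions_subset_schwartz by auto
  have D0: "D (\<lambda>x. 0) = 0" using scale[OF test_function_zero, of 0] by simp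
  have Dsum: "D (\<lambda>x. \<Sum>i\<in>I. h i x) = (\<Sum>i\<in>I. D (h i))" if "\<And>i. h i \<in> test_functions"
    for I :: "(int^'n) set" and h
    using that by (induction I rule: infinite_finite_induct) (simp_all add: D0 add test_function_sum)
  define P where "P x = (\<Sum>\<kappa>\<in>int_box m. f (x + of_int_vec \<kappa>))" for x
  have Psm: "smooth_fun P" unfolding P_def[abs_def]
    by (intro smooth_sum smooth_translate test_function_smooth f)
  \<comment> \<open>Insert the partition of unity and move each translate of \<open>\<phi>\<close> back, using the invariance of \<open>D\<close>.\<close>
  have "f x = (\<Sum>\<kappa>\<in>int_box m. \<phi> (x - of_int_vec \<kappa>) * f x)" for x
  proof (cases "R < norm x")
    case False
    have "(\<Sum>\<kappa>\<in>int_box m. \<phi> (x - of_int_vec \<kappa>)) = 1"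
      by (rule periodic_partition_sum[OF \<phi>, where R = R]) (use False m R\<phi> in auto)
    then show ?thesis by (simp flip: sum_distrib_right)
  qed (simp add: Rf)
  then have "D f = D (\<lambda>x. \<Sum>\<kappa>\<in>int_box m. \<phi> (x - of_int_vec \<kappa>) * f x)" by presburger
  also have "\<dots> = (\<Sum>\<kappa>\<in>int_box m. D (\<lambda>x. \<phi> (x - of_int_vec \<kappa>) * f x))"
    by (rule Dsum) (use test_function_mult[OF test_function_translate[OF \<phi>t] test_function_smooth[OF f]] in
      \<open>simp add: of_int_vec_minus[symmetric] diff_conv_add_uminus del: add_uminus_conv_diff\<close>)
  also have "\<dots> = (\<Sum>\<kappa>\<in>int_box m. D (\<lambda>x. \<phi> x * f (x + of_int_vec \<kappa>)))"
  proof (rule sum.cong[OF refl])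
    fix \<kappa> :: "int^'n"
    have "(\<lambda>x. \<phi> (x - of_int_vec \<kappa>) * f x) \<in> test_functions"
      using test_function_mult[OF test_function_translate[OF \<phi>t, of "- of_int_vec \<kappa>"] test_function_smooth[OF f]]
      by simp
    from per[OF this, of \<kappa>]
    show "D (\<lambda>x. \<phi> (x - of_int_vec \<kappa>) * f x) = D (\<lambda>x. \<phi> x * f (x + of_int_vec \<kappa>))" by simp
  qed
  also have "\<dots> = D (\<lambda>x. \<Sum>\<kappa>\<in>int_box m. \<phi> x * f (x + of_int_vec \<kappa>))"
    by (rule Dsum[symmetric]) (intro test_function_mult \<phi>t smooth_translate test_function_smooth f)
  also have "\<dots> = D (\<lambda>x. \<phi> x * P x)" by (simp add: P_def sum_distrib_left)
  finally have Df: "D f = D (\<lambda>x. \<phi> x * P x)" .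
  have Dtrig: "D (\<lambda>x. \<phi> x * T x) = 0" if "T \<in> trig_polynomials" for T
    using that unfolding trig_polynomials_def
  proof induction
    case (add S T)
    then have "smooth_fun S" "smooth_fun T" using trig_polynomial_smooth by (auto simp: trig_polynomials_def)
    then show ?case
      using add assms(1)[of "\<lambda>x. \<phi> x * S x" "\<lambda>x. \<phi> x * T x"] by (simp add: distrib_left test_function_mult \<phi>t)
  next
    case (scale S a)
    then have "smooth_fun S" using trig_polynomial_smooth by (auto simp: trig_polynomials_def)
    then show ?case
      using scale assms(2)[of "\<lambda>x. \<phi> x * S x" a] by (simp add: mult.left_commute test_function_mult \<phi>t)
  qed (auto simp: D0 coeff)
  \<comment> \<open>\<open>Suc K\<close>, since the Fejer kernel of index \<open>0\<close> is zero.\<close>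
  define T where "T K = (\<lambda>y::real^'n. complex_of_real (fejer_kernel (Suc K) y))" for K
  have T: "T K \<in> trig_polynomials" for K unfolding T_def by (rule fejer_kernel_trig)
  have csm: "smooth_fun (convolve (T K) f)" for K
    using convolve_trig[OF T fS] trig_polynomial_smooth by blast
  define h where "h K = (\<lambda>x. \<phi> x * (P x - convolve (T K) f x))" for K
  have ht: "h K \<in> test_functions" for K
    unfolding h_def by (intro test_function_mult \<phi>t smooth_diff Psm csm)
  have Dh: "D (h K) = D f" for K
  proof -
    have e: "h K = (\<lambda>x. \<phi> x * P x + (-1) * (\<phi> x * convolve (T K) f x))"
      by (auto simp: h_def algebra_simps)
    have "D (h K) = D (\<lambda>x. \<phi> x * P x) + (-1) * D (\<lambda>x. \<phi> x * convolve (T K) f x)"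
      unfolding e
      by (subst add, intro test_function_mult \<phi>t Psm, intro test_function_cmult test_function_mult \<phi>t csm,
          subst scale, intro test_function_mult \<phi>t csm, rule refl)
    then show ?thesis using Dtrig[of "convolve (T K) f"] convolve_trig[OF T fS] Df by auto
  qed
  have "(\<lambda>K. D (h K)) \<longlonglongrightarrow> 0"
  proof (rule cont[of h R])
    fix "is" :: "'n list"
    let ?J = "{js :: 'n list. length js \<le> length is}"
    have "\<exists>B>0. \<forall>x. norm (partial_derivs js \<phi> x) \<le> B" for js
      using schwartz_bounded[OF schwartz_partial_derivs[OF \<phi>S, of js]] by metis
    then obtain B where B: "\<And>js. B js > 0" "\<And>js x. norm (partial_derivs js \<phi> x) \<le> B js" by metis
    have "\<exists>\<Lambda>\<ge>0. \<forall>x y. norm (partial_derivs js f x - partial_derivs js f y) \<le> \<Lambda> * norm (x - y)" for js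
      using schwartz_lipschitz[OF schwartz_partial_derivs[OF fS, of js]] by metis
    then obtain \<Lambda> where L: "\<And>js. \<Lambda> js \<ge> 0"
      "\<And>js x y. norm (partial_derivs js f x - partial_derivs js f y) \<le> \<Lambda> js * norm (x - y)" by metis
    define c where "c = (\<Sum>js\<in>?J. card (int_box m :: (int^'n) set) * (\<Lambda> js * CARD('n)))"
    have est: "norm (partial_derivs js (\<lambda>x. P x - convolve (T K) f x) x) \<le> c / sqrt (Suc K)"
      if js: "js \<in> ?J" and x: "norm x \<le> R" for js K x
    proof -
      have "partial_derivs js (\<lambda>x. P x - convolve (T K) f x) x =
          (\<Sum>\<kappa>\<in>int_box m. partial_derivs js f (x + of_int_vec \<kappa>)) - convolve (T K) (partial_derivs js f) x"
      proof -
        have "partial_derivs js P = (\<lambda>x. \<Sum>\<kappa>\<in>int_box m. partial_derivs js f (x + of_int_vec \<kappa>))"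
          unfolding P_def[abs_def]
          by (simp add: partial_derivs_sum partial_derivs_translate smooth_translate test_function_smooth[OF f])
        then show ?thesis by (simp add: partial_derivs_diff[OF Psm csm] convolve_partial_derivs[OF T fS])
      qed
      also have "norm \<dots> \<le> card (int_box m :: (int^'n) set) * (\<Lambda> js * (CARD('n) / sqrt (Suc K)))"
        unfolding T_def
        by (rule fejer_approximation[OF schwartz_partial_derivs[OF fS] partial_derivs_zero_outside[OF Rf] L(2,1) m x]) auto
      also have "\<dots> = card (int_box m :: (int^'n) set) * (\<Lambda> js * CARD('n)) / sqrt (Suc K)" by simp
      also have "\<dots> \<le> c / sqrt (Suc K)"
        unfolding c_def using L(1)
        by (intro divide_right_mono member_le_sum[OF js] finite_short_lists) auto
      finally show ?thesis .
    qed
    have "B js \<le> (\<Sum>js\<in>?J. B js)" if "js \<in> ?J" for js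
      using that B(1) by (intro member_le_sum finite_short_lists) (auto simp: less_imp_le)
    then have B': "norm (partial_derivs js \<phi> x) \<le> (\<Sum>js\<in>?J. B js)" if "js \<in> ?J" for js x
      using that B(2)[of js x] order_trans by blast
    define C where "C = 2 ^ length is * ((\<Sum>js\<in>?J. B js) * c)"
    have bound: "norm (partial_derivs is (h K) x) \<le> \<bar>C\<bar> / sqrt (Suc K)" for K x
    proof (cases "R < norm x")
      case True
      have "partial_derivs is (h K) x = 0"
        by (rule partial_derivs_zero_outside[OF _ True]) (simp add: h_def R\<phi>)
      then show ?thesis by simp
    next
      case False
      have "norm (partial_derivs is (h K) x) \<le> 2 ^ length is * ((\<Sum>js\<in>?J. B js) * (c / sqrt (Suc K)))"
        unfolding h_def
        by (rule partial_derivs_mult_bound) (use B' est False in \<open>auto intro: smooth_diff Psm csm test_function_smooth[OF \<phi>t]\<close>)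
      also have "\<dots> = C / sqrt (Suc K)" by (simp add: C_def)
      also have "\<dots> \<le> \<bar>C\<bar> / sqrt (Suc K)" by (intro divide_right_mono) auto
      finally show ?thesis .
    qed
    have "(\<lambda>K. \<bar>C\<bar> / sqrt (Suc K)) \<longlonglongrightarrow> 0"
      by (intro tendsto_divide_0[OF tendsto_const] filterlim_at_top_imp_at_infinity
          filterlim_compose[OF sqrt_at_top] filterlim_compose[OF filterlim_real_sequentially filterlim_Suc])
    then show "uniform_limit UNIV (\<lambda>K. partial_derivs is (h K)) (\<lambda>x. 0) sequentially"
      unfolding uniform_limit_iff
    proof (intro allI impI)
      fix e :: real assume e: "e > 0"
      have "eventually (\<lambda>K. \<bar>C\<bar> / sqrt (Suc K) < e) sequentially"
        using order_tendstoD(2)[OF \<open>(\<lambda>K. \<bar>C\<bar> / sqrt (Suc K)) \<longlonglongrightarrow> 0\<close> e] .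
      then show "\<forall>\<^sub>F K in sequentially. \<forall>x\<in>UNIV. dist (partial_derivs is (h K) x) 0 < e"
        by eventually_elim (use bound in \<open>auto intro: le_less_trans\<close>)
    qed
  qed (use ht in \<open>auto simp: h_def R\<phi>\<close>)
  then show ?thesis using LIMSEQ_unique[OF tendsto_const] by (simp add: Dh)
qed

section \<open>Tempered extensions\<close>

lemma weighted_seminorm_upper:
  fixes f :: "real^'n::finite \<Rightarrow> complex"
  assumes f: "f \<in> schwartz_functions" and l: "length is \<le> m"
  shows "(1 + norm x) ^ k * norm (partial_derivs is f x) \<le> weighted_seminorm k m f"
proof -
  have bdd: "bdd_above (range (\<lambda>x. (1 + norm x) ^ k * norm (partial_derivs js f x)))" for js
    using schwartz_rapid[OF schwartz_partial_derivs[OF f, of js]]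
    unfolding rapidly_decreasing_def bdd_above_def by fastforce
  have up: "(1 + norm x) ^ k * norm (partial_derivs js f x) \<le> (SUP x. (1 + norm x) ^ k * norm (partial_derivs js f x))" for js x
    by (rule cSUP_upper[OF UNIV_I bdd])
  have "(SUP x. (1 + norm x) ^ k * norm (partial_derivs is f x)) \<le> weighted_seminorm k m f"
    unfolding weighted_seminorm_def
  proof (rule member_le_sum)
    fix js :: "'n list"
    have "0 \<le> (1 + norm (0::real^'n)) ^ k * norm (partial_derivs js f 0)" by simp
    also have "\<dots> \<le> (SUP x. (1 + norm x) ^ k * norm (partial_derivs js f x))" by (rule up)
    finally show "0 \<le> (SUP x. (1 + norm x) ^ k * norm (partial_derivs js f x))" .
  qed (use l in \<open>auto intro: finite_short_lists\<close>)
  with up[of x "is"] show ?thesis by (rule order_trans)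
qed

lemma weighted_seminorm_least:
  fixes f :: "real^'n::finite \<Rightarrow> complex" and c :: real
  assumes "\<And>is x. length is \<le> m \<Longrightarrow> (1 + norm x) ^ k * norm (partial_derivs is f x) \<le> c"
  shows "weighted_seminorm k m f \<le> card {js :: 'n list. length js \<le> m} * c"
  unfolding weighted_seminorm_def
  by (rule sum_bounded_above) (auto intro!: cSUP_least assms)

lemma weighted_seminorm_nonneg: "f \<in> schwartz_functions \<Longrightarrow> 0 \<le> weighted_seminorm k m f"
  by (rule order_trans[OF _ weighted_seminorm_upper[of f "[]" m 0 k]]) simp_all

lemma weighted_seminorm_decay:
  fixes f :: "real^'n::finite \<Rightarrow> complex"
  assumes "f \<in> schwartz_functions"
  shows "norm (f x) \<le> weighted_seminorm (2 * CARD('n)) m f * decay x"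
  using weighted_seminorm_upper[OF assms, of "[]" m x "2 * CARD('n)"] by (intro rapidly_decreasing_le_decay) simp

subsection \<open>Test functions are dense\<close>

lemma partial_derivs_dilate:
  fixes f :: "real^'n \<Rightarrow> complex"
  assumes "smooth_fun f"
  shows "partial_derivs is (\<lambda>x. f (r *\<^sub>R x)) = (\<lambda>x. of_real (r ^ length is) * partial_derivs is f (r *\<^sub>R x))"
proof (induction "is")
  case (Cons i "is")
  have sm: "smooth_fun (partial_derivs is f)" using assms by (rule smooth_partial_derivs)
  have lin: "linear (\<lambda>x::real^'n. r *\<^sub>R x)" by (rule linear_scaleR)
  have "partial_deriv i (\<lambda>x. partial_derivs is f (r *\<^sub>R x + 0)) x = of_real r * partial_deriv i (partial_derivs is f) (r *\<^sub>R x)" for x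
  proof -
    have "partial_deriv i (\<lambda>x. partial_derivs is f (r *\<^sub>R x + 0)) x =
        (\<Sum>j\<in>UNIV. (r *\<^sub>R axis i 1) $ j *\<^sub>R partial_deriv j (partial_derivs is f) (r *\<^sub>R x + 0))"
      by (rule partial_deriv_compose_affine[OF lin smooth_differentiable[OF sm]])
    also have "\<dots> = r *\<^sub>R (\<Sum>j\<in>UNIV. axis i 1 $ j *\<^sub>R partial_deriv j (partial_derivs is f) (r *\<^sub>R x))"
      by (simp add: scaleR_sum_right)
    also have "\<dots> = r *\<^sub>R partial_deriv i (partial_derivs is f) (r *\<^sub>R x)"
      by (simp only: sum_axis_scaleR)
    finally show ?thesis by (simp only: scaleR_conv_of_real[where 'a = complex])
  qed
  then have "partial_deriv i (\<lambda>x. of_real (r ^ length is) * partial_derivs is f (r *\<^sub>R x)) =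
      (\<lambda>x. of_real (r ^ length is) * (of_real r * partial_deriv i (partial_derivs is f) (r *\<^sub>R x)))"
    using smooth_differentiable[OF smooth_compose_linear[OF sm lin]] by (auto simp: partial_deriv_cmult)
  then show ?case
    using Cons by (simp add: partial_derivs_Cons mult_ac del: partial_derivs.simps)
qed simp

text \<open>Cut off by \<open>cut (x / R)\<close>. The derivatives of the cutoff stay bounded for \<open>R \<ge> 1\<close> and the difference
  lives where \<open>\<bar>x\<bar> \<ge> R\<close>, where the decay of \<open>f\<close> gains a factor \<open>1 / R\<close>.\<close>

lemma test_functions_dense:
  fixes f :: "real^'n::finite \<Rightarrow> complex"
  assumes f: "f \<in> schwartz_functions"
  obtains C where "\<And>R. R \<ge> 1 \<Longrightarrow> \<exists>g\<in>test_functions. weighted_seminorm m m (\<lambda>x. f x - g x) \<le> C / R"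
proof -
  define cut where "cut x = (\<Sum>\<kappa>\<in>int_box 1. partition_fun (x - of_int_vec \<kappa>))" for x :: "real^'n"
  have cut: "cut \<in> test_functions"
  proof -
    have "(\<lambda>x. partition_fun (x - of_int_vec \<kappa>)) \<in> test_functions" for \<kappa> :: "int^'n"
      using test_function_translate[OF partition_fun_test, of "- of_int_vec \<kappa>"] by simp
    then show ?thesis unfolding cut_def[abs_def] by (intro test_function_sum)
  qed
  define G where "G x = 1 - cut x" for x
  have Gs: "smooth_fun G"
    unfolding G_def[abs_def] by (intro smooth_diff smooth_const test_function_smooth cut)
  have G0: "G x = 0" if "norm x < 1" for x
  proof -
    have "\<bar>x $ i\<bar> \<le> real 1" for i using component_le_norm_cart[of x i] that by simp
    then have "cut x = 1" unfolding cut_def by (rule partition_fun_sum)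
    then show ?thesis by (simp add: G_def)
  qed
  have G0': "partial_derivs js G x = 0" if x: "norm x < 1" for js x
  proof -
    have "open {x :: real^'n. norm x < 1}" by (intro open_Collect_less continuous_intros)
    then have "partial_derivs js G x = partial_derivs js (\<lambda>x. 0) x"
      by (rule partial_derivs_local) (use G0 x in auto)
    then show ?thesis by (simp add: partial_derivs_zero)
  qed
  have "\<exists>B>0. \<forall>x. norm (partial_derivs js G x) \<le> B" for js
  proof -
    obtain B where B: "B > 0" "\<And>x. norm (partial_derivs js cut x) \<le> B"
      using schwartz_bounded[OF schwartz_partial_derivs, of cut js] cut test_functions_subset_schwartz by blast
    have c: "norm (partial_derivs js (\<lambda>x::real^'n. 1) x) \<le> 1" for x
    proof (cases js rule: rev_cases)
      case (snoc ys y)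
      have "partial_deriv y (\<lambda>x::real^'n. 1) = (\<lambda>x. 0)" by (auto simp: partial_deriv_def)
      then show ?thesis by (simp add: snoc partial_derivs_snoc partial_derivs_zero)
    qed simp
    have "norm (partial_derivs js G x) \<le> 1 + B" for x
      unfolding G_def[abs_def] partial_derivs_diff[OF smooth_const test_function_smooth[OF cut]]
      using norm_triangle_ineq4 c[of x] B(2)[of x] by (meson add_mono order_trans)
    then show ?thesis using B(1) by (intro exI[of _ "1 + B"]) auto
  qed
  then obtain B where B: "\<And>js. B js > 0" "\<And>js x. norm (partial_derivs js G x) \<le> B js" by metis
  have "\<exists>A. \<forall>x. (1 + norm x) ^ Suc m * norm (partial_derivs js f x) \<le> A" for js
    using schwartz_rapid[OF schwartz_partial_derivs[OF f]] unfolding rapidly_decreasing_def by blast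
  then obtain A where A: "\<And>js x. (1 + norm x) ^ Suc m * norm (partial_derivs js f x) \<le> A js" by metis
  have A0: "A js \<ge> 0" for js
    by (rule order_trans[OF _ A[of 0 js]]) simp
  let ?J = "{js :: 'n list. length js \<le> m}"
  define SA where "SA = (\<Sum>js\<in>?J. A js)"
  define SB where "SB = (\<Sum>js\<in>?J. B js)"
  have SA: "A js \<le> SA" "0 \<le> SA" and SB: "B js \<le> SB" "0 \<le> SB" if "js \<in> ?J" for js
    unfolding SA_def SB_def using that A0 B(1)
    by (auto intro!: member_le_sum sum_nonneg finite_short_lists simp: less_imp_le)
  define c where "c = 2 ^ m * (SA * SB)"
  have c0: "0 \<le> c"
    using SA(2)[of "[]"] SB(2)[of "[]"] by (simp add: c_def)
  have "\<exists>g\<in>test_functions. weighted_seminorm m m (\<lambda>x. f x - g x) \<le> (card ?J * c) / R" if R: "R \<ge> 1" for R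
  proof -
    define r where "r = 1 / R"
    have r: "0 < r" "r \<le> 1" using R by (auto simp: r_def)
    define g where "g x = cut (r *\<^sub>R x) * f x" for x
    have "(\<lambda>x. cut (r *\<^sub>R x)) \<in> test_functions"
      by (rule test_function_compose_linear[OF cut linear_scaleR linear_scaleR[of R]]) (use R in \<open>simp add: r_def\<close>)
    then have g: "g \<in> test_functions"
      unfolding g_def[abs_def] by (rule test_function_mult) (rule schwartz_smooth[OF f])
    have e: "f x - g x = f x * G (r *\<^sub>R x)" for x
      by (simp add: g_def G_def algebra_simps)
    have Gr: "smooth_fun (\<lambda>x. G (r *\<^sub>R x))" by (rule smooth_compose_linear[OF Gs linear_scaleR])
    have "weighted_seminorm m m (\<lambda>x. f x - g x) \<le> card ?J * (c / R)"
      unfolding e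
    proof (rule weighted_seminorm_least)
      fix "is" :: "'n list" and x :: "real^'n"
      assume l: "length is \<le> m"
      have dG: "norm (partial_derivs js (\<lambda>x. G (r *\<^sub>R x)) x) \<le> (if norm x < R then 0 else SB)" if js: "length js \<le> length is" for js
      proof (cases "norm x < R")
        case True
        then have "norm (r *\<^sub>R x) < 1" using R by (simp add: r_def)
        then show ?thesis using True by (simp add: partial_derivs_dilate[OF Gs] G0')
      next
        case False
        have "norm (partial_derivs js (\<lambda>x. G (r *\<^sub>R x)) x) = r ^ length js * norm (partial_derivs js G (r *\<^sub>R x))"
          using r by (simp add: partial_derivs_dilate[OF Gs] norm_mult norm_power)
        also have "\<dots> \<le> 1 * norm (partial_derivs js G (r *\<^sub>R x))"
          using r by (intro mult_right_mono power_le_one) auto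
        also have "\<dots> \<le> SB" using B(2)[of js "r *\<^sub>R x"] SB(1)[of js] js l by simp
        finally show ?thesis using False by simp
      qed
      have df: "norm (partial_derivs js f x) \<le> SA / (1 + norm x) ^ Suc m" if js: "length js \<le> length is" for js
      proof -
        have "(1 + norm x) ^ Suc m * norm (partial_derivs js f x) \<le> SA"
          using A[of x js] SA(1)[of js] js l by simp
        then show ?thesis by (simp add: pos_le_divide_eq add_pos_nonneg mult_ac)
      qed
      have "norm (partial_derivs is (\<lambda>x. f x * G (r *\<^sub>R x)) x) \<le>
          2 ^ length is * (SA / (1 + norm x) ^ Suc m * (if norm x < R then 0 else SB))"
        by (rule partial_derivs_mult_bound[OF schwartz_smooth[OF f] Gr df dG])
      also have "\<dots> \<le> 2 ^ m * (SA / (1 + norm x) ^ Suc m * (if norm x < R then 0 else SB))"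
        using l SA(2) SB(2) by (intro mult_right_mono power_increasing) auto
      finally have "(1 + norm x) ^ m * norm (partial_derivs is (\<lambda>x. f x * G (r *\<^sub>R x)) x) \<le>
          (1 + norm x) ^ m * (2 ^ m * (SA / (1 + norm x) ^ Suc m * (if norm x < R then 0 else SB)))"
        by (intro mult_left_mono) auto
      also have "\<dots> = (if norm x < R then 0 else c / (1 + norm x))"
      proof -
        have "t ^ m * (2 ^ m * (SA / t ^ Suc m * s)) = 2 ^ m * (SA * s) / t" if "t > 0" for t s :: real
          using that by (simp add: field_simps)
        from this[of "1 + norm x"] show ?thesis by (simp add: c_def add_pos_nonneg)
      qed
      also have "\<dots> \<le> c / R"
        using R c0 by (auto intro!: divide_left_mono mult_pos_pos add_pos_nonneg)
      finally show "(1 + norm x) ^ m * norm (partial_derivs is (\<lambda>x. f x * G (r *\<^sub>R x)) x) \<le> c / R" .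
    qed
    then show ?thesis using g by auto
  qed
  then show ?thesis using that by blast
qed

lemma tempered_distribution_eqI:
  fixes u w :: "'n::finite functional"
  assumes u: "u \<in> tempered_distributions" and w: "w \<in> tempered_distributions"
    and eq: "\<And>f. f \<in> test_functions \<Longrightarrow> u f = w f"
  shows "u = w"
proof
  fix f :: "real^'n \<Rightarrow> complex"
  show "u f = w f"
  proof (cases "f \<in> schwartz_functions")
    case f: True
    have lim: "\<exists>C. \<forall>R\<ge>1. norm (v f) \<le> C / R"
      if v: "linear_functional_on schwartz_functions v" "\<And>f. f \<in> schwartz_functions \<Longrightarrow> norm (v f) \<le> B * weighted_seminorm m m f"
        and z: "\<And>f. f \<in> test_functions \<Longrightarrow> v f = 0" for v :: "'n functional" and B m
    proof -
      obtain C where C: "\<And>R. R \<ge> 1 \<Longrightarrow> \<exists>g\<in>test_functions. weighted_seminorm m m (\<lambda>x. f x - g x) \<le> C / R"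
        using test_functions_dense[OF f] by metis
      have "norm (v f) \<le> (\<bar>B\<bar> * C) / R" if R: "R \<ge> 1" for R
      proof -
        obtain g where g: "g \<in> test_functions" "weighted_seminorm m m (\<lambda>x. f x - g x) \<le> C / R"
          using C[OF R] by blast
        have gS: "g \<in> schwartz_functions" using g test_functions_subset_schwartz by blast
        have fg: "(\<lambda>x. f x - g x) \<in> schwartz_functions" by (rule schwartz_diff[OF f gS])
        have "v f = v (\<lambda>x. (f x - g x) + g x)" by simp
        also have "\<dots> = v (\<lambda>x. f x - g x) + v g"
          using v(1) fg gS unfolding linear_functional_on_def by fastforce
        finally have "norm (v f) \<le> B * weighted_seminorm m m (\<lambda>x. f x - g x)"
          using v(2)[OF fg] z[OF g(1)] by simp
        also have "\<dots> \<le> \<bar>B\<bar> * weighted_seminorm m m (\<lambda>x. f x - g x)"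
          by (intro mult_right_mono weighted_seminorm_nonneg fg) auto
        also have "\<dots> \<le> \<bar>B\<bar> * (C / R)" using g(2) by (intro mult_left_mono) auto
        finally show ?thesis by simp
      qed
      then show ?thesis by blast
    qed
    obtain Bu mu Bw mw where b: "\<And>f. f \<in> schwartz_functions \<Longrightarrow> norm (u f) \<le> Bu * weighted_seminorm mu mu f"
      "\<And>f. f \<in> schwartz_functions \<Longrightarrow> norm (w f) \<le> Bw * weighted_seminorm mw mw f"
      using u w unfolding tempered_distributions_def by blast
    \<comment> \<open>Both functionals are bounded by the seminorm of the larger order, to which density is applied.\<close>
    define M where "M = max mu mw"
    have mono: "weighted_seminorm k k h \<le> card {js :: 'n list. length js \<le> k} * weighted_seminorm M M h"
      if h: "h \<in> schwartz_functions" and k: "k \<le> M" for h :: "real^'n \<Rightarrow> complex" and k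
    proof (rule weighted_seminorm_least)
      fix "is" :: "'n list" and x :: "real^'n" assume "length is \<le> k"
      have "(1 + norm x) ^ k * norm (partial_derivs is h x) \<le> (1 + norm x) ^ M * norm (partial_derivs is h x)"
        using k by (intro mult_right_mono power_increasing) auto
      also have "\<dots> \<le> weighted_seminorm M M h"
        using \<open>length is \<le> k\<close> k by (intro weighted_seminorm_upper[OF h]) simp
      finally show "(1 + norm x) ^ k * norm (partial_derivs is h x) \<le> weighted_seminorm M M h" .
    qed
    define B where "B = \<bar>Bu\<bar> * card {js :: 'n list. length js \<le> mu} + \<bar>Bw\<bar> * card {js :: 'n list. length js \<le> mw}"
    have "\<exists>C. \<forall>R\<ge>1. norm (u f - w f) \<le> C / R"
    proof (rule lim)
      show "linear_functional_on schwartz_functions (\<lambda>f. u f - w f)"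
        using u w unfolding tempered_distributions_def linear_functional_on_def by (auto simp: algebra_simps)
      fix h :: "real^'n \<Rightarrow> complex" assume h: "h \<in> schwartz_functions"
      have 1: "norm (v h) \<le> \<bar>Bv\<bar> * card {js :: 'n list. length js \<le> mv} * weighted_seminorm M M h"
        if "norm (v h) \<le> Bv * weighted_seminorm mv mv h" "mv \<le> M" for v :: "'n functional" and Bv mv
      proof -
        note that(1)
        also have "Bv * weighted_seminorm mv mv h \<le> \<bar>Bv\<bar> * weighted_seminorm mv mv h"
          by (intro mult_right_mono weighted_seminorm_nonneg h) auto
        also have "\<dots> \<le> \<bar>Bv\<bar> * (card {js :: 'n list. length js \<le> mv} * weighted_seminorm M M h)"
          by (intro mult_left_mono mono[OF h that(2)]) auto
        finally show ?thesis by simp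
      qed
      have "norm (u h - w h) \<le> norm (u h) + norm (w h)" by (rule norm_triangle_ineq4)
      also have "\<dots> \<le> B * weighted_seminorm M M h"
        using 1[of u Bu mu] 1[of w Bw mw] b(1)[OF h] b(2)[OF h] unfolding B_def by (simp add: M_def distrib_right)
      finally show "norm (u h - w h) \<le> B * weighted_seminorm M M h" .
    qed (simp add: eq)
    then obtain C where C: "\<And>R. R \<ge> 1 \<Longrightarrow> norm (u f - w f) \<le> C / R" by blast
    have "norm (u f - w f) \<le> 0"
    proof (rule field_le_epsilon)
      fix e :: real assume e: "e > 0"
      define R where "R = max 1 (\<bar>C\<bar> / e)"
      have "norm (u f - w f) \<le> C / R" by (rule C) (simp add: R_def)
      also have "\<dots> \<le> \<bar>C\<bar> / R" by (intro divide_right_mono) (auto simp: R_def)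
      also have "\<dots> \<le> e"
      proof -
        have "\<bar>C\<bar> / e \<le> R" "R > 0" by (auto simp: R_def)
        then show ?thesis using e by (simp add: field_simps)
      qed
      finally show "norm (u f - w f) \<le> 0 + e" by simp
    qed
    then show ?thesis by simp
  next
    case False
    then show ?thesis using u w unfolding tempered_distributions_def linear_functional_on_def by auto
  qed
qed

lemma tempered_extension_eqI:
  assumes "w \<in> tempered_distributions" "\<And>f. f \<in> test_functions \<Longrightarrow> w f = u f"
  shows "tempered_extension u = w"
  unfolding tempered_extension_def
  by (rule the_equality) (use assms in \<open>auto intro: tempered_distribution_eqI\<close>)

subsection \<open>Absolutely convergent sums of characters\<close>

text \<open>The distribution \<open>\<Sum>\<kappa>. c \<kappa> * character (\<zeta> \<kappa>)\<close>: the bilinear pairing of a character with \<open>f\<close> is a value of the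
  inverse Fourier transform of \<open>f\<close>.\<close>

definition character_sum :: "('i \<Rightarrow> complex) \<Rightarrow> ('i \<Rightarrow> real^'n) \<Rightarrow> 'n::finite functional" where
  "character_sum c \<zeta> f = (if f \<in> schwartz_functions then \<Sum>\<^sub>\<infinity>\<kappa>. c \<kappa> * inv_fourier f (\<zeta> \<kappa>) else 0)"

lemma norm_inv_fourier_le:
  assumes "integrable lborel f" shows "norm (inv_fourier f y) \<le> (\<integral>x. norm (f x) \<partial>lborel)"
  unfolding inv_fourier_def
  by (rule norm_integral_le) (auto intro: integrable_character_mult assms simp: norm_mult)

lemma
  assumes c: "(\<lambda>\<kappa>. norm (c \<kappa>)) summable_on UNIV" and b: "\<And>\<kappa>. norm (a \<kappa>) \<le> M"
  shows summable_bounded_mult: "(\<lambda>\<kappa>. c \<kappa> * (a \<kappa> :: complex)) summable_on UNIV"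
    and norm_infsum_bounded_mult: "norm (\<Sum>\<^sub>\<infinity>\<kappa>. c \<kappa> * a \<kappa>) \<le> (\<Sum>\<^sub>\<infinity>\<kappa>. norm (c \<kappa>)) * M"
proof -
  have s: "(\<lambda>\<kappa>. norm (c \<kappa>) * M) summable_on UNIV"
    by (rule summable_on_cmult_left[OF c])
  have le: "norm (c \<kappa> * a \<kappa>) \<le> norm (c \<kappa>) * M" for \<kappa>
    using b by (simp add: norm_mult mult_left_mono)
  have abs: "(\<lambda>\<kappa>. norm (c \<kappa> * a \<kappa>)) summable_on UNIV"
    by (rule summable_on_comparison_test[OF s le]) auto
  then show "(\<lambda>\<kappa>. c \<kappa> * a \<kappa>) summable_on UNIV"
    by (rule abs_summable_summable)
  have "norm (\<Sum>\<^sub>\<infinity>\<kappa>. c \<kappa> * a \<kappa>) \<le> (\<Sum>\<^sub>\<infinity>\<kappa>. norm (c \<kappa> * a \<kappa>))"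
    by (rule norm_infsum_bound[OF abs])
  also have "\<dots> \<le> (\<Sum>\<^sub>\<infinity>\<kappa>. norm (c \<kappa>) * M)"
    by (rule infsum_mono[OF abs s le])
  also have "\<dots> = (\<Sum>\<^sub>\<infinity>\<kappa>. norm (c \<kappa>)) * M"
    by (rule infsum_cmult_left') 
  finally show "norm (\<Sum>\<^sub>\<infinity>\<kappa>. c \<kappa> * a \<kappa>) \<le> (\<Sum>\<^sub>\<infinity>\<kappa>. norm (c \<kappa>)) * M" .
qed

lemma inv_fourier_add:
  "f \<in> schwartz_functions \<Longrightarrow> g \<in> schwartz_functions \<Longrightarrow> inv_fourier (\<lambda>x. f x + g x) y = inv_fourier f y + inv_fourier g y"
  unfolding inv_fourier_def
  by (simp add: distrib_left integrable_character_mult schwartz_integrable)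

lemma inv_fourier_cmult: "inv_fourier (\<lambda>x. a * f x) y = a * inv_fourier f y"
  unfolding inv_fourier_def by (simp add: mult.left_commute)

lemma character_sum_linear:
  assumes c: "(\<lambda>\<kappa>. norm (c \<kappa>)) summable_on UNIV"
  shows "linear_functional_on schwartz_functions (character_sum c \<zeta>)"
  unfolding linear_functional_on_def
proof (intro conjI ballI allI impI)
  fix f g :: "real^'b \<Rightarrow> complex" assume f: "f \<in> schwartz_functions" and g: "g \<in> schwartz_functions"
  have s: "(\<lambda>\<kappa>. c \<kappa> * inv_fourier h (\<zeta> \<kappa>)) summable_on UNIV" if "h \<in> schwartz_functions" for h
    by (rule summable_bounded_mult[OF c norm_inv_fourier_le[OF schwartz_integrable[OF that]]])
  show "character_sum c \<zeta> (\<lambda>x. f x + g x) = character_sum c \<zeta> f + character_sum c \<zeta> g"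
    using f g by (simp add: character_sum_def schwartz_add inv_fourier_add distrib_left infsum_add s)
next
  fix a and f :: "real^'b \<Rightarrow> complex" assume f: "f \<in> schwartz_functions"
  then show "character_sum c \<zeta> (\<lambda>x. a * f x) = a * character_sum c \<zeta> f"
    by (simp add: character_sum_def schwartz_cmult inv_fourier_cmult mult.left_commute infsum_cmult_right')
qed (simp add: character_sum_def)

lemma character_sum_bound:
  assumes c: "(\<lambda>\<kappa>. norm (c \<kappa>)) summable_on UNIV" and f: "f \<in> schwartz_functions"
  shows "norm (character_sum c \<zeta> f) \<le> (\<Sum>\<^sub>\<infinity>\<kappa>. norm (c \<kappa>)) * (\<integral>x. norm (f x) \<partial>lborel)"
  using f norm_infsum_bounded_mult[OF c norm_inv_fourier_le[OF schwartz_integrable[OF f]]]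
  by (simp add: character_sum_def)

lemma character_sum_tempered:
  fixes \<zeta> :: "'i \<Rightarrow> real^'n::finite"
  assumes c: "(\<lambda>\<kappa>. norm (c \<kappa>)) summable_on UNIV"
  shows "character_sum c \<zeta> \<in> tempered_distributions"
proof -
  let ?m = "2 * CARD('n)"
  have "norm (character_sum c \<zeta> f) \<le>
      ((\<Sum>\<^sub>\<infinity>\<kappa>. norm (c \<kappa>)) * (\<integral>x. decay x \<partial>(lborel :: (real^'n) measure))) * weighted_seminorm ?m ?m f"
    if f: "f \<in> schwartz_functions" for f
  proof -
    have "(\<integral>x. norm (f x) \<partial>lborel) \<le> (\<integral>x. weighted_seminorm ?m ?m f * decay x \<partial>(lborel :: (real^'n) measure))"
      by (intro integral_mono integrable_norm schwartz_integrable f integrable_mult_right integrable_decay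
          weighted_seminorm_decay)
    then have "(\<Sum>\<^sub>\<infinity>\<kappa>. norm (c \<kappa>)) * (\<integral>x. norm (f x) \<partial>lborel) \<le>
        (\<Sum>\<^sub>\<infinity>\<kappa>. norm (c \<kappa>)) * (weighted_seminorm ?m ?m f * (\<integral>x. decay x \<partial>(lborel :: (real^'n) measure)))"
      by (intro mult_left_mono infsum_nonneg) auto
    then show ?thesis using character_sum_bound[OF c f, of \<zeta>] by (simp add: mult_ac)
  qed
  then show ?thesis
    using character_sum_linear[OF c] unfolding tempered_distributions_def by blast
qed

section \<open>The Fourier series of a periodic distribution\<close>

text \<open>The chain rule for a linear map expresses derivatives by those of the same order. So convergence of test
  functions survives the substitution that turns the lattice into the integers.\<close>

lemma partial_derivs_compose_linear_bound:
  fixes M :: "real^'m::finite \<Rightarrow> real^'n::finite"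
  assumes M: "linear M"
  shows "\<exists>C\<ge>0. \<forall>f x. smooth_fun f \<longrightarrow>
    norm (partial_derivs is (\<lambda>x. f (M x)) x) \<le> C * (\<Sum>js | length js \<le> length is. norm (partial_derivs js f (M x)))"
proof (induction "is" rule: rev_induct)
  case Nil
  have "norm (f (M x)) \<le> 1 * (\<Sum>js :: 'n list | length js \<le> 0. norm (partial_derivs js f (M x)))"
    for f :: "real^'n \<Rightarrow> complex" and x by simp
  then show ?case by (intro exI[of _ 1]) auto
next
  case (snoc i "is")
  then obtain C where C: "C \<ge> 0" "\<And>f x. smooth_fun f \<Longrightarrow>
      norm (partial_derivs is (\<lambda>x. f (M x)) x) \<le> C * (\<Sum>js | length js \<le> length is. norm (partial_derivs js f (M x)))"
    by blast
  define A where "A = (\<Sum>j\<in>UNIV. \<bar>M (axis i 1) $ j\<bar>)"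
  have "norm (partial_derivs (is @ [i]) (\<lambda>x. f (M x)) x) \<le>
      (A * C) * (\<Sum>js | length js \<le> length (is @ [i]). norm (partial_derivs js f (M x)))"
    if f: "smooth_fun f" for f :: "real^'n \<Rightarrow> complex" and x
  proof -
    let ?S = "\<Sum>js | length js \<le> length (is @ [i]). norm (partial_derivs js f (M x))"
    have pd: "partial_deriv i (\<lambda>x. f (M x)) = (\<lambda>x. \<Sum>j\<in>UNIV. complex_of_real (M (axis i 1) $ j) * partial_deriv j f (M x))"
    proof
      fix x
      show "partial_deriv i (\<lambda>x. f (M x)) x = (\<Sum>j\<in>UNIV. complex_of_real (M (axis i 1) $ j) * partial_deriv j f (M x))"
        using partial_deriv_compose_affine[OF M smooth_differentiable[OF f], of i 0 x]
        by (simp add: scaleR_conv_of_real[where 'a = complex])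
    qed
    have sm: "smooth_fun (\<lambda>x. partial_deriv j f (M x))" for j
      by (rule smooth_compose_linear[OF smooth_partial_deriv[OF f] M])
    have "partial_derivs (is @ [i]) (\<lambda>x. f (M x)) x =
        (\<Sum>j\<in>UNIV. complex_of_real (M (axis i 1) $ j) * partial_derivs is (\<lambda>x. partial_deriv j f (M x)) x)"
      unfolding partial_derivs_snoc pd
      by (simp add: partial_derivs_sum smooth_cmult sm partial_derivs_cmult)
    also have "norm \<dots> \<le> (\<Sum>j\<in>UNIV. \<bar>M (axis i 1) $ j\<bar> * (C * ?S))"
    proof (rule sum_norm_le)
      fix j
      have "(\<Sum>js | length js \<le> length is. norm (partial_derivs js (partial_deriv j f) (M x))) =
          (\<Sum>js\<in>(\<lambda>js. js @ [j]) ` {js. length js \<le> length is}. norm (partial_derivs js f (M x)))"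
        by (subst sum.reindex) (auto simp: inj_on_def partial_derivs_snoc)
      also have "\<dots> \<le> ?S"
        by (rule sum_mono2) (auto intro: finite_short_lists)
      finally have "C * (\<Sum>js | length js \<le> length is. norm (partial_derivs js (partial_deriv j f) (M x))) \<le> C * ?S"
        using C(1) by (rule mult_left_mono)
      with C(2)[OF smooth_partial_deriv[OF f, of j], of x]
      have "norm (partial_derivs is (\<lambda>x. partial_deriv j f (M x)) x) \<le> C * ?S" by linarith
      then show "norm (complex_of_real (M (axis i 1) $ j) * partial_derivs is (\<lambda>x. partial_deriv j f (M x)) x) \<le>
          \<bar>M (axis i 1) $ j\<bar> * (C * ?S)"
        by (simp add: norm_mult mult_left_mono)
    qed
    also have "\<dots> = (A * C) * ?S" by (simp add: A_def sum_distrib_right mult.assoc)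
    finally show ?thesis .
  qed
  moreover have "0 \<le> A * C" unfolding A_def using C(1) by (intro mult_nonneg_nonneg sum_nonneg) auto
  ultimately show ?case by blast
qed

lemma small_factor:
  fixes a b e :: real
  assumes "a \<ge> 0" "b \<ge> 0" "e > 0"
  obtains d where "d > 0" "a * (b * d) < e"
proof
  have pos: "a * b + 1 > 0" using assms by (simp add: add_nonneg_pos)
  then show "e / (a * b + 1) > 0" using assms(3) by simp
  have "a * (b * (e / (a * b + 1))) = e * (a * b) / (a * b + 1)" by simp
  also have "\<dots> < e" using pos assms(3) by (simp add: divide_less_eq)
  finally show "a * (b * (e / (a * b + 1))) < e" .
qed

lemma uniform_limit_compose_linear:
  fixes M :: "real^'m::finite \<Rightarrow> real^'n::finite"
  assumes M: "linear M" and h: "\<And>K::nat. smooth_fun (h K)"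
    and lim: "\<And>js. uniform_limit UNIV (\<lambda>K. partial_derivs js (h K)) (\<lambda>x. 0) sequentially"
  shows "uniform_limit UNIV (\<lambda>K. partial_derivs is (\<lambda>x. h K (M x))) (\<lambda>x. 0) sequentially"
proof -
  let ?J = "{js :: 'n list. length js \<le> length is}"
  obtain C where C: "C \<ge> 0" "\<And>f x. smooth_fun f \<Longrightarrow>
      norm (partial_derivs is (\<lambda>x. f (M x)) x) \<le> C * (\<Sum>js\<in>?J. norm (partial_derivs js f (M x)))"
    using partial_derivs_compose_linear_bound[OF M] by blast
  show ?thesis
    unfolding uniform_limit_iff
  proof (intro allI impI)
    fix e :: real assume e: "e > 0"
    obtain d where d: "d > 0" "C * (real (card ?J) * d) < e"
      using small_factor[OF C(1) _ e, of "real (card ?J)"] by auto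
    have "eventually (\<lambda>K. \<forall>js\<in>?J. \<forall>x\<in>UNIV. dist (partial_derivs js (h K) x) 0 < d) sequentially"
      using lim d(1) unfolding uniform_limit_iff by (intro eventually_ball_finite finite_short_lists) auto
    then show "\<forall>\<^sub>F K in sequentially. \<forall>x\<in>UNIV. dist (partial_derivs is (\<lambda>x. h K (M x)) x) 0 < e"
    proof eventually_elim
      case (elim K)
      have "norm (partial_derivs is (\<lambda>x. h K (M x)) x) < e" for x
      proof -
        have "norm (partial_derivs is (\<lambda>x. h K (M x)) x) \<le> C * (\<Sum>js\<in>?J. norm (partial_derivs js (h K) (M x)))"
          by (rule C(2)[OF h])
        also have "\<dots> \<le> C * (\<Sum>js\<in>?J. d)"
          using elim C(1) by (intro mult_left_mono sum_mono) (auto simp: less_imp_le)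
        also have "\<dots> < e" using d(2) by simp
        finally show ?thesis .
      qed
      then show ?case by simp
    qed
  qed
qed

lemma distribution_sequentially_continuous:
  fixes p :: "'n::finite functional"
  assumes p: "p \<in> distributions" and h: "\<And>K::nat. h K \<in> test_functions"
    and supp: "\<And>K x. R < norm x \<Longrightarrow> h K x = 0"
    and lim: "\<And>js. uniform_limit UNIV (\<lambda>K. partial_derivs js (h K)) (\<lambda>x. 0) sequentially"
  shows "(\<lambda>K. p (h K)) \<longlonglongrightarrow> 0"
proof -
  have "\<forall>S. compact S \<longrightarrow> (\<exists>B m. \<forall>f\<in>test_functions. {x. f x \<noteq> 0} \<subseteq> S \<longrightarrow> norm (p f) \<le> B * weighted_seminorm 0 m f)"
    using p by (simp add: distributions_def)
  from this[rule_format, OF compact_cball[of 0 R]]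
  obtain B m where B: "\<And>f. f \<in> test_functions \<Longrightarrow> {x. f x \<noteq> 0} \<subseteq> cball 0 R \<Longrightarrow>
      norm (p f) \<le> B * weighted_seminorm 0 m f"
    by blast
  let ?J = "{js :: 'n list. length js \<le> m}"
  show ?thesis
  proof (rule tendstoI)
    fix e :: real assume e: "e > 0"
    obtain d where d: "d > 0" "\<bar>B\<bar> * (real (card ?J) * d) < e"
      using small_factor[of "\<bar>B\<bar>" "real (card ?J)" e] e by auto
    have "eventually (\<lambda>K. \<forall>js\<in>?J. \<forall>x\<in>UNIV. dist (partial_derivs js (h K) x) 0 < d) sequentially"
      using lim d(1) unfolding uniform_limit_iff by (intro eventually_ball_finite finite_short_lists) auto
    then show "\<forall>\<^sub>F K in sequentially. dist (p (h K)) 0 < e"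
    proof eventually_elim
      case (elim K)
      let ?W = "weighted_seminorm 0 m (h K)"
      have W: "?W \<le> card ?J * d"
        by (rule weighted_seminorm_least) (use elim in \<open>auto simp: less_imp_le\<close>)
      have W0: "0 \<le> ?W"
        using h[of K] test_functions_subset_schwartz by (intro weighted_seminorm_nonneg) blast
      have "norm (p (h K)) \<le> B * ?W"
      proof (rule B[OF h])
        show "{x. h K x \<noteq> 0} \<subseteq> cball 0 R" using supp[of _ K] by (fastforce simp: not_less)
      qed
      also have "\<dots> \<le> \<bar>B\<bar> * ?W" using W0 by (intro mult_right_mono) auto
      also have "\<dots> \<le> \<bar>B\<bar> * (card ?J * d)" using W by (intro mult_left_mono) auto
      also have "\<dots> < e" by (rule d(2))
      finally show ?case by simp
    qed
  qed
qed

lemma character_sum_sequentially_continuous: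
  fixes \<zeta> :: "'i \<Rightarrow> real^'n::finite"
  assumes c: "(\<lambda>\<kappa>. norm (c \<kappa>)) summable_on UNIV" and h: "\<And>K::nat. h K \<in> test_functions"
    and supp: "\<And>K x. R < norm x \<Longrightarrow> h K x = 0"
    and lim: "uniform_limit UNIV h (\<lambda>x. 0) sequentially"
  shows "(\<lambda>K. character_sum c \<zeta> (h K)) \<longlonglongrightarrow> 0"
proof (rule tendstoI)
  let ?s = "\<Sum>\<^sub>\<infinity>\<kappa>. norm (c \<kappa>)"
  let ?v = "measure lborel (cball (0::real^'n) R)"
  fix e :: real assume e: "e > 0"
  have s: "?s \<ge> 0" by (rule infsum_nonneg) auto
  obtain d where d: "d > 0" "?s * (?v * d) < e"
    using small_factor[OF s _ e, of ?v] by auto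
  have "eventually (\<lambda>K. \<forall>x\<in>UNIV. dist (h K x) 0 < d) sequentially"
    using lim d(1) unfolding uniform_limit_iff by blast
  then show "\<forall>\<^sub>F K in sequentially. dist (character_sum c \<zeta> (h K)) 0 < e"
  proof eventually_elim
    case (elim K)
    have hS: "h K \<in> schwartz_functions" using h test_functions_subset_schwartz by blast
    have ind: "integrable lborel (indicator (cball (0::real^'n) R) :: real^'n \<Rightarrow> real)"
      by (rule integrable_real_indicator) (use emeasure_bounded_finite[of "cball (0::real^'n) R"] in auto)
    have "(\<integral>x. norm (h K x) \<partial>lborel) \<le> (\<integral>x. d * indicator (cball 0 R) x \<partial>(lborel :: (real^'n) measure))"
    proof (rule integral_mono[OF integrable_norm[OF schwartz_integrable[OF hS]]])
      show "integrable lborel (\<lambda>x::real^'n. d * indicator (cball 0 R) x)" by (intro integrable_mult_right ind)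
      fix x
      show "norm (h K x) \<le> d * indicator (cball 0 R) x"
        using elim supp[of x K] by (cases "norm x \<le> R") (auto simp: less_imp_le)
    qed
    also have "\<dots> = d * ?v" by simp
    finally have "norm (character_sum c \<zeta> (h K)) \<le> ?s * (d * ?v)"
      using character_sum_bound[OF c hS, of \<zeta>] s by (meson mult_left_mono order_trans)
    also have "\<dots> < e" using d(2) by (simp add: mult.commute)
    finally show ?case by simp
  qed
qed

lemma inv_fourier_translate:
  assumes "f \<in> schwartz_functions"
  shows "inv_fourier (\<lambda>x. f (x + a)) y = character y (- a) * inv_fourier f y"
proof -
  have [measurable]: "f \<in> borel_measurable borel" by (rule schwartz_measurable[OF assms])
  have "(\<lambda>x. character y (x - a) * f x) \<in> borel_measurable borel" by measurable
  from integral_translate[OF this, of a]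
  have "inv_fourier (\<lambda>x. f (x + a)) y = (\<integral>x. character y (x - a) * f x \<partial>lborel)"
    by (simp add: inv_fourier_def)
  also have "\<dots> = (\<integral>x. character y (- a) * (character y x * f x) \<partial>lborel)"
    using character_add[of y _ "- a"] by (simp add: mult_ac)
  finally show ?thesis by (simp add: inv_fourier_def)
qed

lemma dual_lattice_inner:
  fixes L :: "real^'n^'n"
  assumes "invertible L"
  shows "(transpose (matrix_inv L) *v z) \<bullet> (L *v y) = z \<bullet> y"
  by (simp add: dot_lmul_matrix matrix_vector_mul_assoc matrix_inv_inverse(2)[OF assms])

text \<open>The substitution \<open>x \<mapsto> L x\<close> reduces to integer periods. There the difference of the two sides is invariant under
  translations, continuous along convergent sequences of test functions, and has vanishing Fourier coefficients by the
  orthogonality of the characters.\<close>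

theorem periodic_distribution_eq_character_sum:
  fixes L :: "real^'n::finite^'n" and p :: "'n functional"
  assumes L: "invertible L" and p: "p \<in> periodic_distributions L"
    and c: "(\<lambda>\<kappa>. norm (fourier_coeff L p \<kappa>)) summable_on UNIV"
    and f: "f \<in> test_functions"
  shows "p f = character_sum (fourier_coeff L p) (\<lambda>\<kappa>. transpose (matrix_inv L) *v of_int_vec \<kappa>) f"
proof -
  define c where "c = fourier_coeff L p"
  define \<zeta> where "\<zeta> = (\<lambda>\<kappa>. transpose (matrix_inv L) *v of_int_vec \<kappa>)"
  define w where "w = character_sum c \<zeta>"
  define M where "M x = matrix_inv L *v x" for x
  define \<phi> where "\<phi> = (SOME \<phi>. periodic_partition (\<phi> :: real^'n \<Rightarrow> complex))"
  have \<phi>: "periodic_partition \<phi>"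
    unfolding \<phi>_def by (rule someI[of periodic_partition, OF periodic_partition_exists])
  have cs: "(\<lambda>\<kappa>. norm (c \<kappa>)) summable_on UNIV" using assms(3) by (simp add: c_def)
  have linM: "linear M" and linL: "linear (\<lambda>x. L *v x)"
    by (simp_all add: M_def[abs_def] matrix_vector_mul_linear)
  have L_M: "L *v M x = x" and M_L: "M (L *v x) = x" for x
    using matrix_inv_inverse[OF L] by (simp_all add: M_def matrix_vector_mul_assoc)
  have Madd: "M (x + L *v y) = M x + y" for x y
    using linear_add[OF linM] by (simp add: M_L)
  have det: "det L \<noteq> 0" using L by (simp add: invertible_det_nz)
  have pd: "p \<in> distributions" and per: "\<And>\<kappa>. dist_translate (L *v of_int_vec \<kappa>) p = p"
    using p by (auto simp: periodic_distributions_def)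
  have p_add: "p (\<lambda>x. f x + g x) = p f + p g" if "f \<in> test_functions" "g \<in> test_functions" for f g
    using pd that unfolding distributions_def linear_functional_on_def by blast
  have p_scale: "p (\<lambda>x. a * f x) = a * p f" if "f \<in> test_functions" for a f
    using pd that unfolding distributions_def linear_functional_on_def by blast
  have w_add: "w (\<lambda>x. f x + g x) = w f + w g" if "f \<in> test_functions" "g \<in> test_functions" for f g
    using character_sum_linear[OF cs, of \<zeta>] that test_functions_subset_schwartz
    unfolding w_def linear_functional_on_def by blast
  have w_scale: "w (\<lambda>x. a * f x) = a * w f" if "f \<in> test_functions" for a f
    using character_sum_linear[OF cs, of \<zeta>] that test_functions_subset_schwartz
    unfolding w_def linear_functional_on_def by blast
  have tM: "(\<lambda>x. g (M x)) \<in> test_functions" if "g \<in> test_functions" for g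
    by (rule test_function_compose_linear[OF that linM linL L_M])
  define D where "D g = p (\<lambda>x. g (M x)) - w (\<lambda>x. g (M x))" for g
  have zeta: "character (\<zeta> \<kappa>) (L *v y) = int_character \<kappa> y" for \<kappa> y
    by (simp only: \<zeta>_def character_def int_character_def dual_lattice_inner[OF L])
  have D0: "D g = 0" if "g \<in> test_functions" for g
  proof (rule periodic_functional_eq_zero[of D, OF _ _ _ _ \<phi> _ that])
    fix f g :: "real^'n \<Rightarrow> complex" assume "f \<in> test_functions" "g \<in> test_functions"
    then show "D (\<lambda>x. f x + g x) = D f + D g"
      using p_add[OF tM tM] w_add[OF tM tM] by (simp add: D_def)
  next
    fix a and f :: "real^'n \<Rightarrow> complex" assume "f \<in> test_functions"
    then show "D (\<lambda>x. a * f x) = a * D f"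
      using p_scale[OF tM] w_scale[OF tM] by (simp add: D_def right_diff_distrib)
  next
    fix f :: "real^'n \<Rightarrow> complex" and \<mu> :: "int^'n" assume f: "f \<in> test_functions"
    let ?a = "L *v of_int_vec \<mu>"
    have "p (\<lambda>x. f (M x + of_int_vec \<mu>)) = dist_translate ?a p (\<lambda>x. f (M x))"
      by (simp add: dist_translate_def Madd)
    then have 1: "p (\<lambda>x. f (M x + of_int_vec \<mu>)) = p (\<lambda>x. f (M x))" by (simp add: per)
    have S: "(\<lambda>x. f (M x)) \<in> schwartz_functions" using tM[OF f] test_functions_subset_schwartz by blast
    have "inv_fourier (\<lambda>x. f (M (x + ?a))) (\<zeta> \<kappa>) = inv_fourier (\<lambda>x. f (M x)) (\<zeta> \<kappa>)" for \<kappa>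
    proof -
      have "character (\<zeta> \<kappa>) (- ?a) = 1"
        using zeta[of \<kappa> "of_int_vec (- \<mu>)"] by (simp add: of_int_vec_minus int_character_def
            vec.neg character_of_int_vec[of \<kappa> "- \<mu>", unfolded of_int_vec_minus])
      then show ?thesis by (simp add: inv_fourier_translate[OF S])
    qed
    then have "w (\<lambda>x. f (M (x + ?a))) = w (\<lambda>x. f (M x))"
      using S schwartz_translate[OF S, of ?a] by (simp add: w_def character_sum_def)
    with 1 show "D (\<lambda>x. f (x + of_int_vec \<mu>)) = D f" by (simp add: D_def Madd)
  next
    fix h :: "nat \<Rightarrow> real^'n \<Rightarrow> complex" and R
    assume h: "\<And>K. h K \<in> test_functions" "\<And>K x. R < norm x \<Longrightarrow> h K x = 0"
      and lim: "\<And>is. uniform_limit UNIV (\<lambda>K. partial_derivs is (h K)) (\<lambda>x. 0) sequentially"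
    obtain B where B: "B > 0" "\<And>x. norm (L *v x) \<le> B * norm x"
      using linear_bounded_pos[OF linL] by blast
    have supp: "h K (M x) = 0" if "B * R < norm x" for K x
    proof -
      have "B * R < B * norm (M x)" using that B(2)[of "M x"] by (simp add: L_M)
      then show ?thesis using B(1) h(2) by simp
    qed
    have lim': "uniform_limit UNIV (\<lambda>K. partial_derivs js (\<lambda>x. h K (M x))) (\<lambda>x. 0) sequentially" for js
      by (rule uniform_limit_compose_linear[OF linM test_function_smooth[OF h(1)] lim])
    have "(\<lambda>K. p (\<lambda>x. h K (M x))) \<longlonglongrightarrow> 0"
      by (rule distribution_sequentially_continuous[OF pd tM[OF h(1)] supp lim'])
    moreover have "(\<lambda>K. w (\<lambda>x. h K (M x))) \<longlonglongrightarrow> 0"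
      unfolding w_def
      by (rule character_sum_sequentially_continuous[OF cs tM[OF h(1)] supp]) (use lim'[of "[]"] in simp_all)
    ultimately show "(\<lambda>K. D (h K)) \<longlonglongrightarrow> 0"
      unfolding D_def using tendsto_diff by fastforce
  next
    fix \<kappa> :: "int^'n"
    define g where "g x = \<phi> x * int_character \<kappa> x" for x
    have g: "g \<in> test_functions"
      unfolding g_def[abs_def] using \<phi>
      by (intro test_function_mult) (auto simp: periodic_partition_def int_character_def smooth_character)
    have gS: "(\<lambda>x. g (M x)) \<in> schwartz_functions" using tM[OF g] test_functions_subset_schwartz by blast
    \<comment> \<open>The pairing is bilinear, so testing against the character with index \<open>\<kappa>\<close> gives the coefficient with index \<open>- \<kappa>\<close>.\<close>
    have "c (- \<kappa>) = p (\<lambda>x. g (M x)) / complex_of_real \<bar>det L\<bar>"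
      unfolding c_def fourier_coeff_def \<phi>_def[symmetric] dist_compose_def Let_def
      by (simp add: g_def M_def int_character_def character_def of_int_vec_minus inner_commute)
    then have 1: "p (\<lambda>x. g (M x)) = complex_of_real \<bar>det L\<bar> * c (- \<kappa>)"
      using det by (simp add: field_simps)
    have inv: "inv_fourier (\<lambda>x. g (M x)) (\<zeta> \<mu>) = (if \<mu> = - \<kappa> then complex_of_real \<bar>det L\<bar> else 0)" for \<mu>
    proof -
      have [measurable]: "(\<lambda>x. g (M x)) \<in> borel_measurable borel" by (rule schwartz_measurable[OF gS])
      have dm: "det (matrix (\<lambda>x. L *v x)) = det L" by (simp add: matrix_of_matrix_vector_mul)
      have "(\<lambda>x. character (\<zeta> \<mu>) x * g (M x)) \<in> borel_measurable borel" by measurable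
      from integral_linear[OF linL _ this]
      have "inv_fourier (\<lambda>x. g (M x)) (\<zeta> \<mu>) =
          \<bar>det L\<bar> * (\<integral>x. int_character \<mu> x * (\<phi> x * int_character \<kappa> x) \<partial>lborel)"
        using det by (simp add: inv_fourier_def dm zeta M_L g_def)
      also have "(\<integral>x. int_character \<mu> x * (\<phi> x * int_character \<kappa> x) \<partial>lborel) = (\<integral>x. \<phi> x * int_character (\<mu> + \<kappa>) x \<partial>lborel)"
        by (simp add: mult.left_commute[of "int_character \<mu> _"] int_character_mult)
      also have "\<dots> = (if \<mu> = - \<kappa> then 1 else 0)"
        by (simp add: integral_partition_character[OF \<phi>] eq_neg_iff_add_eq_0)
      finally show ?thesis by simp
    qed
    have "w (\<lambda>x. g (M x)) = (\<Sum>\<^sub>\<infinity>\<mu>. c \<mu> * (if \<mu> = - \<kappa> then complex_of_real \<bar>det L\<bar> else 0))"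
      using gS by (simp add: w_def character_sum_def inv)
    also have "\<dots> = (\<Sum>\<^sub>\<infinity>\<mu>\<in>{- \<kappa>}. c \<mu> * (if \<mu> = - \<kappa> then complex_of_real \<bar>det L\<bar> else 0))"
      by (rule infsum_cong_neutral) auto
    also have "\<dots> = c (- \<kappa>) * complex_of_real \<bar>det L\<bar>" by simp
    finally show "D (\<lambda>x. \<phi> x * int_character \<kappa> x) = 0"
      using 1 by (simp add: D_def g_def)
  qed
  have "(\<lambda>x. f (L *v x)) \<in> test_functions"
    by (rule test_function_compose_linear[OF f linL linM M_L])
  from D0[OF this] show ?thesis by (simp add: D_def L_M w_def c_def \<zeta>_def)
qed

corollary tempered_extension_periodic:
  fixes L :: "real^'n::finite^'n"
  assumes "invertible L" "p \<in> periodic_distributions L"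
    and "(\<lambda>\<kappa>. norm (fourier_coeff L p \<kappa>)) summable_on UNIV"
  shows "tempered_extension p = character_sum (fourier_coeff L p) (\<lambda>\<kappa>. transpose (matrix_inv L) *v of_int_vec \<kappa>)"
  by (rule tempered_extension_eqI[OF character_sum_tempered[OF assms(3)]])
     (rule periodic_distribution_eq_character_sum[OF assms, symmetric])

section \<open>Operators on Banach spaces of distributions\<close>

lemma
  assumes "banach_space_on X N"
  shows banach_zero: "(\<lambda>f. 0) \<in> X"
    and banach_add: "\<And>u w. u \<in> X \<Longrightarrow> w \<in> X \<Longrightarrow> (\<lambda>f. u f + w f) \<in> X"
    and banach_scale: "\<And>a u. u \<in> X \<Longrightarrow> (\<lambda>f. a * u f) \<in> X"
    and banach_nonneg: "\<And>u. u \<in> X \<Longrightarrow> 0 \<le> N u"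
    and banach_norm_zero: "\<And>u. u \<in> X \<Longrightarrow> N u = 0 \<longleftrightarrow> u = (\<lambda>f. 0)"
    and banach_triangle: "\<And>u w. u \<in> X \<Longrightarrow> w \<in> X \<Longrightarrow> N (\<lambda>f. u f + w f) \<le> N u + N w"
    and banach_norm_scale: "\<And>a u. u \<in> X \<Longrightarrow> N (\<lambda>f. a * u f) = norm a * N u"
  using assms unfolding banach_space_on_def by blast+

lemma banach_complete:
  assumes "banach_space_on X N" "\<And>n::nat. \<sigma> n \<in> X"
    and "\<And>e. e > 0 \<Longrightarrow> \<exists>M. \<forall>m\<ge>M. \<forall>n\<ge>M. N (\<lambda>f. \<sigma> m f - \<sigma> n f) < e"
  obtains u where "u \<in> X" "(\<lambda>n. N (\<lambda>f. \<sigma> n f - u f)) \<longlonglongrightarrow> 0"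
proof -
  have "\<forall>\<sigma>. (\<forall>n. \<sigma> n \<in> X) \<and> (\<forall>e>0. \<exists>M::nat. \<forall>m\<ge>M. \<forall>n\<ge>M. N (\<lambda>f. \<sigma> m f - \<sigma> n f) < e) \<longrightarrow>
      (\<exists>u\<in>X. (\<lambda>n. N (\<lambda>f. \<sigma> n f - u f)) \<longlonglongrightarrow> 0)"
    using assms(1) by (simp add: banach_space_on_def)
  from this[rule_format, of \<sigma>] show ?thesis using assms(2,3) that by blast
qed

lemma banach_diff:
  assumes "banach_space_on X N" "u \<in> X" "w \<in> X" shows "(\<lambda>f. u f - w f) \<in> X"
  using banach_add[OF assms(1,2) banach_scale[OF assms(1,3), of "-1"]] by simp

lemma banach_norm_minus:
  assumes "banach_space_on X N" "u \<in> X" "w \<in> X" shows "N (\<lambda>f. u f - w f) = N (\<lambda>f. w f - u f)"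
  using banach_norm_scale[OF assms(1) banach_diff[OF assms(1,3,2)], of "-1"] by simp

lemma banach_triangle_diff:
  assumes "banach_space_on X N" "u \<in> X" "w \<in> X" "x \<in> X"
  shows "N (\<lambda>f. u f - x f) \<le> N (\<lambda>f. u f - w f) + N (\<lambda>f. w f - x f)"
  using banach_triangle[OF assms(1) banach_diff[OF assms(1,2,3)] banach_diff[OF assms(1,3,4)]] by simp

lemma banach_sum:
  assumes X: "banach_space_on X N" and "finite F" "\<And>i. i \<in> F \<Longrightarrow> a i \<in> X"
  shows "(\<lambda>f. \<Sum>i\<in>F. a i f) \<in> X \<and> N (\<lambda>f. \<Sum>i\<in>F. a i f) \<le> (\<Sum>i\<in>F. N (a i))"
  using assms(2,3)
proof (induction F rule: finite_induct)
  case empty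
  then show ?case using banach_zero[OF X] banach_norm_zero[OF X banach_zero[OF X]] by simp
next
  case (insert i F)
  then have "(\<lambda>f. \<Sum>i\<in>F. a i f) \<in> X" "N (\<lambda>f. \<Sum>i\<in>F. a i f) \<le> (\<Sum>i\<in>F. N (a i))" "a i \<in> X" by auto
  then show ?case
    using insert banach_add[OF X, of "a i" "\<lambda>f. \<Sum>i\<in>F. a i f"] banach_triangle[OF X, of "a i" "\<lambda>f. \<Sum>i\<in>F. a i f"]
    by simp
qed

text \<open>The form in which completeness is applied to series: \<open>t\<close> is the sequence of partial sums of a summable majorant.\<close>

lemma banach_convergent:
  assumes X: "banach_space_on X N" and s: "\<And>n::nat. \<sigma> n \<in> X"
    and le: "\<And>m n. n \<le> m \<Longrightarrow> N (\<lambda>f. \<sigma> m f - \<sigma> n f) \<le> t m - t n" and t: "convergent t"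
  obtains u where "u \<in> X" "(\<lambda>n. N (\<lambda>f. \<sigma> n f - u f)) \<longlonglongrightarrow> 0"
proof (rule banach_complete[OF X, of \<sigma>])
  fix e :: real assume "e > 0"
  moreover have "Cauchy t" using t by (rule convergent_Cauchy)
  ultimately obtain M where M: "\<And>m n. m \<ge> M \<Longrightarrow> n \<ge> M \<Longrightarrow> norm (t m - t n) < e"
    by (meson CauchyD)
  have "N (\<lambda>f. \<sigma> m f - \<sigma> n f) < e" if "m \<ge> M" "n \<ge> M" for m n
  proof (cases "n \<le> m")
    case True
    then show ?thesis using le[OF True] M[OF that] by simp
  next
    case False
    then have "N (\<lambda>f. \<sigma> n f - \<sigma> m f) \<le> t n - t m" by (intro le) simp
    then show ?thesis using M[OF that] banach_norm_minus[OF X s s, of m n] by simp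
  qed
  then show "\<exists>M. \<forall>m\<ge>M. \<forall>n\<ge>M. N (\<lambda>f. \<sigma> m f - \<sigma> n f) < e" by blast
qed (use s that in auto)

text \<open>The sum is formed pointwise. It coincides with the limit in norm because evaluation at a Schwartz
  function is continuous on \<open>X\<close>.\<close>

lemma banach_absolutely_convergent_sum:
  fixes a :: "'i::countable \<Rightarrow> 'n::finite functional"
  assumes X: "banach_space_on X N" and temp: "X \<subseteq> tempered_distributions"
    and ev: "\<And>f. f \<in> schwartz_functions \<Longrightarrow> \<exists>B. \<forall>u\<in>X. norm (u f) \<le> B * N u"
    and a: "\<And>i. a i \<in> X" and le: "\<And>i. N (a i) \<le> b i" and b: "b summable_on UNIV"
  shows "(\<lambda>i. a i f) summable_on UNIV"
    and "(\<lambda>f. \<Sum>\<^sub>\<infinity>i. a i f) \<in> X"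
    and "N (\<lambda>f. \<Sum>\<^sub>\<infinity>i. a i f) \<le> (\<Sum>\<^sub>\<infinity>i. b i)"
proof -
  define F where "F n = {i :: 'i. to_nat i < n}" for n
  have finF: "finite (F n)" for n
    using finite_vimageI[of "{..<n}" "to_nat :: 'i \<Rightarrow> nat"] by (simp add: F_def vimage_def)
  have F_lim: "filterlim F (finite_subsets_at_top UNIV) sequentially"
    unfolding filterlim_finite_subsets_at_top
  proof (intro allI impI)
    fix S :: "'i set" assume "finite S \<and> S \<subseteq> UNIV"
    then have "finite (to_nat ` S)" by simp
    then obtain n where n: "\<And>i. i \<in> S \<Longrightarrow> to_nat i < n"
      using finite_nat_bounded[of "to_nat ` S"] by blast
    show "\<forall>\<^sub>F y in sequentially. finite (F y) \<and> S \<subseteq> F y \<and> F y \<subseteq> UNIV"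
      using eventually_ge_at_top[of n]
      by eventually_elim (use n finF in \<open>force simp: F_def\<close>)
  qed
  have lim: "(\<lambda>n. sum h (F n)) \<longlonglongrightarrow> infsum h UNIV" if "h summable_on UNIV" for h :: "'i \<Rightarrow> 'c::banach"
    using has_sum_infsum[OF that] unfolding has_sum_def by (rule filterlim_compose) (rule F_lim)
  have N0: "0 \<le> N (a i)" for i by (rule banach_nonneg[OF X a])
  have out: "u f = 0" if "u \<in> X" "f \<notin> schwartz_functions" for u f
    using that temp unfolding tempered_distributions_def linear_functional_on_def by blast
  show sm: "(\<lambda>i. a i f) summable_on UNIV" for f
  proof (cases "f \<in> schwartz_functions")
    case True
    then obtain B where B: "\<And>u. u \<in> X \<Longrightarrow> norm (u f) \<le> B * N u" using ev by blast
    have bound: "norm (a i f) \<le> \<bar>B\<bar> * b i" for i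
    proof -
      have "norm (a i f) \<le> B * N (a i)" by (rule B[OF a])
      also have "\<dots> \<le> \<bar>B\<bar> * N (a i)" using N0 by (intro mult_right_mono) auto
      also have "\<dots> \<le> \<bar>B\<bar> * b i" using le by (intro mult_left_mono) auto
      finally show ?thesis .
    qed
    have "(\<lambda>i. \<bar>B\<bar> * b i) summable_on UNIV" by (rule summable_on_cmult_right[OF b])
    then have "(\<lambda>i. norm (a i f)) summable_on UNIV"
      by (rule summable_on_comparison_test) (use bound in auto)
    then show ?thesis by (rule abs_summable_summable)
  next
    case False
    then show ?thesis by (simp add: out[OF a])
  qed
  define \<sigma> where "\<sigma> n = (\<lambda>f. \<Sum>i\<in>F n. a i f)" for n
  have sum_X: "(\<lambda>f. \<Sum>i\<in>S. a i f) \<in> X" "N (\<lambda>f. \<Sum>i\<in>S. a i f) \<le> sum b S" if "finite S" for S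
    using banach_sum[OF X that, of a] a sum_mono[of S "\<lambda>i. N (a i)" b] le by (auto intro: order_trans)
  have sX: "\<sigma> n \<in> X" and sN: "N (\<sigma> n) \<le> sum b (F n)" for n
    unfolding \<sigma>_def by (rule sum_X[OF finF])+
  obtain u where u: "u \<in> X" "(\<lambda>n. N (\<lambda>f. \<sigma> n f - u f)) \<longlonglongrightarrow> 0"
  proof (rule banach_convergent[OF X sX])
    show "convergent (\<lambda>n. sum b (F n))" using lim[OF b] by (auto simp: convergent_def)
    fix m n :: nat assume "n \<le> m"
    then have sub: "F n \<subseteq> F m" by (auto simp: F_def)
    have "(\<lambda>f. \<sigma> m f - \<sigma> n f) = (\<lambda>f. \<Sum>i\<in>F m - F n. a i f)"
      unfolding \<sigma>_def by (intro ext sum_diff[OF finF sub, symmetric])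
    then have "N (\<lambda>f. \<sigma> m f - \<sigma> n f) \<le> (\<Sum>i\<in>F m - F n. b i)"
      using sum_X(2)[of "F m - F n"] finF by simp
    also have "\<dots> = sum b (F m) - sum b (F n)" by (rule sum_diff[OF finF sub])
    finally show "N (\<lambda>f. \<sigma> m f - \<sigma> n f) \<le> sum b (F m) - sum b (F n)" .
  qed
  have eq: "u f = (\<Sum>\<^sub>\<infinity>i. a i f)" for f
  proof (cases "f \<in> schwartz_functions")
    case True
    then obtain B where B: "\<And>u. u \<in> X \<Longrightarrow> norm (u f) \<le> B * N u" using ev by blast
    have "(\<lambda>n. \<sigma> n f - u f) \<longlonglongrightarrow> 0"
    proof (rule Lim_null_comparison)
      show "\<forall>\<^sub>F n in sequentially. norm (\<sigma> n f - u f) \<le> B * N (\<lambda>f. \<sigma> n f - u f)"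
        using B[OF banach_diff[OF X sX u(1)]] by simp
      show "(\<lambda>n. B * N (\<lambda>f. \<sigma> n f - u f)) \<longlonglongrightarrow> 0"
        using tendsto_mult_right_zero[OF u(2)] .
    qed
    then have "(\<lambda>n. \<sigma> n f) \<longlonglongrightarrow> u f" by (simp add: LIM_zero_iff)
    moreover have "(\<lambda>n. \<sigma> n f) \<longlonglongrightarrow> (\<Sum>\<^sub>\<infinity>i. a i f)"
      using lim[OF sm[of f]] by (simp add: \<sigma>_def)
    ultimately show ?thesis by (rule LIMSEQ_unique)
  next
    case False
    then show ?thesis by (simp add: out[OF a] out[OF u(1)])
  qed
  then have u_eq: "u = (\<lambda>f. \<Sum>\<^sub>\<infinity>i. a i f)" by blast
  then show "(\<lambda>f. \<Sum>\<^sub>\<infinity>i. a i f) \<in> X" using u(1) by simp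
  have "N u \<le> N (\<lambda>f. \<sigma> n f - u f) + sum b (F n)" for n
    using banach_triangle_diff[OF X u(1) sX banach_zero[OF X], of n] sN[of n] banach_norm_minus[OF X u(1) sX, of n]
    by simp
  then have "N u \<le> 0 + infsum b UNIV"
    by (intro LIMSEQ_le_const[OF tendsto_add[OF u(2) lim[OF b]]]) auto
  then show "N (\<lambda>f. \<Sum>\<^sub>\<infinity>i. a i f) \<le> (\<Sum>\<^sub>\<infinity>i. b i)" by (simp add: u_eq)
qed

text \<open>The Neumann series, in the form of the iteration \<open>u \<mapsto> g + E u\<close>.\<close>

lemma banach_neumann:
  assumes X: "banach_space_on X N"
    and E: "\<And>u. u \<in> X \<Longrightarrow> E u \<in> X"
    and E_diff: "\<And>u w. u \<in> X \<Longrightarrow> w \<in> X \<Longrightarrow> E (\<lambda>f. u f - w f) = (\<lambda>f. E u f - E w f)"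
    and E_le: "\<And>u. u \<in> X \<Longrightarrow> N (E u) \<le> r * N u" and r: "0 \<le> r" "r < 1" and g: "g \<in> X"
  shows "\<exists>u\<in>X. u = (\<lambda>f. g f + E u f)"
proof -
  define \<sigma> where "\<sigma> = rec_nat (\<lambda>f. 0) (\<lambda>_ u. (\<lambda>f. g f + E u f))"
  have s0: "\<sigma> 0 = (\<lambda>f. 0)" and sS: "\<sigma> (Suc n) = (\<lambda>f. g f + E (\<sigma> n) f)" for n
    by (simp_all add: \<sigma>_def)
  have s: "\<sigma> n \<in> X" for n
    by (induction n) (simp_all add: s0 sS banach_zero[OF X] banach_add[OF X g] E)
  have step_le: "N (\<lambda>f. \<sigma> (Suc n) f - \<sigma> n f) \<le> r ^ n * N (\<sigma> 1)" for n
  proof (induction n)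
    case (Suc n)
    have "(\<lambda>f. \<sigma> (Suc (Suc n)) f - \<sigma> (Suc n) f) = E (\<lambda>f. \<sigma> (Suc n) f - \<sigma> n f)"
      unfolding E_diff[OF s s] by (simp add: sS)
    then have "N (\<lambda>f. \<sigma> (Suc (Suc n)) f - \<sigma> (Suc n) f) \<le> r * N (\<lambda>f. \<sigma> (Suc n) f - \<sigma> n f)"
      using E_le[OF banach_diff[OF X s s]] by simp
    also have "\<dots> \<le> r * (r ^ n * N (\<sigma> 1))" using Suc r by (intro mult_left_mono)
    finally show ?case by simp
  qed (simp add: s0)
  define t where "t n = (\<Sum>k<n. r ^ k * N (\<sigma> 1))" for n
  obtain u where u: "u \<in> X" "(\<lambda>n. N (\<lambda>f. \<sigma> n f - u f)) \<longlonglongrightarrow> 0"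
  proof (rule banach_convergent[OF X s])
    have "summable (\<lambda>k. r ^ k * N (\<sigma> 1))" using r by (intro summable_mult2 summable_geometric) simp
    then show "convergent t" unfolding t_def summable_iff_convergent .
    fix m n :: nat assume "n \<le> m"
    then show "N (\<lambda>f. \<sigma> m f - \<sigma> n f) \<le> t m - t n"
    proof (induction m rule: dec_induct)
      case base
      then show ?case using banach_norm_zero[OF X banach_zero[OF X]] by simp
    next
      case (step m)
      have "N (\<lambda>f. \<sigma> (Suc m) f - \<sigma> n f) \<le> N (\<lambda>f. \<sigma> (Suc m) f - \<sigma> m f) + N (\<lambda>f. \<sigma> m f - \<sigma> n f)"
        by (rule banach_triangle_diff[OF X s s s])
      then show ?case using step.IH step_le[of m] by (simp add: t_def)
    qed
  qed
  let ?v = "\<lambda>f. g f + E u f"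
  have v: "?v \<in> X" by (intro banach_add[OF X g] E u)
  have "N (\<lambda>f. u f - ?v f) \<le> N (\<lambda>f. \<sigma> (Suc n) f - u f) + r * N (\<lambda>f. \<sigma> n f - u f)" for n
  proof -
    have "(\<lambda>f. \<sigma> (Suc n) f - ?v f) = E (\<lambda>f. \<sigma> n f - u f)"
      unfolding E_diff[OF s u(1)] by (simp add: sS)
    then have "N (\<lambda>f. \<sigma> (Suc n) f - ?v f) \<le> r * N (\<lambda>f. \<sigma> n f - u f)"
      using E_le[OF banach_diff[OF X s u(1)]] by simp
    then show ?thesis
      using banach_triangle_diff[OF X u(1) s v, of "Suc n"] banach_norm_minus[OF X u(1) s, of "Suc n"] by simp
  qed
  then have "N (\<lambda>f. u f - ?v f) \<le> 0 + r * 0"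
    by (intro LIMSEQ_le_const[OF tendsto_add[OF LIMSEQ_Suc[OF u(2)] tendsto_mult_left[OF u(2)]]]) auto
  then have "N (\<lambda>f. u f - ?v f) = 0"
    using banach_nonneg[OF X banach_diff[OF X u(1) v]] by simp
  then have "(\<lambda>f. u f - ?v f) = (\<lambda>f. 0)" using banach_norm_zero[OF X banach_diff[OF X u(1) v]] by blast
  then have "u = ?v" by (metis eq_iff_diff_eq_0)
  with u(1) show ?thesis by blast
qed

text \<open>Since \<open>N (Q u) \<le> r * N u\<close>, the operator \<open>A\<close> is bounded below by \<open>norm a * (1 - r)\<close>, hence injective,
  and this constant bounds the inverse. Surjectivity is the Neumann series.\<close>

lemma neumann_inverse:
  assumes X: "banach_space_on X N" and a: "a \<noteq> 0" and r: "0 \<le> r" "r < 1"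
    and Q: "\<And>u. u \<in> X \<Longrightarrow> Q u \<in> X"
    and Q_add: "\<And>u w. u \<in> X \<Longrightarrow> w \<in> X \<Longrightarrow> Q (\<lambda>f. u f + w f) = (\<lambda>f. Q u f + Q w f)"
    and Q_scale: "\<And>b u. u \<in> X \<Longrightarrow> Q (\<lambda>f. b * u f) = (\<lambda>f. b * Q u f)"
    and Q_le: "\<And>u. u \<in> X \<Longrightarrow> N (Q u) \<le> r * N u"
    and A_def: "A = (\<lambda>u\<in>X. \<lambda>f. a * (u f - Q u f))"
  shows "A \<in> bounded_operators X N"
    and "\<exists>B\<in>bounded_operators X N. (\<forall>u\<in>X. A (B u) = u \<and> B (A u) = u) \<and>
           operator_norm X N B \<le> 1 / (norm a * (1 - r))"
proof -
  have A: "A u = (\<lambda>f. a * (u f - Q u f))" if "u \<in> X" for u using that by (simp add: A_def)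
  have AX: "A u \<in> X" if "u \<in> X" for u
    unfolding A[OF that] by (rule banach_scale[OF X banach_diff[OF X that Q[OF that]]])
  have A_add: "A (\<lambda>f. u f + w f) = (\<lambda>f. A u f + A w f)" if "u \<in> X" "w \<in> X" for u w
    unfolding A[OF that(1)] A[OF that(2)] A[OF banach_add[OF X that]] Q_add[OF that]
    by (simp add: algebra_simps)
  have A_scale: "A (\<lambda>f. b * u f) = (\<lambda>f. b * A u f)" if "u \<in> X" for b u
    unfolding A[OF that] A[OF banach_scale[OF X that]] Q_scale[OF that] by (simp add: algebra_simps)
  have Q_diff: "Q (\<lambda>f. u f - w f) = (\<lambda>f. Q u f - Q w f)" if "u \<in> X" "w \<in> X" for u w
    using Q_add[OF that(1) banach_scale[OF X that(2), of "-1"]] Q_scale[OF that(2), of "-1"] by simp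
  have A_diff: "A (\<lambda>f. u f - w f) = (\<lambda>f. A u f - A w f)" if "u \<in> X" "w \<in> X" for u w
    using A_add[OF that(1) banach_scale[OF X that(2), of "-1"]] A_scale[OF that(2), of "-1"] by simp
  have upper: "N (A u) \<le> norm a * (1 + r) * N u" if u: "u \<in> X" for u
  proof -
    have "N (A u) = norm a * N (\<lambda>f. u f - Q u f)"
      unfolding A[OF u] by (rule banach_norm_scale[OF X banach_diff[OF X u Q[OF u]]])
    also have "N (\<lambda>f. u f - Q u f) \<le> N u + N (Q u)"
      using banach_triangle_diff[OF X u banach_zero[OF X] Q[OF u]]
        banach_norm_minus[OF X banach_zero[OF X] Q[OF u]] by simp
    then have "norm a * N (\<lambda>f. u f - Q u f) \<le> norm a * ((1 + r) * N u)"
      using Q_le[OF u] by (intro mult_left_mono) (auto simp: algebra_simps)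
    finally show ?thesis by (simp add: mult.assoc)
  qed
  have lower: "norm a * (1 - r) * N u \<le> N (A u)" if u: "u \<in> X" for u
  proof -
    have "N u \<le> N (\<lambda>f. u f - Q u f) + N (Q u)"
      using banach_triangle_diff[OF X u Q[OF u] banach_zero[OF X]] by simp
    then have "norm a * ((1 - r) * N u) \<le> norm a * N (\<lambda>f. u f - Q u f)"
      using Q_le[OF u] by (intro mult_left_mono) (auto simp: algebra_simps)
    also have "\<dots> = N (A u)"
      unfolding A[OF u] by (rule banach_norm_scale[OF X banach_diff[OF X u Q[OF u]], symmetric])
    finally show ?thesis by (simp add: mult.assoc)
  qed
  have pos: "norm a * (1 - r) > 0" using a r by simp
  have "A \<in> X \<rightarrow>\<^sub>E X" using AX unfolding A_def by (intro restrict_PiE_iff[THEN iffD2]) auto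
  then show "A \<in> bounded_operators X N"
    unfolding bounded_operators_def using A_add A_scale upper by blast
  have inj: "inj_on A X"
  proof (rule inj_onI)
    fix u w assume uw: "u \<in> X" "w \<in> X" "A u = A w"
    let ?d = "\<lambda>f. u f - w f"
    have d: "?d \<in> X" by (rule banach_diff[OF X uw(1,2)])
    have "N (A ?d) = 0"
      unfolding A_diff[OF uw(1,2)] uw(3) using banach_norm_zero[OF X banach_zero[OF X]] by simp
    then have "norm a * (1 - r) * N ?d \<le> 0" using lower[OF d] by simp
    then have "N ?d \<le> 0" using mult_pos_pos[OF pos, of "N ?d"] by linarith
    then have "?d = (\<lambda>f. 0)" using banach_nonneg[OF X d] banach_norm_zero[OF X d] by simp
    then show "u = w" by (metis eq_iff_diff_eq_0 ext)
  qed
  have surj: "g \<in> A ` X" if g: "g \<in> X" for g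
  proof -
    obtain u where u: "u \<in> X" "u = (\<lambda>f. (1 / a) * g f + Q u f)"
      using banach_neumann[where E = Q and r = r, OF X Q Q_diff Q_le r banach_scale[OF X g, of "1 / a"]] by blast
    have "A u f = g f" for f
    proof -
      have "u f - Q u f = (1 / a) * g f" using fun_cong[OF u(2), of f] by (simp add: algebra_simps)
      then show ?thesis using a by (simp add: A[OF u(1)])
    qed
    then show ?thesis using u(1) by (metis ext image_eqI)
  qed
  define B where "B = (\<lambda>g\<in>X. inv_into X A g)"
  have B: "B g \<in> X" "A (B g) = g" if "g \<in> X" for g
    using inv_into_into[OF surj[OF that]] f_inv_into_f[OF surj[OF that]] that by (auto simp: B_def)
  have BA: "B (A u) = u" if "u \<in> X" for u using inv_into_f_f[OF inj that] AX[OF that] by (simp add: B_def)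
  have B_eq: "B g = u" if "u \<in> X" "A u = g" for u g using BA[OF that(1)] that(2) by simp
  have B_le: "N (B g) \<le> 1 / (norm a * (1 - r)) * N g" if "g \<in> X" for g
    using lower[OF B(1)[OF that]] pos unfolding B(2)[OF that] by (simp add: field_simps)
  have "B \<in> bounded_operators X N"
    unfolding bounded_operators_def
  proof (intro CollectI conjI ballI allI)
    show "B \<in> X \<rightarrow>\<^sub>E X" using B(1) by (auto simp: B_def)
    show "B (\<lambda>f. u f + w f) = (\<lambda>f. B u f + B w f)" if "u \<in> X" "w \<in> X" for u w
      using that by (intro B_eq banach_add[OF X] B(1)) (simp_all add: A_add B)
    show "B (\<lambda>f. b * u f) = (\<lambda>f. b * B u f)" if "u \<in> X" for b u
      using that by (intro B_eq banach_scale[OF X] B(1)) (simp_all add: A_scale B)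
    show "\<exists>K. \<forall>u\<in>X. N (B u) \<le> K * N u" using B_le by blast
  qed
  moreover have "operator_norm X N B \<le> 1 / (norm a * (1 - r))"
    unfolding operator_norm_def
  proof (rule cSUP_least)
    show "{u \<in> X. N u \<le> 1} \<noteq> {}"
      using banach_zero[OF X] banach_norm_zero[OF X banach_zero[OF X]] by force
    fix g assume "g \<in> {u \<in> X. N u \<le> 1}"
    then have g: "g \<in> X" "N g \<le> 1" by auto
    have "1 / (norm a * (1 - r)) * N g \<le> 1 / (norm a * (1 - r)) * 1"
      using g(2) pos by (intro mult_left_mono) auto
    then show "N (B g) \<le> 1 / (norm a * (1 - r))" using B_le[OF g(1)] by simp
  qed
  ultimately show "\<exists>B\<in>bounded_operators X N. (\<forall>u\<in>X. A (B u) = u \<and> B (A u) = u) \<and>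
      operator_norm X N B \<le> 1 / (norm a * (1 - r))"
    using B BA by (intro bexI[of _ B] conjI ballI) auto
qed

lemma bounded_operator_diff:
  assumes X: "banach_space_on X N" and A: "A \<in> bounded_operators X N" and u: "u \<in> X" "w \<in> X"
  shows "A (\<lambda>f. u f - w f) = (\<lambda>f. A u f - A w f)"
proof -
  have add: "A (\<lambda>f. u f + w f) = (\<lambda>f. A u f + A w f)" if "u \<in> X" "w \<in> X" for u w
    using A that unfolding bounded_operators_def by blast
  have scale: "A (\<lambda>f. a * u f) = (\<lambda>f. a * A u f)" if "u \<in> X" for a u
    using A that unfolding bounded_operators_def by blast
  show ?thesis
    using add[OF u(1) banach_scale[OF X u(2), of "-1"]] scale[OF u(2), of "-1"] by simp
qed

text \<open>The Schwartz functions are dense in \<open>X\<close>.\<close>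

lemma bounded_extension_unique:
  assumes tfs: "tfs_invariant X N v C"
    and A: "A \<in> bounded_operators X N" "extends_schwartz_operator A T"
    and A': "A' \<in> bounded_operators X N" "extends_schwartz_operator A' T"
  shows "A' = A"
proof
  have X: "banach_space_on X N" using tfs by (simp add: tfs_invariant_def)
  have S: "dist_of_fun f \<in> X" if "f \<in> schwartz_functions" for f
    using tfs that by (auto simp: tfs_invariant_def)
  have dense: "\<exists>f\<in>schwartz_functions. N (\<lambda>g. u g - dist_of_fun f g) < e" if "u \<in> X" "e > 0" for u e
    using tfs that by (simp add: tfs_invariant_def)
  obtain B where B: "\<And>u. u \<in> X \<Longrightarrow> N (A u) \<le> B * N u"
    using A(1) unfolding bounded_operators_def by blast
  obtain B' where B': "\<And>u. u \<in> X \<Longrightarrow> N (A' u) \<le> B' * N u"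
    using A'(1) unfolding bounded_operators_def by blast
  have mem: "A u \<in> X" "A' u \<in> X" if "u \<in> X" for u
    using A(1) A'(1) that unfolding bounded_operators_def by auto
  fix u
  show "A' u = A u"
  proof (cases "u \<in> X")
    case u: True
    have "N (\<lambda>g. A' u g - A u g) \<le> 0"
    proof (rule field_le_epsilon)
      fix e :: real assume e: "e > 0"
      define d where "d = e / (\<bar>B\<bar> + \<bar>B'\<bar> + 1)"
      have pos: "\<bar>B\<bar> + \<bar>B'\<bar> + 1 > 0" by simp
      have d: "d > 0" using e pos by (simp add: d_def)
      obtain f where f: "f \<in> schwartz_functions" "N (\<lambda>g. u g - dist_of_fun f g) < d"
        using dense[OF u d] by blast
      let ?w = "\<lambda>g. u g - dist_of_fun f g"
      have w: "?w \<in> X" by (rule banach_diff[OF X u S[OF f(1)]])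
      have eq: "A' (dist_of_fun f) = A (dist_of_fun f)"
        using A(2) A'(2) f(1) by (simp add: extends_schwartz_operator_def)
      have "(\<lambda>g. A' u g - A u g) = (\<lambda>g. A' ?w g - A ?w g)"
        unfolding bounded_operator_diff[OF X A(1) u S[OF f(1)]] bounded_operator_diff[OF X A'(1) u S[OF f(1)]] eq
        by simp
      then have "N (\<lambda>g. A' u g - A u g) \<le> N (A' ?w) + N (A ?w)"
        using banach_triangle_diff[OF X mem(2)[OF w] banach_zero[OF X] mem(1)[OF w]]
          banach_norm_minus[OF X banach_zero[OF X] mem(1)[OF w]] by simp
      also have "\<dots> \<le> B' * N ?w + B * N ?w" by (intro add_mono B[OF w] B'[OF w])
      also have "\<dots> \<le> \<bar>B'\<bar> * d + \<bar>B\<bar> * d"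
      proof (intro add_mono)
        have "b * N ?w \<le> \<bar>b\<bar> * d" for b
          using banach_nonneg[OF X w] f(2) by (intro mult_mono) auto
        then show "B' * N ?w \<le> \<bar>B'\<bar> * d" "B * N ?w \<le> \<bar>B\<bar> * d" by auto
      qed
      also have "\<dots> \<le> (\<bar>B\<bar> + \<bar>B'\<bar> + 1) * d" using d by (simp add: algebra_simps)
      also have "\<dots> = e" using pos by (simp add: d_def)
      finally show "N (\<lambda>g. A' u g - A u g) \<le> 0 + e" by simp
    qed
    moreover have D: "(\<lambda>g. A' u g - A u g) \<in> X" by (rule banach_diff[OF X mem(2)[OF u] mem(1)[OF u]])
    ultimately have "(\<lambda>g. A' u g - A u g) = (\<lambda>g. 0)"
      using banach_nonneg[OF X D] banach_norm_zero[OF X D] by simp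
    then show ?thesis by (metis eq_iff_diff_eq_0 ext)
  next
    case False
    then show ?thesis using A(1) A'(1) unfolding bounded_operators_def by (auto simp: PiE_def extensional_def)
  qed
qed

lemma Op_character_sum:
  assumes c: "(\<lambda>\<kappa>. norm (c \<kappa>)) summable_on UNIV"
    and f: "f \<in> schwartz_functions" and g: "g \<in> schwartz_functions"
  shows "Op \<tau> (character_sum c \<zeta>) f g = (\<Sum>\<^sub>\<infinity>\<kappa>. c \<kappa> *
    (character (fst_part (\<zeta> \<kappa>)) (\<tau> *\<^sub>R snd_part (\<zeta> \<kappa>)) * tf_shift (symplectic_J *v \<zeta> \<kappa>) (dist_of_fun f) g))"
  unfolding Op_eq[OF f g] Op_character[OF f g, symmetric]
  using schwartz_inv_fourier_snd[OF schwartz_kernel_pullback[OF f g, of \<tau>]]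
  by (simp add: character_sum_def inv_fourier_def)

lemma polynomial_weight_ge_1: "polynomial_weight v \<Longrightarrow> v z \<ge> 1"
  unfolding polynomial_weight_def by (auto intro!: ge_one_powr_ge_zero)

lemma
  fixes f :: "'i \<Rightarrow> 'b::banach"
  assumes "f summable_on (UNIV - {k})"
  shows summable_on_remove: "(\<lambda>i. if i = k then 0 else f i) summable_on UNIV"
    and infsum_remove: "(\<Sum>\<^sub>\<infinity>i. if i = k then 0 else f i) = infsum f (UNIV - {k})"
    and summable_on_insert_point: "f summable_on UNIV"
    and infsum_insert_point: "infsum f UNIV = f k + infsum f (UNIV - {k})"
proof -
  have e: "((\<lambda>i. if i = k then 0 else f i) has_sum x) UNIV \<longleftrightarrow> (f has_sum x) (UNIV - {k})" for x
    by (rule has_sum_cong_neutral) auto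
  show "(\<lambda>i. if i = k then 0 else f i) summable_on UNIV"
    using assms by (simp add: summable_on_def e)
  show "(\<Sum>\<^sub>\<infinity>i. if i = k then 0 else f i) = infsum f (UNIV - {k})"
    by (rule infsum_cong_neutral) auto
  have U: "insert k (UNIV - {k}) = UNIV" by auto
  have "(f has_sum (f k + infsum f (UNIV - {k}))) (insert k (UNIV - {k}))"
    using has_sum_infsum[OF assms] by (subst has_sum_insert) auto
  then have "(f has_sum (f k + infsum f (UNIV - {k}))) UNIV" unfolding U .
  then show "f summable_on UNIV" "infsum f UNIV = f k + infsum f (UNIV - {k})"
    by (auto intro: has_sum_imp_summable infsumI)
qed


text \<open>The bound \<open>C * v z\<close> on the norm of a time frequency shift turns summability with the weight \<open>v\<close> into absolute
  convergence in \<open>X\<close>.\<close>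

lemma
  fixes d :: "'i::countable \<Rightarrow> complex" and z :: "'i \<Rightarrow> real^('n::finite+'n)"
  assumes tfs: "tfs_invariant X N v C" and d: "(\<lambda>i. norm (d i) * v (z i)) summable_on UNIV" and u: "u \<in> X"
  shows tf_shift_sum_summable: "(\<lambda>i. d i * tf_shift (z i) u g) summable_on UNIV"
    and tf_shift_sum_mem: "(\<lambda>g. \<Sum>\<^sub>\<infinity>i. d i * tf_shift (z i) u g) \<in> X"
    and tf_shift_sum_le: "N (\<lambda>g. \<Sum>\<^sub>\<infinity>i. d i * tf_shift (z i) u g) \<le> C * (\<Sum>\<^sub>\<infinity>i. norm (d i) * v (z i)) * N u"
proof -
  have X: "banach_space_on X N" and temp: "X \<subseteq> tempered_distributions"
    and ev: "\<And>f. f \<in> schwartz_functions \<Longrightarrow> \<exists>B. \<forall>u\<in>X. norm (u f) \<le> B * N u"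
    and shift: "tf_shift y u \<in> X" "N (tf_shift y u) \<le> C * v y * N u" for y
    using tfs u by (simp_all add: tfs_invariant_def)
  let ?a = "\<lambda>i g. d i * tf_shift (z i) u g" and ?b = "\<lambda>i. norm (d i) * v (z i) * (C * N u)"
  have a: "?a i \<in> X" for i by (rule banach_scale[OF X shift(1)])
  have le: "N (?a i) \<le> ?b i" for i
  proof -
    have "N (?a i) = norm (d i) * N (tf_shift (z i) u)" by (rule banach_norm_scale[OF X shift(1)])
    also have "\<dots> \<le> norm (d i) * (C * v (z i) * N u)" by (intro mult_left_mono shift(2)) simp
    finally show ?thesis by (simp add: mult_ac)
  qed
  have b: "?b summable_on UNIV" by (rule summable_on_cmult_left[OF d])
  note * = banach_absolutely_convergent_sum[of X N ?a ?b, OF X temp ev a le b]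
  show "(\<lambda>i. ?a i g) summable_on UNIV" "(\<lambda>g. \<Sum>\<^sub>\<infinity>i. ?a i g) \<in> X" by (rule *; assumption)+
  have "N (\<lambda>g. \<Sum>\<^sub>\<infinity>i. ?a i g) \<le> infsum ?b UNIV" by (rule *; assumption)
  also have "\<dots> = (\<Sum>\<^sub>\<infinity>i. norm (d i) * v (z i)) * (C * N u)" by (rule infsum_cmult_left[OF d])
  finally show "N (\<lambda>g. \<Sum>\<^sub>\<infinity>i. ?a i g) \<le> C * (\<Sum>\<^sub>\<infinity>i. norm (d i) * v (z i)) * N u" by (simp add: mult_ac)
qed

lemma tf_shift_zero: "tf_shift (0 :: real^('n::finite+'n)) u = u"
proof -
  have "fst_part (0 :: real^('n+'n)) = 0" "snd_part (0 :: real^('n+'n)) = 0"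
    by (simp_all add: fst_part_def snd_part_def zero_vec_def)
  then show ?thesis by (simp add: tf_shift_eq)
qed

theorem theorem5p1:
  fixes X :: "'d::finite functional set"
    and N :: "'d functional \<Rightarrow> real"
    and v :: "real^('d+'d) \<Rightarrow> real"
    and C :: real
    and L :: "real^('d+'d)^('d+'d)"
    and p :: "('d+'d) functional"
    and c :: "int^('d+'d) \<Rightarrow> complex"
    and w :: "int^('d+'d) \<Rightarrow> real"
    and \<tau> :: real
  defines "c \<equiv> fourier_coeff L p"
    and "w \<equiv> (\<lambda>\<kappa>. v (symplectic_J *v (transpose (matrix_inv L) *v of_int_vec \<kappa>)))"
  assumes "tfs_invariant X N v C"
    and "invertible L"
    and "p \<in> periodic_distributions L"
    and "c 0 \<noteq> 0"
    and "(\<lambda>\<kappa>. norm (c \<kappa>) * w \<kappa>) summable_on (UNIV - {0})"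
    and "(\<Sum>\<^sub>\<infinity>\<kappa>\<in>UNIV - {0}. norm (c \<kappa>) * w \<kappa>) < norm (c 0) / C"
    and "0 \<le> \<tau>" and "\<tau> \<le> 1"
  shows "\<exists>A \<in> bounded_operators X N.
           extends_schwartz_operator A (Op \<tau> (tempered_extension p)) \<and>
           (\<forall>A' \<in> bounded_operators X N.
              extends_schwartz_operator A' (Op \<tau> (tempered_extension p)) \<longrightarrow> A' = A) \<and>
           (\<exists>B \<in> bounded_operators X N.
              (\<forall>u\<in>X. A (B u) = u \<and> B (A u) = u) \<and>
              operator_norm X N B
                \<le> 1 / ((1 + C * v 0) * norm (c 0) - C * (\<Sum>\<^sub>\<infinity>\<kappa>. w \<kappa> * norm (c \<kappa>))))"
proof -
  note tfs = assms(3) and c0 = assms(6) and sum = assms(7) and small = assms(8)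
  define \<zeta> where "\<zeta> \<kappa> = transpose (matrix_inv L) *v of_int_vec \<kappa>" for \<kappa>
  define z where "z \<kappa> = symplectic_J *v \<zeta> \<kappa>" for \<kappa>
  define \<eta> where "\<eta> \<kappa> = character (fst_part (\<zeta> \<kappa>)) (\<tau> *\<^sub>R snd_part (\<zeta> \<kappa>))" for \<kappa>
  define q where "q = (\<Sum>\<^sub>\<infinity>\<kappa>\<in>UNIV - {0}. norm (c \<kappa>) * w \<kappa>)"
  \<comment> \<open>\<open>d\<close> collects the terms with \<open>\<kappa> \<noteq> 0\<close>, normalized so that the operator is \<open>c 0\<close> times the identity minus \<open>Q\<close>.\<close>
  define d where "d \<kappa> = (if \<kappa> = 0 then 0 else - (c \<kappa> * \<eta> \<kappa> / c 0))" for \<kappa>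
  define Q where "Q u = (\<lambda>g. \<Sum>\<^sub>\<infinity>\<kappa>. d \<kappa> * tf_shift (z \<kappa>) u g)" for u
  define A where "A = (\<lambda>u\<in>X. \<lambda>g. c 0 * (u g - Q u g))"
  define r where "r = C * q / norm (c 0)"
  have X: "banach_space_on X N" and temp: "X \<subseteq> tempered_distributions"
    and S: "\<And>f. f \<in> schwartz_functions \<Longrightarrow> dist_of_fun f \<in> X" and v: "polynomial_weight v" and C: "C > 0"
    using tfs by (auto simp: tfs_invariant_def)
  have zero: "\<zeta> 0 = 0" "z 0 = 0" "\<eta> 0 = 1" "w 0 = v 0"
    by (simp_all add: \<zeta>_def z_def \<eta>_def w_def of_int_vec_zero fst_part_def snd_part_def zero_vec_def[symmetric])
  have w: "w \<kappa> = v (z \<kappa>)" and w1: "w \<kappa> \<ge> 1" for \<kappa>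
    using polynomial_weight_ge_1[OF v] by (simp_all add: w_def z_def \<zeta>_def)

  \<comment> \<open>The weight is at least 1, so the coefficients are summable without it.\<close>
  have "(\<lambda>\<kappa>. norm (c \<kappa>)) summable_on UNIV"
  proof (rule summable_on_comparison_test[OF summable_on_insert_point[OF sum]])
    fix \<kappa> show "norm (c \<kappa>) \<le> norm (c \<kappa>) * w \<kappa>" using mult_left_mono[OF w1[of \<kappa>] norm_ge_zero[of "c \<kappa>"]] by simp
  qed simp
  then have c: "(\<lambda>\<kappa>. norm (c \<kappa>)) summable_on UNIV" .
  have p: "tempered_extension p = character_sum c \<zeta>"
    using tempered_extension_periodic[OF assms(4,5)] c by (simp add: c_def \<zeta>_def[abs_def])

  have d_eq: "norm (d \<kappa>) * v (z \<kappa>) = (if \<kappa> = 0 then 0 else norm (c \<kappa>) * w \<kappa>) * (1 / norm (c 0))" for \<kappa>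
    by (simp add: d_def \<eta>_def w norm_mult norm_divide)
  have d: "(\<lambda>\<kappa>. norm (d \<kappa>) * v (z \<kappa>)) summable_on UNIV"
    unfolding d_eq by (rule summable_on_cmult_left[OF summable_on_remove[OF sum]])
  have d_sum: "C * (\<Sum>\<^sub>\<infinity>\<kappa>. norm (d \<kappa>) * v (z \<kappa>)) = r"
    unfolding d_eq infsum_cmult_left[OF summable_on_remove[OF sum]] infsum_remove[OF sum]
    by (simp add: r_def q_def)
  have q0: "q \<ge> 0"
    unfolding q_def using w1 by (intro infsum_nonneg mult_nonneg_nonneg) (auto intro: order_trans[of 0 1])
  have r: "0 \<le> r" "r < 1"
    using q0 C small[folded q_def] c0 by (simp_all add: r_def field_simps)
  note Q_summable = tf_shift_sum_summable[OF tfs d]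
  have Q_add: "Q (\<lambda>f. u f + w f) = (\<lambda>f. Q u f + Q w f)" if "u \<in> X" "w \<in> X" for u w
    unfolding Q_def infsum_add[OF Q_summable[OF that(1)] Q_summable[OF that(2)], symmetric]
    by (simp add: tf_shift_eq distrib_left)
  have Q_scale: "Q (\<lambda>f. b * u f) = (\<lambda>f. b * Q u f)" if "u \<in> X" for b u
    unfolding Q_def infsum_cmult_right[OF Q_summable[OF that], symmetric]
    by (simp add: tf_shift_eq mult.left_commute)
  note inverse = neumann_inverse[OF X c0 r tf_shift_sum_mem[OF tfs d, folded Q_def] Q_add Q_scale
      tf_shift_sum_le[OF tfs d, unfolded d_sum, folded Q_def] A_def]

  have ext: "extends_schwartz_operator A (Op \<tau> (tempered_extension p))"
    unfolding extends_schwartz_operator_def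
  proof (intro ballI ext)
    fix f :: "real^'d \<Rightarrow> complex" and g assume f: "f \<in> schwartz_functions"
    let ?u = "dist_of_fun f" and ?t = "\<lambda>\<kappa>. c \<kappa> * (\<eta> \<kappa> * tf_shift (z \<kappa>) (dist_of_fun f) g)"
    show "A ?u g = Op \<tau> (tempered_extension p) f g"
    proof (cases "g \<in> schwartz_functions")
      case True
      have "?t summable_on (UNIV - {0})"
      proof (rule summable_on_cong[THEN iffD2])
        show "(\<lambda>\<kappa>. - c 0 * (d \<kappa> * tf_shift (z \<kappa>) ?u g)) summable_on (UNIV - {0})"
          by (rule summable_on_cmult_right[OF summable_on_subset_banach[OF Q_summable[OF S[OF f]]]]) simp
      qed (use c0 in \<open>simp add: d_def\<close>)
      then have "infsum ?t UNIV = c 0 * ?u g + infsum ?t (UNIV - {0})"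
        by (simp add: infsum_insert_point[of ?t 0] zero tf_shift_zero)
      also have "infsum ?t (UNIV - {0}) = (\<Sum>\<^sub>\<infinity>\<kappa>. - c 0 * (d \<kappa> * tf_shift (z \<kappa>) ?u g))"
        by (rule infsum_cong_neutral) (use c0 in \<open>auto simp: d_def\<close>)
      also have "\<dots> = - c 0 * Q ?u g"
        unfolding Q_def by (rule infsum_cmult_right[OF Q_summable[OF S[OF f]]])
      finally have "c 0 * (?u g - Q ?u g) = infsum ?t UNIV" by (simp add: algebra_simps)
      moreover have "A ?u g = c 0 * (?u g - Q ?u g)" by (simp only: A_def restrict_apply S[OF f] if_True)
      moreover have "Op \<tau> (character_sum c \<zeta>) f g = infsum ?t UNIV"
        unfolding z_def \<eta>_def by (rule Op_character_sum[OF c f True])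
      ultimately show ?thesis unfolding p by simp
    next
      case False
      \<comment> \<open>Elements of \<open>X\<close> and values of \<open>Op\<close> both vanish at functions that are not Schwartz functions.\<close>
      have "A ?u \<in> X" using inverse(1) S[OF f] unfolding bounded_operators_def by blast
      then have "A ?u g = 0"
        using temp False unfolding tempered_distributions_def linear_functional_on_def by blast
      then show ?thesis using False by (simp add: Op_def)
    qed
  qed

  have "(\<Sum>\<^sub>\<infinity>\<kappa>. w \<kappa> * norm (c \<kappa>)) = norm (c 0) * v 0 + q"
    using infsum_insert_point[OF sum] by (simp add: zero q_def mult.commute)
  then have bound: "(1 + C * v 0) * norm (c 0) - C * (\<Sum>\<^sub>\<infinity>\<kappa>. w \<kappa> * norm (c \<kappa>)) = norm (c 0) * (1 - r)"
    using c0 by (simp add: r_def field_simps)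
  have "\<forall>A' \<in> bounded_operators X N.
      extends_schwartz_operator A' (Op \<tau> (tempered_extension p)) \<longrightarrow> A' = A"
    by (intro ballI impI) (rule bounded_extension_unique[OF tfs inverse(1) ext])
  with inverse ext show ?thesis unfolding bound by blast
qed

end
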